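(* Let $r$ be a positive integer, let $\lambda=[\lambda_1,\ldots,\lambda_n]$ be a partition of $r$ of length $n$, let $j$ be an integer with $0\le j\le\min\{n,r-n-1\}$, and set $d=r+n-j$. If $j\le n-m_1(\lambda)$, then the following equalities hold set-theoretically in $\mathbb{P}^d=\mathbb{P}(\mathbb{C}[x,y]_d)$: $$\overline{\varPsi_{d,r}^{-1}(\mathrm{CH}_j(\Delta_\lambda))}=\bigcup_{\lambda'\in\mathcal{F}_j(\lambda)}\overline{\varPsi_{d,r-j}^{-1}(\mathrm{CH}_0(\Delta_{\lambda'}))}=\bigcup_{\lambda'\in\mathcal{F}_j(\lambda)}(\Delta_{(\lambda'_1+1,\ldots,\lambda'_n+1)})^\vee.$$
   Context: Everything is over $\mathbb{C}$. Write $R=\mathbb{C}[x,y]$ and $D=\mathbb{C}[\partial_x,\partial_y]$, with $D$ acting on $R$ by differentiation. $\mathbb{G}(l,\mathbb{P}^N)=\mathbb{G}(l,N)$ is the Grassmannian of $l$-dimensional projective subspaces of $\mathbb{P}^N$. Bars denote closures. Partitions. A partition of $s$ is an unordered list of positive integers with sum $s$; $|\lambda|$ denotes the length and $m_1(\lambda)$ the number of parts equal to $1$. For $\lambda=[\lambda_1,\ldots,\lambda_n]$ and $0\le j\le n-m_1(\lambda)$, $$\mathcal{F}_j(\lambda)=\{\lambda'=[\lambda_1-\iota_1,\ldots,\lambda_n-\iota_n]:\iota_i\in\{0,1\},\ \iota_1+\cdots+\iota_n=j,\ |\lambda'|=n\},$$ that is, all the entries $\lambda_i-\iota_i$ are required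 to be positive. Elements of $\mathcal{F}_j(\lambda)$ are partitions $\lambda'=[\lambda'_1,\ldots,\lambda'_n]$ of $r-j$. Coincident root loci and duals. For a partition $\mu=[\mu_1,\ldots,\mu_m]$ of $s$, $\Delta_\mu\subset\mathbb{P}^s=\mathbb{P}(D_s)$ is the $m$-dimensional irreducible variety of forms of degree $s$ (up to scalars) that factor as $\prod_{i=1}^m\ell_i^{\mu_i}$ with $\ell_i$ nonzero linear forms. Its dual variety $(\Delta_\mu)^\vee\subset\mathbb{P}(R_s)$ is the closure of the set of $f$ such that the hyperplane $\{g:g(f)=0\}\subset\mathbb{P}(D_s)$ contains the projective tangent space to $\Delta_\mu$ at some smooth point. Apolar maps. For $f\in R_d$ let $(f^\perp)_s=\{g\in D_s: g(f)=0\}$. For $d\ge s\ge d-s$, the linear map $D_s\to R_{d-s}$, $g\mapsto g(f)$, has maximal rank $d-s+1$ for general $f$, and the apolar map is the rational map $$\varPsi_{d,s}:\mathbb{P}^d=\mathbb{P}(R_d)\dashrightarrow\mathbb{G}(2s-d-1,\mathbb{P}(D_s)),\qquad f\mapsto\mathbb{P}((f^\perp)_s),$$ defined on the locus where this linear map has maximal rank; preimages are taken in this locus. Higher associated varieties. Let $X\subset\mathbb{P}^N$ be an irreducible projective variety of dimension $m$, with embedded projective tangent space $T_xX$ at $x$. For $0\le j\le m$, $\mathrm{CH}_j(X)\subset\mathbb{G}(N-m-1+j,N)$ is the closure of the set of $(N-m-1+j)$-dimensional subspaces $H$ such that $H\cap X\ne\emptyset$ and $\dim(H\cap T_xX)\ge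 j$ for some smooth point $x\in H\cap X$. Here $\mathrm{CH}_j(\Delta_\lambda)$ is formed with $\Delta_\lambda\subset\mathbb{P}^r$ and $\mathrm{CH}_0(\Delta_{\lambda'})$ with $\Delta_{\lambda'}\subset\mathbb{P}^{r-j}$. *)

theory Defs
  imports Complex_Main "HOL-Library.Multiset" "HOL-Computational_Algebra.Polynomial"
    "Jordan_Normal_Form.Determinant"
begin

section \<open>Binary forms and the differentiation action\<close>

text \<open>
  Both $R = C[x,y]$ and $D = C[\partial_x,\partial_y]$ are represented as $C[x][y]$: the outer
  polynomial variable is $y$ (resp. $\partial_y$), the inner one is $x$ (resp. $\partial_x$).
\<close>

type_synonym bpoly = "complex poly poly"

text \<open>The coefficient at $x^i y^k$.\<close>

definition bcoeff :: "bpoly \<Rightarrow> nat \<times> nat \<Rightarrow> complex" where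
  "bcoeff f = (\<lambda>(i, k). poly.coeff (poly.coeff f k) i)"

definition cscale :: "complex \<Rightarrow> bpoly \<Rightarrow> bpoly" (infixr "*\<^sub>b" 75) where
  "c *\<^sub>b f = Polynomial.smult [:c:] f"

global_interpretation bp: vector_space cscale
proof
  show "(a + b) *\<^sub>b x = a *\<^sub>b x + b *\<^sub>b x" for a b x
    unfolding cscale_def by (metis add_pCons add_0 smult_add_left)
  show "1 *\<^sub>b x = x" for x
    unfolding cscale_def by (metis one_pCons smult_1_left)
qed (simp_all add: cscale_def smult_add_right mult.commute)

definition forms :: "nat \<Rightarrow> bpoly set" where
  "forms s = {f. \<forall>i k. bcoeff f (i, k) \<noteq> 0 \<longrightarrow> i + k = s}"

definition dx :: "bpoly \<Rightarrow> bpoly" where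
  "dx = map_poly pderiv"

definition dy :: "bpoly \<Rightarrow> bpoly" where
  "dy = pderiv"

definition diff_action :: "bpoly \<Rightarrow> bpoly \<Rightarrow> bpoly" where
  "diff_action g f =
     (\<Sum>k\<le>Polynomial.degree g. \<Sum>i\<le>Polynomial.degree (poly.coeff g k). bcoeff g (i, k) *\<^sub>b (dx ^^ i) ((dy ^^ k) f))"


section \<open>Projective spaces, Grassmannians and their Zariski topology\<close>

text \<open>
  A projective subspace of $P(V)$ of dimension $l$ is given by the linear subspace of $V$ of
  dimension $l+1$; points of $P(V)$ are the lines through the origin.
\<close>

definition Gr :: "int \<Rightarrow> bpoly set \<Rightarrow> bpoly set set" where
  "Gr l V = {W. bp.subspace W \<and> W \<subseteq> V \<and> int (bp.dim W) = l + 1}"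

definition PP :: "bpoly set \<Rightarrow> bpoly set set" where
  "PP V = Gr 0 V"

text \<open>Homogeneous polynomials of a given degree in variables indexed by \<open>'i\<close>, as functions
  (each involves finitely many variables).\<close>

inductive homog_poly :: "nat \<Rightarrow> (('i \<Rightarrow> complex) \<Rightarrow> complex) \<Rightarrow> bool" where
  const: "homog_poly 0 (\<lambda>z. c)"
| var: "homog_poly 1 (\<lambda>z. z i)"
| add: "homog_poly e F \<Longrightarrow> homog_poly e G \<Longrightarrow> homog_poly e (\<lambda>z. F z + G z)"
| mult: "homog_poly e F \<Longrightarrow> homog_poly e' G \<Longrightarrow> homog_poly (e + e') (\<lambda>z. F z * G z)"

text \<open>
  \<open>hc p\<close> is the set of all systems of homogeneous coordinates of the point \<open>p\<close> of \<open>U\<close>. The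
  closure is the zero locus of all homogeneous polynomials vanishing on \<open>A\<close>.
\<close>

definition zariski_closure ::
    "('p \<Rightarrow> ('i \<Rightarrow> complex) set) \<Rightarrow> 'p set \<Rightarrow> 'p set \<Rightarrow> 'p set" where
  "zariski_closure hc U A =
     {p \<in> U. \<forall>e F. homog_poly e F \<longrightarrow> (\<forall>a\<in>A. \<forall>z\<in>hc a. F z = 0) \<longrightarrow> (\<forall>z\<in>hc p. F z = 0)}"

definition point_coords :: "bpoly set \<Rightarrow> (nat \<times> nat \<Rightarrow> complex) set" where
  "point_coords L = bcoeff ` (L - {0})"

definition proj_closure :: "bpoly set \<Rightarrow> bpoly set set \<Rightarrow> bpoly set set" where
  "proj_closure V A = zariski_closure point_coords (PP V) A"

text \<open>
  Pluecker coordinates: the maximal minors of the coefficient matrix of an ordered basis \<open>B\<close>.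
  The columns are selected by \<open>I\<close>, of which only \<open>I 0, \<dots>, I (length B - 1)\<close> matter.
\<close>

definition pluecker :: "bpoly list \<Rightarrow> (nat \<Rightarrow> nat \<times> nat) \<Rightarrow> complex" where
  "pluecker B = (\<lambda>I. det (mat (length B) (length B) (\<lambda>(a, b). bcoeff (B ! a) (I b))))"

definition pluecker_coords :: "bpoly set \<Rightarrow> ((nat \<Rightarrow> nat \<times> nat) \<Rightarrow> complex) set" where
  "pluecker_coords W =
     pluecker ` {B. distinct B \<and> bp.independent (set B) \<and> bp.span (set B) = W}"

definition Gr_closure :: "int \<Rightarrow> bpoly set \<Rightarrow> bpoly set set \<Rightarrow> bpoly set set" where
  "Gr_closure l V A = zariski_closure pluecker_coords (Gr l V) A"


section \<open>Tangent spaces, dual varieties and higher associated varieties\<close>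

text \<open>
  The embedded tangent space at \<open>x\<close> of \<open>X\<close> in $P(V)$, as a linear subspace of \<open>V\<close>: the common
  kernel of the differentials at \<open>x\<close> of all homogeneous polynomials vanishing on \<open>X\<close>.
\<close>

definition tangent :: "bpoly set \<Rightarrow> bpoly set set \<Rightarrow> bpoly set \<Rightarrow> bpoly set" where
  "tangent V X x =
     {v \<in> V. \<forall>e F. homog_poly e F \<longrightarrow> (\<forall>p\<in>X. \<forall>z\<in>point_coords p. F z = 0) \<longrightarrow>
        (\<forall>a\<in>x - {0}. ((\<lambda>t. F (bcoeff (a + t *\<^sub>b v))) has_field_derivative 0) (at 0))}"

text \<open>In the following, \<open>m\<close> is the dimension of the variety \<open>X\<close>.\<close>

definition smooth_points :: "bpoly set \<Rightarrow> nat \<Rightarrow> bpoly set set \<Rightarrow> bpoly set set" where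
  "smooth_points V m X = {x \<in> X. bp.dim (tangent V X x) = m + 1}"

text \<open>For \<open>X\<close> in $P^N = P(D_N)$; a subspace of projective dimension at least \<open>j\<close> has linear
  dimension at least \<open>j + 1\<close>.\<close>

definition CH :: "nat \<Rightarrow> nat \<Rightarrow> nat \<Rightarrow> bpoly set set \<Rightarrow> bpoly set set" where
  "CH N m j X =
     (let l = int N - int m - 1 + int j in
      Gr_closure l (forms N)
        {H \<in> Gr l (forms N). \<exists>x \<in> smooth_points (forms N) m X.
           x \<subseteq> H \<and> j + 1 \<le> bp.dim (H \<inter> tangent (forms N) X x)})"

text \<open>$(f^\perp)_s$ for the point \<open>L\<close> spanned by \<open>f\<close>.\<close>

definition perp :: "nat \<Rightarrow> bpoly set \<Rightarrow> bpoly set" where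
  "perp s L = {g \<in> forms s. \<forall>f\<in>L. diff_action g f = 0}"

definition dual_variety :: "nat \<Rightarrow> nat \<Rightarrow> bpoly set set \<Rightarrow> bpoly set set" where
  "dual_variety N m X =
     proj_closure (forms N)
       {L \<in> PP (forms N). \<exists>x \<in> smooth_points (forms N) m X. tangent (forms N) X x \<subseteq> perp N L}"


section \<open>Apolar maps\<close>

definition apolar_dom :: "nat \<Rightarrow> nat \<Rightarrow> bpoly set set" where
  "apolar_dom d s =
     {L \<in> PP (forms d). \<forall>f\<in>L - {0}. bp.dim ((\<lambda>g. diff_action g f) ` forms s) = d - s + 1}"

text \<open>The apolar map sends \<open>L\<close> in \<open>apolar_dom d s\<close> to \<open>perp s L\<close>.\<close>

definition apolar_preimage :: "nat \<Rightarrow> nat \<Rightarrow> bpoly set set \<Rightarrow> bpoly set set" where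
  "apolar_preimage d s A = {L \<in> apolar_dom d s. perp s L \<in> A}"


section \<open>Partitions and coincident root loci\<close>

definition is_partition :: "nat multiset \<Rightarrow> nat \<Rightarrow> bool" where
  "is_partition \<mu> s \<longleftrightarrow> 0 \<notin># \<mu> \<and> sum_mset \<mu> = s"

definition FF :: "nat \<Rightarrow> nat multiset \<Rightarrow> nat multiset set" where
  "FF j \<mu> =
     {mset (map2 (-) xs es) | xs es.
        mset xs = \<mu> \<and> length es = length xs \<and> set es \<subseteq> {0, 1} \<and> sum_list es = j \<and>
        (\<forall>y \<in> set (map2 (-) xs es). y > 0)}"

definition root_locus :: "nat multiset \<Rightarrow> bpoly set set" where
  "root_locus \<mu> =
     {bp.span {\<Prod>i<length xs. ls i ^ (xs ! i)} | xs ls.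
        mset xs = \<mu> \<and> (\<forall>i<length xs. ls i \<in> forms 1 \<and> ls i \<noteq> 0)}"

text \<open>$\Delta_\mu$ is a subvariety of $P(D_s)$, \<open>s = sum_mset \<mu>\<close>, of dimension \<open>size \<mu>\<close>.\<close>

definition CH_root :: "nat \<Rightarrow> nat multiset \<Rightarrow> bpoly set set" where
  "CH_root j \<mu> = CH (sum_mset \<mu>) (size \<mu>) j (root_locus \<mu>)"

definition dual_root :: "nat multiset \<Rightarrow> bpoly set set" where
  "dual_root \<mu> = dual_variety (sum_mset \<mu>) (size \<mu>) (root_locus \<mu>)"

end

theory Submission
  imports Defs "HOL-Computational_Algebra.Fundamental_Theorem_Algebra"
    "HOL-Computational_Algebra.Polynomial_FPS"
begin

text \<open>
  Evaluating monomials of degree \<open>d\<close> in the derivations on a form \<open>f\<close> of degree \<open>d\<close> turns \<open>f\<close>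
  into a sequence, and a form \<open>g\<close> in the derivations annihilates \<open>f\<close> iff the dehomogenization of
  \<open>g\<close>, read as the characteristic polynomial of a linear recurrence, annihilates that sequence
  (\<open>kills\<close>). The proof compares all three sets of the theorem with one family: the forms \<open>f\<close>
  that are annihilated by a product \<open>\<Prod> l_i ^ \<lambda>'_i\<close> of linear forms (\<open>killed_locus\<close>), and the
  subfamily in which the \<open>l_i\<close> are pairwise independent and no nonzero form of degree \<open>n\<close>
  annihilates \<open>f\<close> (\<open>generic_killed_locus\<close>). Each set whose closure is taken lies between the
  subfamilies and the families for the relevant \<open>\<lambda>'\<close>, and the subfamily is dense in the family
  (\<open>killed_subset_closure\<close>). So all closures agree.

  The link with tangent spaces: at a smooth point \<open>\<Prod> l_i ^ \<mu>_i\<close> of a coincident root locus the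
  tangent space consists of the multiples of \<open>\<Prod> l_i ^ (\<mu>_i - 1)\<close> that have the degree of the
  point (\<open>smooth_point_tangent\<close>). With \<open>\<mu>_i = \<lambda>'_i + 1\<close>, the hyperplane of \<open>f\<close> contains that
  tangent space iff \<open>\<Prod> l_i ^ \<lambda>'_i\<close> annihilates \<open>f\<close>, which is the statement about dual varieties.
  Generic points are smooth because the dehomogenization \<open>z\<close> of a form with at most \<open>n\<close> distinct
  roots satisfies a nontrivial relation \<open>A z + B z' = 0\<close> with \<open>A\<close>, \<open>B\<close> of degrees \<open>< n\<close> and
  \<open>\<le> n\<close>; the minors expressing this cut out the right tangent space (\<open>generic_tangent_dvd\<close>).

  The link with \<open>CH_j\<close>: let \<open>P = \<Prod> l_i ^ (\<lambda>_i - 1)\<close> and \<open>F = P f\<close>, a form of degree \<open>2n - j\<close>. If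
  the annihilator of \<open>f\<close> contains \<open>\<Prod> l_i ^ \<lambda>_i\<close> and meets the tangent space in dimension at
  least \<open>j + 1\<close>, then \<open>\<Prod> l_i\<close> annihilates \<open>F\<close> and too many forms of degree \<open>n\<close> do. As row and
  column rank of the catalecticant of \<open>F\<close> agree, a nonzero \<open>q\<close> of degree \<open>n - j\<close> also
  annihilates \<open>F\<close>. Coprime forms of small degrees cannot both annihilate a nonzero form, so \<open>F\<close>
  is annihilated by a common divisor, hence by a product of \<open>n - j\<close> of the \<open>l_i\<close>
  (\<open>killed_by_few_factors\<close>). This means that lowering \<open>j\<close> of the exponents \<open>\<lambda>_i\<close> by one still
  gives an annihilator of \<open>f\<close>. Should an exponent drop to zero in this way, \<open>exchange\<close> repairs
  it, using \<open>j \<le> n - m_1(\<lambda>)\<close>: the missing factor is replaced by a second copy of a factor whose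
  exponent is at least two.

  Since \<open>CH_j\<close> is itself a closure in a Grassmannian, these conditions are needed for limits of
  subspaces as well. Incidence with the root locus is expressed by equations in Pluecker
  coordinates and in the coefficients of the \<open>l_i\<close>, and \<open>elimination\<close> shows that the subspaces
  for which they have a solution form a Zariski closed set (\<open>perp_in_CH\<close>). The density
  statement, finally, rests on two deformations: solutions of a recurrence can be lifted along a
  perturbation of its factors (\<open>liftable_lprod\<close>), and for fixed factors a Hankel determinant,
  nonzero for one suitable sequence, shows that most sequences satisfying the recurrence are
  nondegenerate.
\<close>

section \<open>Determinants\<close>

lemma det_row_linear:
  fixes M :: "nat \<Rightarrow> nat \<Rightarrow> 'a::comm_ring_1"
  assumes "k < m"
  shows "\<exists>cof. \<forall>p. det (mat m m (\<lambda>(l, i). if l = k then p i else M l i)) = (\<Sum>i<m. p i * cof i)"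
proof -
  define A where "A p = mat m m (\<lambda>(l, i). if l = k then p i else M l i)" for p :: "nat \<Rightarrow> 'a"
  have del: "mat_delete (A p) k i = mat_delete (A (\<lambda>_. 0)) k i" for p i
    unfolding A_def mat_delete_def by (rule eq_matI) auto
  have "det (A p) = (\<Sum>i<m. p i * cofactor (A (\<lambda>_. 0)) k i)" for p
  proof -
    have "det (A p) = (\<Sum>j<m. A p $$ (k, j) * cofactor (A p) k j)"
      by (rule laplace_expansion_row) (use assms in \<open>auto simp: A_def\<close>)
    also have "\<dots> = (\<Sum>i<m. p i * cofactor (A (\<lambda>_. 0)) k i)"
    proof (rule sum.cong[OF refl])
      fix j assume "j \<in> {..<m}"
      then have "A p $$ (k, j) = p j" using assms by (simp add: A_def)
      then show "A p $$ (k, j) * cofactor (A p) k j = p j * cofactor (A (\<lambda>_. 0)) k j"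
        unfolding cofactor_def by (simp only: del[of p j])
    qed
    finally show ?thesis .
  qed
  then show ?thesis unfolding A_def by blast
qed

text \<open>
  Induction on the number of functions. In the expansion of the larger determinant along the row
  of a new point \<open>X\<close>, the coefficient of the last function is the minor already found, so the
  expansion cannot vanish at every \<open>X\<close>.
\<close>

lemma exists_minor:
  fixes w :: "nat \<Rightarrow> 'x \<Rightarrow> complex"
  assumes "\<And>c. (\<And>X. (\<Sum>b<k. c b * w b X) = 0) \<Longrightarrow> \<forall>b<k. c b = 0"
  shows "\<exists>I. det (mat k k (\<lambda>(a, b). w b (I a))) \<noteq> 0"
  using assms
proof (induction k)
  case 0
  show ?case by simp
next
  case (Suc k)
  have "\<forall>b<k. c b = 0" if "\<And>X. (\<Sum>b<k. c b * w b X) = 0" for c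
  proof -
    have "\<forall>b<Suc k. (c(k := 0)) b = 0" by (rule Suc.prems) (simp add: that)
    then show ?thesis by (metis fun_upd_apply less_SucI less_irrefl)
  qed
  then obtain I where I: "det (mat k k (\<lambda>(a, b). w b (I a))) \<noteq> 0" using Suc.IH by blast
  obtain cof where cof: "\<And>p. det (mat (Suc k) (Suc k) (\<lambda>(l, i). if l = k then p i else w i (I l))) = (\<Sum>i<Suc k. p i * cof i)"
    using det_row_linear[of k "Suc k" "\<lambda>l i. w i (I l)"] by auto
  have "cof k = det (mat k k (\<lambda>(a, b). w b (I a)))"
  proof -
    let ?A = "mat (Suc k) (Suc k) (\<lambda>(l, i). if l = k then (if i = k then 1 else 0) else w i (I l))"
    have "cof k = (\<Sum>i<Suc k. (if i = k then 1 else 0) * cof i)" by simp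
    also have "\<dots> = det ?A" using cof[of "\<lambda>i. if i = k then 1 else 0"] by simp
    also have "\<dots> = (\<Sum>j<Suc k. ?A $$ (k, j) * cofactor ?A k j)"
      by (rule laplace_expansion_row) auto
    also have "\<dots> = cofactor ?A k k" by simp
    also have "\<dots> = det (mat_delete ?A k k)" by (simp add: cofactor_def)
    also have "mat_delete ?A k k = mat k k (\<lambda>(a, b). w b (I a))"
      by (rule eq_matI) (auto simp: mat_delete_def)
    finally show ?thesis .
  qed
  then have "cof k \<noteq> 0" using I by simp
  then obtain X where X: "(\<Sum>b<Suc k. cof b * w b X) \<noteq> 0" using Suc.prems[of cof] by blast
  have "mat (Suc k) (Suc k) (\<lambda>(a, b). w b ((I(k := X)) a)) =
      mat (Suc k) (Suc k) (\<lambda>(l, i). if l = k then w i X else w i (I l))"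
    by (rule eq_matI) auto
  then have "det (mat (Suc k) (Suc k) (\<lambda>(a, b). w b ((I(k := X)) a))) = (\<Sum>b<Suc k. cof b * w b X)"
    using cof[of "\<lambda>i. w i X"] by (simp add: mult.commute)
  then show ?case using X by metis
qed

lemma exists_minor_rows:
  fixes w :: "nat \<Rightarrow> 'x \<Rightarrow> complex"
  assumes "\<And>c. (\<And>X. (\<Sum>b<k. c b * w b X) = 0) \<Longrightarrow> \<forall>b<k. c b = 0"
  shows "\<exists>I. det (mat k k (\<lambda>(a, b). w a (I b))) \<noteq> 0"
proof -
  obtain I where I: "det (mat k k (\<lambda>(a, b). w b (I a))) \<noteq> 0" using exists_minor[where k = k and w = w] assms by blast
  let ?A = "mat k k (\<lambda>(a, b). w a (I b))"
  have "mat k k (\<lambda>(a, b). w b (I a)) = transpose_mat ?A" by (rule eq_matI) auto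
  moreover have "det (transpose_mat ?A) = det ?A" by (rule det_transpose[of _ k]) simp
  ultimately show ?thesis using I by (intro exI[of _ I]) simp
qed

text \<open>
  Otherwise the transpose of the matrix would have the nonzero vector \<open>r\<close> in its kernel.
\<close>

lemma det_rows_independent:
  assumes "det (mat k k (\<lambda>(a, b). W a b)) \<noteq> (0::complex)"
    and "\<And>b. b < k \<Longrightarrow> (\<Sum>a<k. r a * W a b) = 0"
  shows "\<forall>a<k. r a = 0"
proof (rule ccontr)
  assume n: "\<not> (\<forall>a<k. r a = 0)"
  let ?A = "mat k k (\<lambda>(a, b). W a b)"
  let ?T = "mat k k (\<lambda>(b, a). W a b)"
  have "?T *\<^sub>v vec k r = 0\<^sub>v k"
    by (rule eq_vecI) (use assms(2) in \<open>auto simp: scalar_prod_def lessThan_atLeast0 mult.commute\<close>)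
  moreover have "vec k r \<noteq> 0\<^sub>v k"
  proof
    assume v: "vec k r = 0\<^sub>v k"
    have "r a = 0" if "a < k" for a using arg_cong[OF v, of "\<lambda>v. v $ a"] that by simp
    then show False using n by blast
  qed
  moreover have "vec k r \<in> carrier_vec k" by simp
  moreover have "?T \<in> carrier_mat k k" by simp
  ultimately have "det ?T = 0" by (subst det_0_iff_vec_prod_zero[of ?T k]) blast+
  moreover have "?T = transpose_mat ?A" by (rule eq_matI) auto
  moreover have "det (transpose_mat ?A) = det ?A" by (rule det_transpose[of _ k]) simp
  ultimately show False using assms(1) by simp
qed

lemma det_dependent_rows:
  fixes W :: "nat \<Rightarrow> nat \<Rightarrow> complex"
  assumes "\<And>b. b < k \<Longrightarrow> (\<Sum>a<k. r a * W a b) = 0" and "a0 < k" "r a0 \<noteq> 0"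
  shows "det (mat k k (\<lambda>(a, b). W a b)) = 0"
  using det_rows_independent[of k W r] assms by blast

lemma tendsto_det:
  assumes "\<And>a b. a < m \<Longrightarrow> b < m \<Longrightarrow> ((\<lambda>x. M x a b) \<longlongrightarrow> (L a b :: complex)) F"
  shows "((\<lambda>x. det (mat m m (\<lambda>(a, b). M x a b))) \<longlongrightarrow> det (mat m m (\<lambda>(a, b). L a b))) F"
proof -
  have e: "det (mat m m (\<lambda>(a, b). W a b)) = (\<Sum>p | p permutes {0..<m}. signof p * (\<Prod>i = 0..<m. W i (p i)))"
    for W :: "nat \<Rightarrow> nat \<Rightarrow> complex"
  proof -
    have "p i < m" if "i < m" "p permutes {0..<m}" for i p
      using that permutes_in_image[of p "{0..<m}" i] by auto
    then show ?thesis by (subst det_def'[of _ m]) (auto intro!: sum.cong prod.cong)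
  qed
  show ?thesis unfolding e
  proof (intro tendsto_sum tendsto_mult tendsto_const tendsto_prod)
    fix p i assume "p \<in> {p. p permutes {0..<m}}" "i \<in> {0..<m}"
    then have "i < m" "p i < m" using permutes_in_image[of p "{0..<m}" i] by auto
    then show "((\<lambda>x. M x i (p i)) \<longlongrightarrow> L i (p i)) F" by (rule assms)
  qed
qed

section \<open>Homogeneous polynomial functions\<close>

text \<open>
  Homogeneous functions and the multihomogeneous functions used for elimination have the same
  closure properties. Stating them once gives closure under determinants for both.
\<close>

locale graded_functions =
  fixes P :: "'g::comm_monoid_add \<Rightarrow> ('y \<Rightarrow> complex) \<Rightarrow> bool"
  assumes const: "P 0 (\<lambda>_. c)"
    and zero: "P g (\<lambda>_. 0)"
    and add: "P g F \<Longrightarrow> P g G \<Longrightarrow> P g (\<lambda>y. F y + G y)"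
    and mult: "P g F \<Longrightarrow> P h G \<Longrightarrow> P (g + h) (\<lambda>y. F y * G y)"
begin

lemma scale: "P g F \<Longrightarrow> P g (\<lambda>y. c * F y)"
  using mult[OF const, of g F c] by simp

lemma scale_right: "P g F \<Longrightarrow> P g (\<lambda>y. F y * c)"
  using mult[OF _ const, of g F c] by simp

lemma sum: "(\<And>x. x \<in> A \<Longrightarrow> P g (F x)) \<Longrightarrow> P g (\<lambda>y. \<Sum>x\<in>A. F x y)"
  by (induction A rule: infinite_finite_induct) (auto intro: zero add)

lemma prod: "(\<And>x. x \<in> A \<Longrightarrow> P (g x) (F x)) \<Longrightarrow> P (\<Sum>x\<in>A. g x) (\<lambda>y. \<Prod>x\<in>A. F x y)"
  by (induction A rule: infinite_finite_induct) (auto intro: const mult)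

lemma det:
  assumes "\<And>a b. a < m \<Longrightarrow> b < m \<Longrightarrow> P (g a) (\<lambda>y. M y a b)"
  shows "P (\<Sum>a<m. g a) (\<lambda>y. det (mat m m (\<lambda>(a, b). M y a b)))"
proof -
  have "P (\<Sum>a<m. g a) (\<lambda>y. \<Sum>p | p permutes {0..<m}. signof p * (\<Prod>i = 0..<m. M y i (p i)))"
  proof (rule sum, rule scale)
    fix p assume "p \<in> {p. p permutes {0..<m}}"
    then have "p i < m" if "i < m" for i using that permutes_in_image[of p "{0..<m}" i] by auto
    then show "P (\<Sum>a<m. g a) (\<lambda>y. \<Prod>i = 0..<m. M y i (p i))"
      unfolding lessThan_atLeast0 by (intro prod assms) auto
  qed
  also have "(\<lambda>y. \<Sum>p | p permutes {0..<m}. signof p * (\<Prod>i = 0..<m. M y i (p i)))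
      = (\<lambda>y. det (mat m m (\<lambda>(a, b). M y a b)))"
  proof
    fix y
    have "p i < m" if "i < m" "p permutes {0..<m}" for i p
      using that permutes_in_image[of p "{0..<m}" i] by auto
    then show "(\<Sum>p | p permutes {0..<m}. signof p * (\<Prod>i = 0..<m. M y i (p i)))
        = det (mat m m (\<lambda>(a, b). M y a b))"
      by (subst det_def'[of _ m]) (auto intro!: sum.cong prod.cong)
  qed
  finally show ?thesis .
qed

end

lemma homog_poly_zero: "homog_poly e (\<lambda>z. 0)"
proof (induction e)
  case 0 show ?case by (rule homog_poly.const)
next
  case (Suc e)
  have "homog_poly (1 + e) (\<lambda>z::'a \<Rightarrow> complex. z undefined * 0)"
    by (rule homog_poly.mult[OF homog_poly.var Suc])
  then show ?case by simp
qed

global_interpretation homog: graded_functions homog_poly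
  by standard (auto intro: homog_poly.intros homog_poly_zero)

lemma homog_poly_scaling: "homog_poly e F \<Longrightarrow> F (\<lambda>i. c * z i) = c ^ e * F z"
  by (induction rule: homog_poly.induct) (auto simp: algebra_simps power_add)

lemma homog_poly_line:
  assumes "homog_poly e F"
  shows "\<exists>p. \<forall>t. F (\<lambda>i. u i + t * v i) = poly p t"
  using assms
proof (induction rule: homog_poly.induct)
  case (const c)
  show ?case by (rule exI[of _ "[:c:]"]) simp
next
  case (var i)
  show ?case by (rule exI[of _ "[:u i, v i:]"]) simp
next
  case (add e F G)
  then obtain p q where "\<forall>t. F (\<lambda>i. u i + t * v i) = poly p t" "\<forall>t. G (\<lambda>i. u i + t * v i) = poly q t" by blast
  then show ?case by (intro exI[of _ "p + q"]) simp
next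
  case (mult e F e' G)
  then obtain p q where "\<forall>t. F (\<lambda>i. u i + t * v i) = poly p t" "\<forall>t. G (\<lambda>i. u i + t * v i) = poly q t" by blast
  then show ?case by (intro exI[of _ "p * q"]) simp
qed

text \<open>
  The point \<open>v\<close> is the point at infinity of the line \<open>u + t v\<close>. By homogeneity \<open>F\<close> vanishes
  there as soon as it vanishes on infinitely many points of the line.
\<close>

lemma homog_poly_line_limit:
  assumes F: "homog_poly e F" and inf: "infinite {t. F (\<lambda>i. u i + t * v i) = 0}"
  shows "F v = 0"
proof -
  obtain p where p: "F (\<lambda>i. u i + t * v i) = poly p t" for t using homog_poly_line[OF F] by blast
  have "p = 0" using inf poly_roots_finite[of p] by (auto simp: p)
  then have z: "F (\<lambda>i. u i + t * v i) = 0" for t using p by simp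
  \<comment> \<open>The line in the opposite chart, which contains \<open>v\<close>.\<close>
  obtain q where q: "F (\<lambda>i. v i + t * u i) = poly q t" for t using homog_poly_line[OF F] by blast
  have "poly q t = 0" if "t \<noteq> 0" for t
  proof -
    have "(\<lambda>i. v i + t * u i) = (\<lambda>i. t * (u i + (1 / t) * v i))" using that by (auto simp: field_simps)
    then have "F (\<lambda>i. v i + t * u i) = t ^ e * F (\<lambda>i. u i + (1 / t) * v i)"
      by (simp add: homog_poly_scaling[OF F])
    then show ?thesis using z[of "1 / t"] q by (metis mult_zero_right)
  qed
  then have "- {0} \<subseteq> {t. poly q t = 0}" by auto
  moreover have "infinite (- {0 :: complex})" using infinite_UNIV_char_0 by (simp add: Compl_eq_Diff_UNIV)
  ultimately have "q = 0" using poly_roots_finite[of q] finite_subset by blast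
  then show ?thesis using q[of 0] by simp
qed

lemma homog_poly_tendsto:
  assumes "homog_poly e F" and "\<And>i. ((\<lambda>x. zf x i) \<longlongrightarrow> z i) net"
  shows "((\<lambda>x. F (zf x)) \<longlongrightarrow> F z) net"
  using assms(1) by (induction rule: homog_poly.induct) (auto intro!: tendsto_intros assms(2))

text \<open>
  The two properties of a differential used below: the chain rule along coordinatewise
  differentiable curves, and continuity in the base point and the direction together. Both are
  stated coordinatewise, as there are infinitely many coordinates.
\<close>

definition is_differential ::
    "(('i \<Rightarrow> complex) \<Rightarrow> complex) \<Rightarrow> (('i \<Rightarrow> complex) \<Rightarrow> ('i \<Rightarrow> complex) \<Rightarrow> complex) \<Rightarrow> bool" where
  "is_differential F D \<longleftrightarrow>
     (\<forall>c v. (\<forall>i. ((\<lambda>t. c t i) has_field_derivative v i) (at 0)) \<longrightarrow>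
        ((\<lambda>t. F (c t)) has_field_derivative D (c 0) v) (at 0)) \<and>
     (\<forall>(net :: complex filter) zf vf z v. (\<forall>i. ((\<lambda>x. zf x i) \<longlongrightarrow> z i) net) \<longrightarrow>
        (\<forall>i. ((\<lambda>x. vf x i) \<longlongrightarrow> v i) net) \<longrightarrow> ((\<lambda>x. D (zf x) (vf x)) \<longlongrightarrow> D z v) net)"

lemma is_differential_derivative:
  "is_differential F D \<Longrightarrow> (\<And>i. ((\<lambda>t. c t i) has_field_derivative v i) (at 0)) \<Longrightarrow>
     ((\<lambda>t. F (c t)) has_field_derivative D (c 0) v) (at 0)"
  unfolding is_differential_def by blast

lemma is_differential_tendsto:
  "is_differential F D \<Longrightarrow> (\<And>i. ((\<lambda>x. zf x i) \<longlongrightarrow> z i) net) \<Longrightarrow>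
     (\<And>i. ((\<lambda>x. vf x i) \<longlongrightarrow> v i) net) \<Longrightarrow> ((\<lambda>x. D (zf x) (vf x)) \<longlongrightarrow> D z v) net"
  for net :: "complex filter"
  unfolding is_differential_def by blast

lemma homog_poly_differential:
  fixes F :: "('i \<Rightarrow> complex) \<Rightarrow> complex"
  assumes "homog_poly e F"
  shows "\<exists>D. is_differential F D"
  using assms
proof (induction rule: homog_poly.induct)
  case (const c)
  show ?case by (rule exI[of _ "\<lambda>z v. 0"]) (auto simp: is_differential_def)
next
  case (var i)
  show ?case by (rule exI[of _ "\<lambda>z v. v i"]) (auto simp: is_differential_def)
next
  case (add e F G)
  then obtain D1 D2 where D: "is_differential F D1" "is_differential G D2" by blast
  have "is_differential (\<lambda>z. F z + G z) (\<lambda>z v. D1 z v + D2 z v)"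
    unfolding is_differential_def
  proof (intro conjI allI impI)
    fix c :: "complex \<Rightarrow> 'i \<Rightarrow> complex" and v
    assume c: "\<forall>i. ((\<lambda>t. c t i) has_field_derivative v i) (at (0::complex))"
    show "((\<lambda>t. F (c t) + G (c t)) has_field_derivative D1 (c 0) v + D2 (c 0) v) (at 0)"
      by (intro DERIV_add is_differential_derivative[OF D(1)] is_differential_derivative[OF D(2)] c[rule_format])
  next
    fix net :: "complex filter" and zf vf :: "complex \<Rightarrow> 'i \<Rightarrow> complex" and z v
    assume "\<forall>i. ((\<lambda>x. zf x i) \<longlongrightarrow> z i) net" "\<forall>i. ((\<lambda>x. vf x i) \<longlongrightarrow> v i) net"
    then show "((\<lambda>x. D1 (zf x) (vf x) + D2 (zf x) (vf x)) \<longlongrightarrow> D1 z v + D2 z v) net"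
      by (intro tendsto_add is_differential_tendsto[OF D(1)] is_differential_tendsto[OF D(2)]) auto
  qed
  then show ?case by blast
next
  case (mult e F e' G)
  then obtain D1 D2 where D: "is_differential F D1" "is_differential G D2" by blast
  have "is_differential (\<lambda>z. F z * G z) (\<lambda>z v. D1 z v * G z + D2 z v * F z)"
    unfolding is_differential_def
  proof (intro conjI allI impI)
    fix c :: "complex \<Rightarrow> 'i \<Rightarrow> complex" and v
    assume c: "\<forall>i. ((\<lambda>t. c t i) has_field_derivative v i) (at (0::complex))"
    show "((\<lambda>t. F (c t) * G (c t)) has_field_derivative D1 (c 0) v * G (c 0) + D2 (c 0) v * F (c 0)) (at 0)"
      by (intro DERIV_mult is_differential_derivative[OF D(1)] is_differential_derivative[OF D(2)] c[rule_format])
  next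
    fix net :: "complex filter" and zf vf :: "complex \<Rightarrow> 'i \<Rightarrow> complex" and z v
    assume l: "\<forall>i. ((\<lambda>x. zf x i) \<longlongrightarrow> z i) net" "\<forall>i. ((\<lambda>x. vf x i) \<longlongrightarrow> v i) net"
    show "((\<lambda>x. D1 (zf x) (vf x) * G (zf x) + D2 (zf x) (vf x) * F (zf x)) \<longlongrightarrow>
            D1 z v * G z + D2 z v * F z) net"
      by (intro tendsto_add tendsto_mult is_differential_tendsto[OF D(1)] is_differential_tendsto[OF D(2)]
          homog_poly_tendsto[OF mult.hyps(1)] homog_poly_tendsto[OF mult.hyps(2)] l[rule_format])
  qed
  then show ?case by blast
qed

section \<open>Elimination of linear forms\<close>

text \<open>
  Polynomial functions of coordinates \<open>z\<close> and of linear forms with coefficient pairs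
  \<open>(a k, b k)\<close>. The multiset records the degrees: the multiplicity of \<open>0\<close> is the degree in \<open>z\<close>,
  that of \<open>Suc k\<close> the degree in the pair \<open>(a k, b k)\<close>.
\<close>

inductive multihomog ::
    "nat multiset \<Rightarrow> (('i \<Rightarrow> complex) \<times> (nat \<Rightarrow> complex) \<times> (nat \<Rightarrow> complex) \<Rightarrow> complex) \<Rightarrow> bool" where
  const: "multihomog {#} (\<lambda>_. c)"
| zero: "multihomog D (\<lambda>_. 0)"
| var_z: "multihomog {#0#} (\<lambda>(z, a, b). z i)"
| var_a: "multihomog {#Suc k#} (\<lambda>(z, a, b). a k)"
| var_b: "multihomog {#Suc k#} (\<lambda>(z, a, b). b k)"
| add: "multihomog D F \<Longrightarrow> multihomog D G \<Longrightarrow> multihomog D (\<lambda>y. F y + G y)"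
| mult: "multihomog D F \<Longrightarrow> multihomog E G \<Longrightarrow> multihomog (D + E) (\<lambda>y. F y * G y)"

global_interpretation mh: graded_functions multihomog
  by standard (simp add: multihomog.const, rule multihomog.zero, erule (1) multihomog.add, erule (1) multihomog.mult)

lemma multihomog_homog_poly:
  assumes "multihomog D G"
  shows "homog_poly (count D 0) (\<lambda>z. G (z, a, b))"
  using assms
proof (induction rule: multihomog.induct)
  case (add D F G) then show ?case by (intro homog_poly.add)
next
  case (mult D F E G) then show ?case by (simp only: count_union homog_poly.mult)
qed (simp_all add: homog_poly_zero homog_poly.const homog_poly.var[unfolded One_nat_def])

lemma multihomog_cong:
  assumes "multihomog D G" and "\<And>k. Suc k \<in># D \<Longrightarrow> a k = a' k \<and> b k = b' k"
  shows "G (z, a, b) = G (z, a', b')"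
  using assms by (induction rule: multihomog.induct) auto

text \<open>
  Displays \<open>G\<close> as a binary form in one pair \<open>(a k, b k)\<close>, whose coefficients are
  multihomogeneous in the remaining variables.
\<close>

lemma multihomog_expand:
  assumes "multihomog D G"
  shows "\<exists>C. (\<forall>i. multihomog (filter_mset (\<lambda>x. x \<noteq> Suc k) D) (C i)) \<and>
             (\<forall>z a b. G (z, a, b) = (\<Sum>i\<le>count D (Suc k). C i (z, a, b) * (a k ^ i * b k ^ (count D (Suc k) - i))))"
  using assms
proof (induction rule: multihomog.induct)
  case (const c)
  show ?case by (rule exI[of _ "\<lambda>i _. c"]) (auto intro: multihomog.const)
next
  case (zero D)
  show ?case by (rule exI[of _ "\<lambda>i _. 0"]) (auto intro: multihomog.zero)
next
  case (var_z i)
  show ?case by (rule exI[of _ "\<lambda>_ (z, a, b). z i"]) (auto intro: multihomog.var_z)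
next
  case (var_a k')
  show ?case
  proof (cases "k' = k")
    case True
    then show ?thesis
      by (intro exI[of _ "\<lambda>i _. if i = 0 then 0 else 1"])
        (use multihomog.const in \<open>auto intro: multihomog.zero\<close>)
  next
    case False
    then show ?thesis
      by (intro exI[of _ "\<lambda>_ (z, a, b). a k'"]) (auto intro: multihomog.var_a)
  qed
next
  case (var_b k')
  show ?case
  proof (cases "k' = k")
    case True
    then show ?thesis
      by (intro exI[of _ "\<lambda>i _. if i = 0 then 1 else 0"])
        (use multihomog.const in \<open>auto intro: multihomog.zero\<close>)
  next
    case False
    then show ?thesis
      by (intro exI[of _ "\<lambda>_ (z, a, b). b k'"]) (auto intro: multihomog.var_b)
  qed
next
  case (add D F G)
  let ?D = "filter_mset (\<lambda>x. x \<noteq> Suc k) D" and ?p = "count D (Suc k)"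
  obtain C1 where C1: "\<forall>i. multihomog ?D (C1 i)"
    "\<forall>z a b. F (z, a, b) = (\<Sum>i\<le>?p. C1 i (z, a, b) * (a k ^ i * b k ^ (?p - i)))"
    using add.IH(1) by (elim exE conjE)
  obtain C2 where C2: "\<forall>i. multihomog ?D (C2 i)"
    "\<forall>z a b. G (z, a, b) = (\<Sum>i\<le>?p. C2 i (z, a, b) * (a k ^ i * b k ^ (?p - i)))"
    using add.IH(2) by (elim exE conjE)
  show ?case
  proof (intro exI[of _ "\<lambda>i y. C1 i y + C2 i y"] conjI allI)
    show "multihomog ?D (\<lambda>y. C1 i y + C2 i y)" for i
      using C1(1) C2(1) by (intro multihomog.add) auto
    show "F (z, a, b) + G (z, a, b) =
       (\<Sum>i\<le>?p. (C1 i (z, a, b) + C2 i (z, a, b)) * (a k ^ i * b k ^ (?p - i)))" for z a b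
      by (simp only: C1(2) C2(2) sum.distrib distrib_right)
  qed
next
  case (mult D F E G)
  let ?p = "count D (Suc k)" and ?q = "count E (Suc k)"
  let ?D = "filter_mset (\<lambda>x. x \<noteq> Suc k) D" and ?E = "filter_mset (\<lambda>x. x \<noteq> Suc k) E"
  obtain C1 where C1: "\<forall>i. multihomog ?D (C1 i)"
    "\<forall>z a b. F (z, a, b) = (\<Sum>i\<le>?p. C1 i (z, a, b) * (a k ^ i * b k ^ (?p - i)))"
    using mult.IH(1) by (elim exE conjE)
  obtain C2 where C2: "\<forall>i. multihomog ?E (C2 i)"
    "\<forall>z a b. G (z, a, b) = (\<Sum>i\<le>?q. C2 i (z, a, b) * (a k ^ i * b k ^ (?q - i)))"
    using mult.IH(2) by (elim exE conjE)
  define C where "C l y = (\<Sum>i\<le>?p. \<Sum>j\<le>?q. if i + j = l then C1 i y * C2 j y else 0)" for l y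
  have "multihomog (?D + ?E) (\<lambda>y. C l y)" for l
    unfolding C_def
  proof (intro mh.sum)
    fix i j
    show "multihomog (?D + ?E) (\<lambda>y. if i + j = l then C1 i y * C2 j y else 0)"
      using C1(1) C2(1) by (cases "i + j = l") (auto intro: multihomog.intros)
  qed
  moreover have "F (z, a, b) * G (z, a, b) =
      (\<Sum>l\<le>?p + ?q. C l (z, a, b) * (a k ^ l * b k ^ (?p + ?q - l)))" for z a b
  proof -
    have "(\<Sum>l\<le>?p + ?q. C l (z, a, b) * (a k ^ l * b k ^ (?p + ?q - l))) =
        (\<Sum>l\<le>?p + ?q. \<Sum>i\<le>?p. \<Sum>j\<le>?q. if l = i + j then C1 i (z, a, b) * C2 j (z, a, b) * (a k ^ l * b k ^ (?p + ?q - l)) else 0)"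
      unfolding C_def sum_distrib_right by (intro sum.cong refl) auto
    also have "\<dots> = (\<Sum>i\<le>?p. \<Sum>j\<le>?q. \<Sum>l\<le>?p + ?q. if l = i + j then C1 i (z, a, b) * C2 j (z, a, b) * (a k ^ l * b k ^ (?p + ?q - l)) else 0)"
      by (subst sum.swap, rule sum.cong[OF refl], subst sum.swap, rule refl)
    also have "\<dots> = (\<Sum>i\<le>?p. \<Sum>j\<le>?q. (C1 i (z, a, b) * (a k ^ i * b k ^ (?p - i))) * (C2 j (z, a, b) * (a k ^ j * b k ^ (?q - j))))"
    proof (intro sum.cong refl)
      fix i j assume "i \<in> {..?p}" "j \<in> {..?q}"
      then have ij: "i \<le> ?p" "j \<le> ?q" by auto
      then have "b k ^ (?p + ?q - (i + j)) = b k ^ (?p - i) * b k ^ (?q - j)"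
        by (simp add: power_add[symmetric])
      then show "(\<Sum>l\<le>?p + ?q. if l = i + j then C1 i (z, a, b) * C2 j (z, a, b) * (a k ^ l * b k ^ (?p + ?q - l)) else 0) =
        C1 i (z, a, b) * (a k ^ i * b k ^ (?p - i)) * (C2 j (z, a, b) * (a k ^ j * b k ^ (?q - j)))"
        using ij by (simp add: sum.delta power_add)
    qed
    also have "\<dots> = F (z, a, b) * G (z, a, b)"
      by (simp only: C1(2) C2(2) sum_product)
    finally show ?thesis by simp
  qed
  ultimately show ?case by (intro exI[of _ C]) (simp only: count_union filter_union_mset, blast)
qed

global_interpretation pv: vector_space "smult :: complex \<Rightarrow> complex poly \<Rightarrow> complex poly"
  by standard (auto simp: smult_add_right smult_add_left)

text \<open>
  A pair \<open>(q, g)\<close> stands for the binary form of degree \<open>q\<close> with dehomogenization \<open>g\<close>. This is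
  the part of degree \<open>K\<close> of the ideal generated by the forms in \<open>B\<close>.
\<close>

definition form_ideal :: "(nat \<times> complex poly) set \<Rightarrow> nat \<Rightarrow> complex poly set" where
  "form_ideal B K = pv.span {monom 1 i * g | i q g. (q, g) \<in> B \<and> q + i \<le> K}"

lemma form_ideal_mono: "p \<in> form_ideal B K \<Longrightarrow> K \<le> L \<Longrightarrow> p \<in> form_ideal B L"
  unfolding form_ideal_def by (erule rev_subsetD, rule pv.span_mono) force

lemma form_ideal_monom: "p \<in> form_ideal B K \<Longrightarrow> monom 1 l * p \<in> form_ideal B (K + l)"
  unfolding form_ideal_def
proof (induction rule: pv.span_induct_alt)
  case base then show ?case by (simp add: pv.span_zero)
next
  case (step c x y)
  then obtain i q g where x: "x = monom 1 i * g" "(q, g) \<in> B" "q + i \<le> K" by blast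
  have "monom 1 l * x = monom 1 (i + l) * g" by (simp add: x mult.assoc[symmetric] mult_monom add.commute)
  then have "monom 1 l * x \<in> pv.span {monom 1 i * g |i q g. (q, g) \<in> B \<and> q + i \<le> K + l}"
    using x by (intro pv.span_base CollectI exI[of _ "i + l"] exI[of _ q] exI[of _ g]) auto
  then show ?case using step.IH
    by (simp add: distrib_left pv.span_add pv.span_scale)
qed

lemma form_ideal_mult:
  assumes "p \<in> form_ideal B K" and "degree h \<le> l"
  shows "h * p \<in> form_ideal B (K + l)"
proof -
  have "h * p = (\<Sum>i\<le>degree h. smult (coeff h i) (monom 1 i * p))"
    by (subst poly_as_sum_of_monoms[of h, symmetric], subst sum_distrib_right)
       (intro sum.cong refl, metis mult_smult_left smult_monom mult.right_neutral)
  moreover have "\<dots> \<in> form_ideal B (K + l)"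
  proof -
    have "monom 1 i * p \<in> form_ideal B (K + l)" if "i \<le> degree h" for i
      using form_ideal_mono[OF form_ideal_monom[OF assms(1), of i], of "K + l"] that assms(2) by simp
    then show ?thesis unfolding form_ideal_def by (intro pv.span_sum pv.span_scale) auto
  qed
  ultimately show ?thesis by simp
qed

lemma form_ideal_base: "(q, g) \<in> B \<Longrightarrow> degree h + q \<le> K \<Longrightarrow> h * g \<in> form_ideal B K"
proof -
  assume a: "(q, g) \<in> B" "degree h + q \<le> K"
  have "g \<in> form_ideal B q" unfolding form_ideal_def
    by (intro pv.span_base CollectI exI[of _ "0::nat"] exI[of _ q] exI[of _ g]) (use a in simp)
  then show ?thesis using form_ideal_mono[OF form_ideal_mult[of g B q h "degree h"]] a by (simp add: add.commute)
qed

definition form_eval :: "nat \<Rightarrow> complex poly \<Rightarrow> complex \<Rightarrow> complex \<Rightarrow> complex" where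
  "form_eval q g s t = (\<Sum>i\<le>q. coeff g i * (s ^ i * t ^ (q - i)))"

lemma form_eval_finite: "degree g \<le> q \<Longrightarrow> form_eval q g s 1 = poly g s"
  unfolding form_eval_def poly_altdef
  by (rule sum.mono_neutral_cong_right) (auto simp: coeff_eq_0)

lemma form_eval_infinity: "form_eval q g 1 0 = coeff g q"
proof -
  have "form_eval q g 1 0 = (\<Sum>i\<le>q. if i = q then coeff g i else 0)"
    unfolding form_eval_def by (intro sum.cong refl) auto
  then show ?thesis by simp
qed

text \<open>
  Modulo the ideal of \<open>B\<close>, every form of large degree is a multiple of any given nonzero form
  \<open>(q, g)\<close>. This follows by splitting off the linear factors of \<open>g\<close> one at a time: a form is
  divisible by a linear factor after subtracting a multiple of some member of \<open>B\<close> that does not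
  vanish at its zero. A degree of \<open>g\<close> smaller than \<open>q\<close> means that \<open>g\<close> has a zero at infinity.
\<close>

lemma form_ideal_eventually_all_aux:
  assumes deg: "\<And>q g. (q, g) \<in> B \<Longrightarrow> degree g \<le> q"
    and nonvanishing: "\<And>s t. (s, t) \<noteq> (0, 0) \<Longrightarrow> \<exists>(q, g) \<in> B. form_eval q g s t \<noteq> 0"
    and g: "g \<noteq> 0" "degree g \<le> q"
  shows "\<exists>K0. \<forall>K\<ge>K0. \<forall>p. degree p \<le> K \<longrightarrow>
           q \<le> K \<and> (\<exists>u v. u \<in> form_ideal B K \<and> degree v \<le> K - q \<and> p = u + v * g)"
  using g
proof (induction q arbitrary: g)
  case 0
  then have "degree g = 0" by simp
  then obtain c where "g = [:c:]" by (rule degree_eq_zeroE)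
  with 0 have c: "g = [:c:]" "c \<noteq> 0" by auto
  show ?case
  proof (rule exI[of _ 0], intro allI impI)
    fix K and p :: "complex poly" assume "degree p \<le> K"
    then show "0 \<le> K \<and> (\<exists>u v. u \<in> form_ideal B K \<and> degree v \<le> K - 0 \<and> p = u + v * g)"
      using c by (intro conjI exI[of _ 0] exI[of _ "smult (1 / c) p"]) (auto simp: form_ideal_def pv.span_zero)
  qed
next
  case (Suc q)
  show ?case
  proof (cases "degree g \<le> q")
    case True
    from Suc.IH[OF Suc.prems(1) True] obtain K0 where K0:
      "\<And>K p. K \<ge> K0 \<Longrightarrow> degree p \<le> K \<Longrightarrow>
           q \<le> K \<and> (\<exists>u v. u \<in> form_ideal B K \<and> degree v \<le> K - q \<and> p = u + v * g)" by blast
    obtain r h where h: "(r, h) \<in> B" "coeff h r \<noteq> 0" using nonvanishing[of 1 0] by (auto simp: form_eval_infinity)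
    show ?thesis
    proof (intro exI[of _ "Suc (K0 + r)"] allI impI)
      fix K and p :: "complex poly" assume K: "Suc (K0 + r) \<le> K" and p: "degree p \<le> K"
      define w where "w = monom (coeff p K / coeff h r) (K - r)"
      have dw: "degree w \<le> K - r" unfolding w_def by (rule degree_monom_le)
      have "degree (w * h) \<le> K" using dw deg[OF h(1)] degree_mult_le[of w h] K by linarith
      then have d: "degree (p - w * h) \<le> K" using p by (metis degree_diff_le)
      have "coeff (w * h) K = coeff p K"
        using K h(2) by (simp add: w_def coeff_monom_mult)
      then have "coeff (p - w * h) K = 0" by simp
      then have "degree (p - w * h) \<le> K - 1"
        using d eq_zero_or_degree_less[of "p - w * h" K] by auto
      then have "q \<le> K - 1 \<and> (\<exists>u v. u \<in> form_ideal B (K - 1) \<and> degree v \<le> K - 1 - q \<and> p - w * h = u + v * g)"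
        using K by (intro K0) auto
      then obtain u v where uv: "q \<le> K - 1" "u \<in> form_ideal B (K - 1)"
        "degree v \<le> K - 1 - q" "p - w * h = u + v * g" by blast
      have "w * h \<in> form_ideal B K" by (rule form_ideal_base[OF h(1)]) (use dw K in simp)
      moreover have "u \<in> form_ideal B K" using form_ideal_mono[OF uv(2)] by simp
      ultimately have "u + w * h \<in> form_ideal B K" unfolding form_ideal_def by (intro pv.span_add)
      moreover have "p = (u + w * h) + v * g" using uv(4) by (simp add: algebra_simps)
      ultimately show "Suc q \<le> K \<and> (\<exists>u v. u \<in> form_ideal B K \<and> degree v \<le> K - Suc q \<and> p = u + v * g)"
        using uv(1,3) K by (intro conjI exI[of _ "u + w * h"] exI[of _ v]) auto
    qed
  next
    case False
    then have "degree g = Suc q" using Suc.prems by simp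
    then obtain \<alpha> where "poly g \<alpha> = 0"
      using fundamental_theorem_of_algebra[of g] by (auto simp: constant_degree)
    then obtain g' where g': "g = [:-\<alpha>, 1:] * g'" by (auto simp: poly_eq_0_iff_dvd dvd_def)
    with Suc.prems have "g' \<noteq> 0" by auto
    moreover have "degree g' \<le> q" using \<open>degree g = Suc q\<close> g' \<open>g' \<noteq> 0\<close> degree_mult_eq[of "[:-\<alpha>, 1:]" g'] by simp
    ultimately have "\<exists>K0. \<forall>K\<ge>K0. \<forall>p. degree p \<le> K \<longrightarrow>
           q \<le> K \<and> (\<exists>u v. u \<in> form_ideal B K \<and> degree v \<le> K - q \<and> p = u + v * g')" by (rule Suc.IH)
    then obtain K0 where K0:
      "\<And>K p. K \<ge> K0 \<Longrightarrow> degree p \<le> K \<Longrightarrow>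
           q \<le> K \<and> (\<exists>u v. u \<in> form_ideal B K \<and> degree v \<le> K - q \<and> p = u + v * g')" by blast
    obtain r h where h: "(r, h) \<in> B" "form_eval r h \<alpha> 1 \<noteq> 0" using nonvanishing[of \<alpha> 1] by auto
    then have h: "(r, h) \<in> B" "poly h \<alpha> \<noteq> 0" using form_eval_finite[OF deg[OF h(1)]] by auto
    show ?thesis
    proof (intro exI[of _ "Suc (K0 + r)"] allI impI)
      fix K and p :: "complex poly" assume K: "Suc (K0 + r) \<le> K" and p: "degree p \<le> K"
      define w where "w = [:poly p \<alpha> / poly h \<alpha>:]"
      have dw: "degree w = 0" unfolding w_def by simp
      have "degree (w * h) \<le> K" using dw deg[OF h(1)] degree_mult_le[of w h] K by linarith
      then have d: "degree (p - w * h) \<le> K" using p by (metis degree_diff_le)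
      have "poly (p - w * h) \<alpha> = 0" using h(2) by (simp add: w_def)
      then obtain p' where p': "p - w * h = [:-\<alpha>, 1:] * p'" unfolding poly_eq_0_iff_dvd by (rule dvdE)
      have "degree p' \<le> K - 1"
      proof (cases "p' = 0")
        case False
        then show ?thesis using d p' degree_mult_eq[of "[:-\<alpha>, 1:]" p'] by simp
      qed simp
      then have "q \<le> K - 1 \<and> (\<exists>u v. u \<in> form_ideal B (K - 1) \<and> degree v \<le> K - 1 - q \<and> p' = u + v * g')"
        using K by (intro K0) auto
      then obtain u v where uv: "q \<le> K - 1" "u \<in> form_ideal B (K - 1)"
        "degree v \<le> K - 1 - q" "p' = u + v * g'" by blast
      have "w * h \<in> form_ideal B K" by (rule form_ideal_base[OF h(1)]) (use dw K in simp)
      moreover have "[:-\<alpha>, 1:] * u \<in> form_ideal B (K - 1 + 1)" by (rule form_ideal_mult[OF uv(2)]) simp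
      then have "[:-\<alpha>, 1:] * u \<in> form_ideal B K" using K by simp
      ultimately have "[:-\<alpha>, 1:] * u + w * h \<in> form_ideal B K" unfolding form_ideal_def by (intro pv.span_add)
      moreover have "p = ([:-\<alpha>, 1:] * u + w * h) + v * g"
      proof -
        have "p = [:-\<alpha>, 1:] * (u + v * g') + w * h" using p' uv(4) by (simp only: diff_eq_eq)
        then show ?thesis unfolding g' by (simp only: algebra_simps)
      qed
      ultimately show "Suc q \<le> K \<and> (\<exists>u v. u \<in> form_ideal B K \<and> degree v \<le> K - Suc q \<and> p = u + v * g)"
        using uv(1,3) K by (intro conjI exI[of _ "[:-\<alpha>, 1:] * u + w * h"] exI[of _ v]) (assumption | linarith)+
    qed
  qed
qed

text \<open>
  A projective Nullstellensatz in one variable: forms without a common zero generate all forms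
  of some degree.
\<close>

lemma form_ideal_eventually_all:
  assumes deg: "\<And>q g. (q, g) \<in> B \<Longrightarrow> degree g \<le> q"
    and nonvanishing: "\<And>s t. (s, t) \<noteq> (0, 0) \<Longrightarrow> \<exists>(q, g) \<in> B. form_eval q g s t \<noteq> 0"
  shows "\<exists>K. \<forall>p. degree p \<le> K \<longrightarrow> p \<in> form_ideal B K"
proof -
  obtain q g where g: "(q, g) \<in> B" "coeff g q \<noteq> 0" using nonvanishing[of 1 0] by (auto simp: form_eval_infinity)
  then have "g \<noteq> 0" by auto
  then obtain K where K: "\<And>p. degree p \<le> K \<Longrightarrow>
           q \<le> K \<and> (\<exists>u v. u \<in> form_ideal B K \<and> degree v \<le> K - q \<and> p = u + v * g)"
    using form_ideal_eventually_all_aux[OF deg nonvanishing _ deg[OF g(1)]] by blast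
  show ?thesis
  proof (intro exI[of _ K] allI impI)
    fix p :: "complex poly" assume "degree p \<le> K"
    then obtain u v where uv: "q \<le> K" "u \<in> form_ideal B K" "degree v \<le> K - q" "p = u + v * g" using K by blast
    have "v * g \<in> form_ideal B K" by (rule form_ideal_base[OF g(1)]) (use uv in simp)
    then show "p \<in> form_ideal B K" using uv unfolding form_ideal_def by (simp add: pv.span_add)
  qed
qed

text \<open>
  Starting from the identity matrix, the rows are replaced by members of \<open>S\<close> one at a time. The
  determinant is linear in each row, and the old row lies in the span of \<open>S\<close>, so some member of
  \<open>S\<close> keeps the determinant nonzero.
\<close>

lemma det_nonzero_from_span:
  assumes "\<And>l. l < m \<Longrightarrow> monom 1 l \<in> pv.span S"
  shows "\<exists>R. (\<forall>l<m. R l \<in> S) \<and> det (mat m m (\<lambda>(l, i). coeff (R l) i)) \<noteq> (0::complex)"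
proof -
  have "\<exists>R. (\<forall>l<k. R l \<in> S) \<and> (\<forall>l\<ge>k. R l = monom 1 l) \<and> det (mat m m (\<lambda>(l, i). coeff (R l) i)) \<noteq> (0::complex)"
    if "k \<le> m" for k
    using that
  proof (induction k)
    case 0
    have "mat m m (\<lambda>(l, i). coeff (monom (1::complex) l) i) = 1\<^sub>m m" by (rule eq_matI) auto
    then show ?case by (intro exI[of _ "\<lambda>l. monom 1 l"]) simp
  next
    case (Suc k)
    then obtain R where R: "\<forall>l<k. R l \<in> S" "\<forall>l\<ge>k. R l = monom 1 l"
      "det (mat m m (\<lambda>(l, i). coeff (R l) i)) \<noteq> (0::complex)" by auto
    have km: "k < m" using Suc.prems by simp
    define L where "L p = det (mat m m (\<lambda>(l, i). coeff ((R(k := p)) l) i))" for p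
    obtain cof where cof: "\<And>p. det (mat m m (\<lambda>(l, i). if l = k then p i else coeff (R l) i)) = (\<Sum>i<m. p i * cof i)"
      using det_row_linear[OF km, of "\<lambda>l i. coeff (R l) i"] by blast
    have L: "L p = (\<Sum>i<m. coeff p i * cof i)" for p
    proof -
      have "L p = det (mat m m (\<lambda>(l, i). if l = k then coeff p i else coeff (R l) i))"
        unfolding L_def by (rule arg_cong[of _ _ det], rule eq_matI) auto
      then show ?thesis using cof by simp
    qed
    have "R(k := monom 1 k) = R" using R(2) by auto
    then have "L (monom 1 k) \<noteq> 0" using R(3) by (simp add: L_def)
    have "\<exists>s\<in>S. L s \<noteq> 0"
    proof (rule ccontr)
      assume "\<not> (\<exists>s\<in>S. L s \<noteq> 0)"
      then have S0: "\<And>s. s \<in> S \<Longrightarrow> L s = 0" by blast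
      have "L x = 0" if "x \<in> pv.span S" for x
        using that
      proof (induction rule: pv.span_induct_alt)
        case base then show ?case by (simp add: L)
      next
        case (step c x y)
        have "L (smult c x + y) = c * L x + L y"
          by (simp add: L sum.distrib sum_distrib_left algebra_simps)
        then show ?case using step S0 by simp
      qed
      then show False using assms[OF km] \<open>L (monom 1 k) \<noteq> 0\<close> by blast
    qed
    then obtain s where "s \<in> S" "L s \<noteq> 0" by blast
    then show ?case using R(1,2)
      by (intro exI[of _ "R(k := s)"]) (auto simp: L_def less_Suc_eq)
  qed
  from this[of m] show ?thesis by blast
qed

text \<open>
  Resultant for arbitrarily many forms. Multiples of the given forms by monomials are written as
  rows of coefficients, in a degree \<open>K\<close> in which they span everything at the given point; \<open>\<Phi>\<close> is
  a determinant of such rows that is nonzero there. A common zero \<open>(a k, b k)\<close> at another point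
  yields the kernel vector of all monomials of degree \<open>K\<close>.
\<close>

lemma eliminate_one:
  fixes \<G> :: "(('i \<Rightarrow> complex) \<times> (nat \<Rightarrow> complex) \<times> (nat \<Rightarrow> complex) \<Rightarrow> complex) set"
  assumes mh: "\<And>G. G \<in> \<G> \<Longrightarrow> \<exists>D. multihomog D G \<and> set_mset D \<subseteq> {..Suc k}"
    and nonvanishing: "\<And>s t. (s, t) \<noteq> (0, 0) \<Longrightarrow> \<exists>G\<in>\<G>. G (z, a(k := s), b(k := t)) \<noteq> 0"
  shows "\<exists>\<Phi> D. multihomog D \<Phi> \<and> set_mset D \<subseteq> {..k} \<and> \<Phi> (z, a, b) \<noteq> 0 \<and>
    (\<forall>z a b. (a k, b k) \<noteq> (0, 0) \<longrightarrow> (\<forall>G\<in>\<G>. G (z, a, b) = 0) \<longrightarrow> \<Phi> (z, a, b) = 0)"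
proof -
  define expands where "expands G x \<longleftrightarrow> (case x of (q, D, C) \<Rightarrow>
      set_mset D \<subseteq> {..k} \<and> (\<forall>i. multihomog D (C i)) \<and>
      (\<forall>z a b. G (z, a, b) = (\<Sum>i\<le>q. C i (z, a, b) * (a k ^ i * b k ^ (q - i)))))"
    for G and x :: "nat \<times> nat multiset \<times> (nat \<Rightarrow> ('i \<Rightarrow> complex) \<times> (nat \<Rightarrow> complex) \<times> (nat \<Rightarrow> complex) \<Rightarrow> complex)"
  have "\<forall>G\<in>\<G>. \<exists>x. expands G x"
  proof
    fix G assume "G \<in> \<G>"
    then obtain D where D: "multihomog D G" "set_mset D \<subseteq> {..Suc k}" using mh by blast
    have "set_mset (filter_mset (\<lambda>x. x \<noteq> Suc k) D) \<subseteq> {..k}" using D(2) by force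
    moreover from multihomog_expand[OF D(1), of k] obtain C where
      "\<forall>i. multihomog (filter_mset (\<lambda>x. x \<noteq> Suc k) D) (C i)"
      "\<forall>z a b. G (z, a, b) = (\<Sum>i\<le>count D (Suc k). C i (z, a, b) * (a k ^ i * b k ^ (count D (Suc k) - i)))"
      by (elim exE conjE)
    ultimately have "expands G (count D (Suc k), filter_mset (\<lambda>x. x \<noteq> Suc k) D, C)"
      unfolding expands_def by simp
    then show "\<exists>x. expands G x" by blast
  qed
  then obtain x where x: "\<forall>G\<in>\<G>. expands G (x G)" by (rule bchoice[THEN exE])
  define q D C where "q G = fst (x G)" and "D G = fst (snd (x G))" and "C G = snd (snd (x G))" for G
  have D: "set_mset (D G) \<subseteq> {..k}" and C: "multihomog (D G) (C G i)" and
    G: "G (z, a, b) = (\<Sum>i\<le>q G. C G i (z, a, b) * (a k ^ i * b k ^ (q G - i)))"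
    if "G \<in> \<G>" for G i z a b
    using x[rule_format, OF that] unfolding expands_def q_def D_def C_def by (simp_all add: case_prod_beta)
  \<comment> \<open>The forms at the given point, dehomogenized.\<close>
  define g where "g G = (\<Sum>i\<le>q G. monom (C G i (z, a, b)) i)" for G
  have cg: "coeff (g G) i = (if i \<le> q G then C G i (z, a, b) else 0)" for G i
    unfolding g_def by (simp add: coeff_sum sum.delta)
  define B where "B = (\<lambda>G. (q G, g G)) ` \<G>"
  have "\<exists>K. \<forall>p. degree p \<le> K \<longrightarrow> p \<in> form_ideal B K"
  proof (rule form_ideal_eventually_all)
    show "degree g' \<le> q'" if "(q', g') \<in> B" for q' g'
      using that by (auto simp: B_def cg intro!: degree_le)
    fix s t :: complex assume "(s, t) \<noteq> (0, 0)"
    then obtain G where G': "G \<in> \<G>" "G (z, a(k := s), b(k := t)) \<noteq> 0" using nonvanishing by blast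
    have "C G i (z, a(k := s), b(k := t)) = C G i (z, a, b)" for i
      by (rule multihomog_cong[OF C[OF G'(1)]]) (use D[OF G'(1)] in force)
    then have "form_eval (q G) (g G) s t = G (z, a(k := s), b(k := t))"
      unfolding G[OF G'(1)] form_eval_def by (intro sum.cong) (auto simp: cg)
    then show "\<exists>(q, g)\<in>B. form_eval q g s t \<noteq> 0" using G' unfolding B_def by (intro bexI[OF _ imageI[OF G'(1)]]) simp
  qed
  then obtain K where K: "\<And>p. degree p \<le> K \<Longrightarrow> p \<in> form_ideal B K" by blast
  let ?S = "{monom 1 i * g | i q g. (q, g) \<in> B \<and> q + i \<le> K}"
  have "monom 1 l \<in> pv.span ?S" if "l < Suc K" for l
    using K[of "monom 1 l"] that by (simp add: form_ideal_def degree_monom_eq)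
  then obtain R where R: "\<And>l. l < Suc K \<Longrightarrow> R l \<in> ?S"
    "det (mat (Suc K) (Suc K) (\<lambda>(l, i). coeff (R l) i)) \<noteq> (0::complex)"
    using det_nonzero_from_span[of "Suc K" ?S] by blast
  have "\<forall>l. \<exists>s G. l < Suc K \<longrightarrow> G \<in> \<G> \<and> q G + s \<le> K \<and> R l = monom 1 s * g G"
    using R(1) unfolding B_def by blast
  then obtain s Gl where Gl: "\<And>l. l < Suc K \<Longrightarrow> Gl l \<in> \<G>" "\<And>l. l < Suc K \<Longrightarrow> q (Gl l) + s l \<le> K"
    "\<And>l. l < Suc K \<Longrightarrow> R l = monom 1 (s l) * g (Gl l)" by metis
  define M where "M y l i = (if s l \<le> i \<and> i - s l \<le> q (Gl l) then C (Gl l) (i - s l) y else 0)" for y l i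
  define \<Phi> where "\<Phi> y = det (mat (Suc K) (Suc K) (\<lambda>(l, i). M y l i))" for y
  have "multihomog (\<Sum>l<Suc K. D (Gl l)) \<Phi>"
    unfolding \<Phi>_def M_def
  proof (rule mh.det)
    fix l i assume "l < Suc K" "i < Suc K"
    then show "multihomog (D (Gl l)) (\<lambda>y. if s l \<le> i \<and> i - s l \<le> q (Gl l) then C (Gl l) (i - s l) y else 0)"
      by (cases "s l \<le> i \<and> i - s l \<le> q (Gl l)") (simp_all only: C[OF Gl(1)] multihomog.zero if_True if_False simp_thms)
  qed
  moreover have "set_mset (\<Sum>l<Suc K. D (Gl l)) \<subseteq> {..k}"
    using D[OF Gl(1)] by (auto simp: set_mset_sum simp del: sum.lessThan_Suc)
  moreover have "\<Phi> (z, a, b) \<noteq> 0"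
  proof -
    have "mat (Suc K) (Suc K) (\<lambda>(l, i). M (z, a, b) l i) = mat (Suc K) (Suc K) (\<lambda>(l, i). coeff (R l) i)"
      by (rule eq_matI) (auto simp: M_def Gl(3) coeff_monom_mult cg)
    then show ?thesis using R(2) by (simp add: \<Phi>_def)
  qed
  moreover have "\<Phi> (z', a', b') = 0" if nz': "(a' k, b' k) \<noteq> (0, 0)" and G0: "\<forall>G\<in>\<G>. G (z', a', b') = 0" for z' a' b'
  proof -
    define x where "x = vec (Suc K) (\<lambda>i. a' k ^ i * b' k ^ (K - i))"
    let ?A = "mat (Suc K) (Suc K) (\<lambda>(l, i). M (z', a', b') l i)"
    have "x \<noteq> 0\<^sub>v (Suc K)"
    proof (cases "a' k = 0")
      case True
      then have "x $ 0 \<noteq> 0" using nz' by (simp add: x_def)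
      then show ?thesis by auto
    next
      case False
      then have "x $ K \<noteq> 0" using nz' by (simp add: x_def)
      then show ?thesis by auto
    qed
    moreover have "?A *\<^sub>v x = 0\<^sub>v (Suc K)"
    proof (rule eq_vecI)
      fix l assume "l < dim_vec (0\<^sub>v (Suc K) :: complex vec)"
      then have l: "l < Suc K" by simp
      let ?q = "q (Gl l)" and ?s = "s l" and ?C = "\<lambda>i. C (Gl l) i (z', a', b')"
      have qs: "?q + ?s \<le> K" using Gl(2)[OF l] .
      have "(?A *\<^sub>v x) $ l = (\<Sum>i<Suc K. M (z', a', b') l i * (a' k ^ i * b' k ^ (K - i)))"
        using l by (simp add: scalar_prod_def x_def lessThan_atLeast0 del: sum.op_ivl_Suc)
      also have "\<dots> = (\<Sum>i\<in>{?s..?s + ?q}. ?C (i - ?s) * (a' k ^ i * b' k ^ (K - i)))"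
        by (rule sum.mono_neutral_cong_right) (use qs in \<open>auto simp: M_def\<close>)
      also have "\<dots> = (\<Sum>i\<le>?q. ?C i * (a' k ^ (i + ?s) * b' k ^ (K - (i + ?s))))"
        by (rule sum.reindex_bij_witness[of _ "\<lambda>i. i + ?s" "\<lambda>i. i - ?s"]) auto
      also have "\<dots> = (\<Sum>i\<le>?q. (a' k ^ ?s * b' k ^ (K - ?q - ?s)) * (?C i * (a' k ^ i * b' k ^ (?q - i))))"
      proof (intro sum.cong refl)
        fix i assume "i \<in> {..?q}"
        then have "K - (i + ?s) = (K - ?q - ?s) + (?q - i)" using qs by simp
        then have "b' k ^ (K - (i + ?s)) = b' k ^ (K - ?q - ?s) * b' k ^ (?q - i)" by (simp only: power_add)
        then show "?C i * (a' k ^ (i + ?s) * b' k ^ (K - (i + ?s))) =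
           (a' k ^ ?s * b' k ^ (K - ?q - ?s)) * (?C i * (a' k ^ i * b' k ^ (?q - i)))"
          by (simp add: power_add)
      qed
      also have "\<dots> = (a' k ^ ?s * b' k ^ (K - ?q - ?s)) * Gl l (z', a', b')"
        by (simp only: G[OF Gl(1)[OF l]] sum_distrib_left)
      also have "\<dots> = 0" using G0 Gl(1)[OF l] by simp
      finally show "(?A *\<^sub>v x) $ l = 0\<^sub>v (Suc K) $ l" using l by simp
    qed simp
    moreover have "x \<in> carrier_vec (Suc K)" by (simp add: x_def)
    ultimately show ?thesis unfolding \<Phi>_def
      using det_0_iff_vec_prod_zero[of ?A "Suc K"] by auto
  qed
  ultimately show ?thesis by blast
qed

text \<open>
  The projection of a closed set along a product of projective lines is closed; the pairs
  \<open>(a k, b k)\<close> are eliminated one after the other.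
\<close>

lemma elimination:
  fixes \<G> :: "(('i \<Rightarrow> complex) \<times> (nat \<Rightarrow> complex) \<times> (nat \<Rightarrow> complex) \<Rightarrow> complex) set"
  assumes "\<And>G. G \<in> \<G> \<Longrightarrow> \<exists>D. multihomog D G \<and> set_mset D \<subseteq> {..n}"
    and "\<And>a b. (\<forall>k<n. (a k, b k) \<noteq> (0, 0)) \<Longrightarrow> \<exists>G\<in>\<G>. G (z0, a, b) \<noteq> 0"
  shows "\<exists>e \<Phi>. homog_poly e \<Phi> \<and> \<Phi> z0 \<noteq> 0 \<and>
    (\<forall>z a b. (\<forall>k<n. (a k, b k) \<noteq> (0, 0)) \<longrightarrow> (\<forall>G\<in>\<G>. G (z, a, b) = 0) \<longrightarrow> \<Phi> z = 0)"
  using assms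
proof (induction n arbitrary: \<G>)
  case 0
  then obtain G where G: "G \<in> \<G>" "G (z0, \<lambda>_. 0, \<lambda>_. 0) \<noteq> 0" by blast
  obtain D where D: "multihomog D G" "set_mset D \<subseteq> {..0}" using 0 G by blast
  have "G (z, a, b) = G (z, \<lambda>_. 0, \<lambda>_. 0)" for z a b
    by (rule multihomog_cong[OF D(1)]) (use D(2) in auto)
  then show ?case using G multihomog_homog_poly[OF D(1), of "\<lambda>_. 0" "\<lambda>_. 0"]
    by (intro exI[of _ "count D 0"] exI[of _ "\<lambda>z. G (z, \<lambda>_. 0, \<lambda>_. 0)"]) metis
next
  case (Suc n)
  \<comment> \<open>All consequences that do not involve the last pair.\<close>
  define \<G>' where "\<G>' = {\<Phi>. \<exists>D. multihomog D \<Phi> \<and> set_mset D \<subseteq> {..n} \<and>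
    (\<forall>z a b. (a n, b n) \<noteq> (0, 0) \<longrightarrow> (\<forall>G\<in>\<G>. G (z, a, b) = 0) \<longrightarrow> \<Phi> (z, a, b) = 0)}"
  have "\<exists>e \<Phi>. homog_poly e \<Phi> \<and> \<Phi> z0 \<noteq> 0 \<and>
    (\<forall>z a b. (\<forall>k<n. (a k, b k) \<noteq> (0, 0)) \<longrightarrow> (\<forall>G\<in>\<G>'. G (z, a, b) = 0) \<longrightarrow> \<Phi> z = 0)"
  proof (rule Suc.IH)
    show "\<exists>D. multihomog D G \<and> set_mset D \<subseteq> {..n}" if "G \<in> \<G>'" for G using that by (auto simp: \<G>'_def)
    fix a b :: "nat \<Rightarrow> complex" assume ab: "\<forall>k<n. (a k, b k) \<noteq> (0, 0)"
    have "\<exists>G\<in>\<G>. G (z0, a(n := s), b(n := t)) \<noteq> 0" if "(s, t) \<noteq> (0, 0)" for s t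
      by (rule Suc.prems(2)) (use ab that in \<open>auto simp: less_Suc_eq\<close>)
    then have "\<exists>\<Phi> D. multihomog D \<Phi> \<and> set_mset D \<subseteq> {..n} \<and> \<Phi> (z0, a, b) \<noteq> 0 \<and>
      (\<forall>z a b. (a n, b n) \<noteq> (0, 0) \<longrightarrow> (\<forall>G\<in>\<G>. G (z, a, b) = 0) \<longrightarrow> \<Phi> (z, a, b) = 0)"
      by (intro eliminate_one Suc.prems(1)) auto
    then show "\<exists>G\<in>\<G>'. G (z0, a, b) \<noteq> 0" unfolding \<G>'_def by blast
  qed
  then obtain e \<Phi> where \<Phi>: "homog_poly e \<Phi>" "\<Phi> z0 \<noteq> 0"
    "\<And>z a b. (\<forall>k<n. (a k, b k) \<noteq> (0, 0)) \<Longrightarrow> (\<forall>G\<in>\<G>'. G (z, a, b) = 0) \<Longrightarrow> \<Phi> z = 0" by blast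
  have "\<Phi> z = 0" if ab: "\<forall>k<Suc n. (a k, b k) \<noteq> (0, 0)" and G: "\<forall>G\<in>\<G>. G (z, a, b) = 0" for z a b
    by (rule \<Phi>(3)[of a b]) (use ab G in \<open>auto simp: \<G>'_def\<close>)
  then show ?case using \<Phi>(1,2) by blast
qed

section \<open>Linear algebra of binary forms\<close>

text \<open>
  A family that is linearly independent modulo the span of \<open>A\<close> extends a basis of that span.
\<close>

lemma family_extend:
  fixes k :: nat
  assumes A: "finite A" "bp.independent A"
    and w: "\<And>c. (\<Sum>i<k. c i *\<^sub>b w i) \<in> bp.span A \<Longrightarrow> \<forall>i<k. c i = 0"
  shows "bp.independent (A \<union> w ` {..<k}) \<and> inj_on w {..<k} \<and> card (A \<union> w ` {..<k}) = card A + k"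
  using w
proof (induction k)
  case 0
  then show ?case using A by simp
next
  case (Suc k)
  have IH: "bp.independent (A \<union> w ` {..<k}) \<and> inj_on w {..<k} \<and> card (A \<union> w ` {..<k}) = card A + k"
  proof (rule Suc.IH)
    fix c assume "(\<Sum>i<k. c i *\<^sub>b w i) \<in> bp.span A"
    then have "\<forall>i<Suc k. (c(k := 0)) i = 0" by (intro Suc.prems) simp
    then show "\<forall>i<k. c i = 0" by (metis fun_upd_apply less_SucI less_irrefl)
  qed
  have new: "w k \<notin> bp.span (A \<union> w ` {..<k})"
  proof
    assume "w k \<in> bp.span (A \<union> w ` {..<k})"
    then obtain u v where uv: "u \<in> bp.span A" "v \<in> bp.span (w ` {..<k})" "w k = u + v"
      unfolding bp.span_Un by auto
    then obtain r where r: "v = (\<Sum>x\<in>w ` {..<k}. r x *\<^sub>b x)" by (auto simp: bp.span_finite)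
    have v: "v = (\<Sum>i<k. r (w i) *\<^sub>b w i)" unfolding r using IH by (subst sum.reindex) auto
    have "(\<Sum>i<Suc k. (if i = k then 1 else - r (w i)) *\<^sub>b w i) = w k - v"
      by (simp add: v sum_negf)
    also have "\<dots> \<in> bp.span A" using uv by simp
    finally have "\<forall>i<Suc k. (if i = k then 1 else - r (w i)) = (0::complex)" by (rule Suc.prems)
    from this[rule_format, of k] show False by simp
  qed
  then have nin: "w k \<notin> A \<union> w ` {..<k}" by (metis bp.span_base)
  have "inj_on w {..<Suc k}" using IH nin by (simp add: lessThan_Suc)
  moreover have "A \<union> w ` {..<Suc k} = insert (w k) (A \<union> w ` {..<k})" by (auto simp: lessThan_Suc)
  moreover have "bp.independent (insert (w k) (A \<union> w ` {..<k}))" using IH new by (simp add: bp.independent_insertI)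
  moreover have "card (insert (w k) (A \<union> w ` {..<k})) = Suc (card A + k)"
    using IH nin A(1) by simp
  ultimately show ?case by simp
qed

lemma family_independent:
  fixes k :: nat
  assumes "\<And>c. (\<Sum>i<k. c i *\<^sub>b w i) = 0 \<Longrightarrow> \<forall>i<k. c i = 0"
  shows "bp.independent (w ` {..<k})" and "inj_on w {..<k}" and "card (w ` {..<k}) = k"
  using family_extend[of "{}" w k] assms by (auto simp: bp.independent_empty)

lemma span_family:
  fixes k :: nat
  shows "bp.span (w ` {..<k}) = {\<Sum>i<k. c i *\<^sub>b w i | c. True}"
proof (induction k)
  case 0
  then show ?case by simp
next
  case (Suc k)
  show ?case
  proof (intro equalityI subsetI)
    fix x assume "x \<in> bp.span (w ` {..<Suc k})"
    then obtain r where "x - r *\<^sub>b w k \<in> bp.span (w ` {..<k})"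
      unfolding lessThan_Suc image_insert bp.span_insert by auto
    then obtain c where "x - r *\<^sub>b w k = (\<Sum>i<k. c i *\<^sub>b w i)" using Suc.IH by auto
    then have "x = (\<Sum>i<Suc k. (c(k := r)) i *\<^sub>b w i)" by (simp add: algebra_simps)
    then show "x \<in> {\<Sum>i<Suc k. c i *\<^sub>b w i | c. True}" by blast
  next
    fix x assume "x \<in> {\<Sum>i<Suc k. c i *\<^sub>b w i | c. True}"
    then show "x \<in> bp.span (w ` {..<Suc k})"
      by (clarify, intro bp.span_sum bp.span_scale bp.span_base) auto
  qed
qed

lemma span_eq_by_card:
  assumes "bp.independent B" and "finite S" and "B \<subseteq> bp.span S" and "card S \<le> card B"
  shows "bp.span B = bp.span S"
proof
  show "bp.span B \<subseteq> bp.span S" using assms(3) by (simp add: bp.span_minimal)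
  show "bp.span S \<subseteq> bp.span B"
  proof
    fix x assume x: "x \<in> bp.span S"
    show "x \<in> bp.span B"
    proof (rule ccontr)
      assume n: "x \<notin> bp.span B"
      then have i: "bp.independent (insert x B)" by (simp add: bp.independent_insertI assms(1))
      have fB: "finite B" using bp.independent_span_bound[OF assms(2,1,3)] by simp
      have "x \<notin> B" using n bp.span_base by blast
      then have "card (insert x B) = Suc (card B)" using fB by simp
      moreover have "card (insert x B) \<le> card S"
        using bp.independent_span_bound[OF assms(2) i] x assms(3) by auto
      ultimately show False using assms(4) by simp
    qed
  qed
qed

lemma bcoeff_add [simp]: "bcoeff (f + g) x = bcoeff f x + bcoeff g x"
  by (cases x) (simp add: bcoeff_def)

lemma bcoeff_0 [simp]: "bcoeff 0 x = 0"
  by (cases x) (simp add: bcoeff_def)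

lemma bcoeff_scale [simp]: "bcoeff (c *\<^sub>b f) x = c * bcoeff f x"
  by (cases x) (simp add: bcoeff_def cscale_def)

lemma bcoeff_sum: "bcoeff (\<Sum>i\<in>A. f i) x = (\<Sum>i\<in>A. bcoeff (f i) x)"
  by (induction A rule: infinite_finite_induct) auto

lemma bcoeff_eqI: "(\<And>x. bcoeff f x = bcoeff g x) \<Longrightarrow> f = g"
proof (intro poly_eqI)
  fix k i assume a: "\<And>x. bcoeff f x = bcoeff g x"
  show "coeff (coeff f k) i = coeff (coeff g k) i" using a[of "(i, k)"] by (simp add: bcoeff_def)
qed

lemma formsD: "f \<in> forms s \<Longrightarrow> bcoeff f (i, k) \<noteq> 0 \<Longrightarrow> i + k = s"
  by (auto simp: forms_def)

lemma subspace_forms: "bp.subspace (forms s)"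
  unfolding bp.subspace_def forms_def by (auto) (metis add.right_neutral)

lemma forms_mult: "f \<in> forms s \<Longrightarrow> g \<in> forms t \<Longrightarrow> f * g \<in> forms (s + t)"
  unfolding forms_def
proof (intro CollectI allI impI)
  fix i k
  assume f: "f \<in> {f. \<forall>i k. bcoeff f (i, k) \<noteq> 0 \<longrightarrow> i + k = s}"
    and g: "g \<in> {f. \<forall>i k. bcoeff f (i, k) \<noteq> 0 \<longrightarrow> i + k = t}"
    and nonvanishing: "bcoeff (f * g) (i, k) \<noteq> 0"
  have "bcoeff (f * g) (i, k) = (\<Sum>k'\<le>k. \<Sum>i'\<le>i. bcoeff f (i', k') * bcoeff g (i - i', k - k'))"
    by (simp add: bcoeff_def coeff_mult coeff_sum)
  then obtain k' i' where "k' \<le> k" "i' \<le> i" "bcoeff f (i', k') * bcoeff g (i - i', k - k') \<noteq> 0"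
    using nonvanishing by (metis (no_types, lifting) atMost_iff sum.neutral)
  then have "i' + k' = s" "(i - i') + (k - k') = t" using f g by auto
  then show "i + k = s + t" using \<open>k' \<le> k\<close> \<open>i' \<le> i\<close> by simp
qed

lemma forms_1: "1 \<in> forms 0"
  unfolding forms_def bcoeff_def by (auto simp: coeff_1 split: if_splits)

lemma forms_power: "f \<in> forms s \<Longrightarrow> f ^ e \<in> forms (e * s)"
  by (induction e) (auto simp: forms_1 intro: forms_mult)

lemma forms_prod: "(\<And>i. i \<in> A \<Longrightarrow> f i \<in> forms (s i)) \<Longrightarrow> (\<Prod>i\<in>A. f i) \<in> forms (\<Sum>i\<in>A. s i)"
  by (induction A rule: infinite_finite_induct) (auto simp: forms_1 intro: forms_mult)

text \<open>
  Setting the outer variable to \<open>1\<close> identifies forms of degree \<open>s\<close> with polynomials of degree at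
  most \<open>s\<close>, compatibly with products; \<open>to_form s\<close> is the inverse.
\<close>

definition to_poly :: "bpoly \<Rightarrow> complex poly" where
  "to_poly g = poly g 1"

definition to_form :: "nat \<Rightarrow> complex poly \<Rightarrow> bpoly" where
  "to_form s p = (\<Sum>i\<le>s. monom (monom (coeff p i) i) (s - i))"

lemma bcoeff_to_form: "bcoeff (to_form s p) (i, k) = (if i + k = s then coeff p i else 0)"
proof -
  have "bcoeff (to_form s p) (i, k) = (\<Sum>j\<le>s. if j = i then (if i + k = s then coeff p i else 0) else 0)"
    unfolding to_form_def bcoeff_sum by (intro sum.cong) (auto simp: bcoeff_def coeff_monom)
  then show ?thesis by (auto simp: sum.delta)
qed

lemma to_form_forms [simp]: "to_form s p \<in> forms s"
  by (auto simp: forms_def bcoeff_to_form)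

lemma coeff_to_poly:
  assumes "g \<in> forms s"
  shows "coeff (to_poly g) i = (if i \<le> s then bcoeff g (i, s - i) else 0)"
proof -
  have "coeff (to_poly g) i = (\<Sum>k\<le>degree g. bcoeff g (i, k))"
    unfolding to_poly_def poly_altdef bcoeff_def by (simp add: coeff_sum)
  also have "\<dots> = (\<Sum>k\<le>degree g. if k = s - i then (if i \<le> s then bcoeff g (i, k) else 0) else 0)"
    using formsD[OF assms] by (intro sum.cong refl) fastforce
  also have "\<dots> = (if i \<le> s then bcoeff g (i, s - i) else 0)"
    by (auto simp: sum.delta bcoeff_def coeff_eq_0)
  finally show ?thesis .
qed

lemma degree_to_poly: "g \<in> forms s \<Longrightarrow> degree (to_poly g) \<le> s"
  by (rule degree_le) (simp add: coeff_to_poly)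

lemma to_poly_to_form: "degree p \<le> s \<Longrightarrow> to_poly (to_form s p) = p"
  by (rule poly_eqI) (auto simp: coeff_to_poly[OF to_form_forms] bcoeff_to_form coeff_eq_0)

lemma to_form_to_poly:
  assumes g: "g \<in> forms s"
  shows "to_form s (to_poly g) = g"
proof (rule bcoeff_eqI)
  fix x :: "nat \<times> nat"
  obtain i k :: nat where x: "x = (i, k)" by (cases x)
  have "bcoeff g (i, k) = 0" if "i + k \<noteq> s" using that formsD[OF g] by blast
  then show "bcoeff (to_form s (to_poly g)) x = bcoeff g x"
    unfolding x by (auto simp: bcoeff_to_form coeff_to_poly[OF g])
qed

lemma to_poly_eqD: "f \<in> forms s \<Longrightarrow> g \<in> forms s \<Longrightarrow> to_poly f = to_poly g \<Longrightarrow> f = g"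
  by (metis to_form_to_poly)

lemma to_poly_add [simp]: "to_poly (f + g) = to_poly f + to_poly g" by (simp add: to_poly_def)

lemma to_poly_0 [simp]: "to_poly 0 = 0" by (simp add: to_poly_def)

lemma to_poly_scale [simp]: "to_poly (c *\<^sub>b f) = smult c (to_poly f)" by (simp add: to_poly_def cscale_def)

lemma to_poly_mult [simp]: "to_poly (f * g) = to_poly f * to_poly g" by (simp add: to_poly_def)

lemma to_poly_power [simp]: "to_poly (f ^ e) = to_poly f ^ e" by (simp add: to_poly_def)

lemma to_poly_prod: "to_poly (\<Prod>i\<in>A. f i) = (\<Prod>i\<in>A. to_poly (f i))" by (simp add: to_poly_def poly_prod)

lemma to_poly_sum: "to_poly (\<Sum>i\<in>A. f i) = (\<Sum>i\<in>A. to_poly (f i))" by (simp add: to_poly_def poly_sum)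

lemma to_form_add: "to_form s (p + q) = to_form s p + to_form s q"
  by (rule bcoeff_eqI) (auto simp: bcoeff_to_form split: prod.splits if_splits) 

lemma to_form_smult: "to_form s (smult c p) = c *\<^sub>b to_form s p"
  by (rule bcoeff_eqI) (auto simp: bcoeff_to_form)

lemma to_form_0 [simp]: "to_form s 0 = 0"
  by (rule bcoeff_eqI) (auto simp: bcoeff_to_form)

lemma to_form_sum: "to_form s (\<Sum>i\<in>A. p i) = (\<Sum>i\<in>A. to_form s (p i))"
  by (induction A rule: infinite_finite_induct) (auto simp: to_form_add)

lemma to_form_eq_0: "degree p \<le> s \<Longrightarrow> to_form s p = 0 \<Longrightarrow> p = 0"
  using to_poly_to_form by fastforce

lemma poly_as_lt_sum: "degree (p :: complex poly) \<le> m \<Longrightarrow> p = (\<Sum>i<Suc m. smult (coeff p i) (monom 1 i))"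
  using poly_as_sum_of_monoms'[of p m] unfolding lessThan_Suc_atMost by (simp only: smult_monom mult_1_right)

lemma to_form_mult_family_independent:
  assumes P: "P \<noteq> 0" "degree P + m \<le> s"
  defines "w \<equiv> (\<lambda>i. to_form s (P * monom 1 i))"
  shows "bp.independent (w ` {..<Suc m})" "card (w ` {..<Suc m}) = Suc m"
    "bp.span (w ` {..<Suc m}) = {to_form s (P * h) | h. degree h \<le> m}"
proof -
  have comb: "(\<Sum>i<Suc m. c i *\<^sub>b w i) = to_form s (P * (\<Sum>i<Suc m. smult (c i) (monom 1 i)))" for c
    unfolding w_def sum_distrib_left to_form_sum by (intro sum.cong refl) (simp add: to_form_smult[symmetric])
  have deg: "degree (\<Sum>i<Suc m. smult (c i) (monom (1::complex) i)) \<le> m" for c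
    by (rule degree_sum_le) (auto intro: order_trans[OF degree_smult_le] order_trans[OF degree_monom_le])
  have coe: "coeff (\<Sum>i<Suc m. smult (c i) (monom (1::complex) i)) j = (if j < Suc m then c j else 0)" for c j
    unfolding coeff_sum by (simp add: coeff_monom if_distrib sum.delta cong: if_cong del: sum.lessThan_Suc)
  have "\<forall>i<Suc m. c i = 0" if "(\<Sum>i<Suc m. c i *\<^sub>b w i) = 0" for c
  proof -
    have "degree (P * (\<Sum>i<Suc m. smult (c i) (monom 1 i))) \<le> s"
      using degree_mult_le[of P "\<Sum>i<Suc m. smult (c i) (monom 1 i)"] deg[of c] P(2) by linarith
    then have "P * (\<Sum>i<Suc m. smult (c i) (monom 1 i)) = 0"
      using that unfolding comb by (rule to_form_eq_0)
    then have "(\<Sum>i<Suc m. smult (c i) (monom (1::complex) i)) = 0" using P(1) by (simp del: sum.lessThan_Suc)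
    then show ?thesis using coe[of c] by (metis coeff_0)
  qed
  from family_independent[OF this]
  show "bp.independent (w ` {..<Suc m})" "card (w ` {..<Suc m}) = Suc m" by auto
  show "bp.span (w ` {..<Suc m}) = {to_form s (P * h) | h. degree h \<le> m}"
  proof (intro equalityI subsetI)
    fix x assume "x \<in> bp.span (w ` {..<Suc m})"
    then obtain c where "x = (\<Sum>i<Suc m. c i *\<^sub>b w i)" unfolding span_family by blast
    then show "x \<in> {to_form s (P * h) | h. degree h \<le> m}" using comb deg by blast
  next
    fix x assume "x \<in> {to_form s (P * h) | h. degree h \<le> m}"
    then obtain h where h: "x = to_form s (P * h)" "degree h \<le> m" by blast
    have "x = (\<Sum>i<Suc m. coeff h i *\<^sub>b w i)"
      unfolding comb h(1) using poly_as_lt_sum[OF h(2)] by simp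
    then show "x \<in> bp.span (w ` {..<Suc m})" unfolding span_family by blast
  qed
qed

lemma dim_multiples:
  assumes "P \<noteq> 0" "degree P + m \<le> s"
  shows "bp.dim {to_form s (P * h) | h. degree h \<le> m} = Suc m"
  using to_form_mult_family_independent[OF assms] bp.dim_span_eq_card_independent by metis

lemma forms_eq_span: "bp.span ((\<lambda>i. to_form s (monom 1 i)) ` {..<Suc s}) = forms s"
proof -
  have "bp.span ((\<lambda>i. to_form s (monom 1 i)) ` {..<Suc s}) = {to_form s h | h. degree h \<le> s}"
    using to_form_mult_family_independent(3)[of 1 s s] by simp
  also have "\<dots> = forms s" using degree_to_poly to_form_to_poly by (auto) metis
  finally show ?thesis .
qed

lemma forms_basis: "bp.independent ((\<lambda>i. to_form s (monom 1 i)) ` {..<Suc s})"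
    "card ((\<lambda>i. to_form s (monom 1 i)) ` {..<Suc s}) = Suc s"
  using to_form_mult_family_independent[of 1 s s] by auto

lemma independent_forms_bound:
  assumes "bp.independent B" "B \<subseteq> forms s"
  shows "finite B" "card B \<le> Suc s"
  using bp.independent_span_bound[of "(\<lambda>i. to_form s (monom 1 i)) ` {..<Suc s}" B] assms
  by (auto simp: forms_eq_span forms_basis(2) simp del: lessThan_Suc)

lemma basis_forms_exists:
  assumes "V \<subseteq> forms s"
  obtains B where "finite B" "B \<subseteq> V" "bp.independent B" "V \<subseteq> bp.span B" "card B = bp.dim V"
  using bp.basis_exists[of V] independent_forms_bound assms by (metis subset_trans)

lemma dim_mono_forms:
  assumes "U \<subseteq> V" "V \<subseteq> forms s"
  shows "bp.dim U \<le> bp.dim V"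
proof -
  obtain B where "finite B" "V \<subseteq> bp.span B" "card B = bp.dim V" using basis_forms_exists[OF assms(2)] by metis
  then show ?thesis using bp.dim_le_card[of U B] assms(1) by auto
qed

lemma subspace_dim_equal_forms:
  assumes "bp.subspace U" "U \<subseteq> V" "V \<subseteq> forms s" "bp.dim V \<le> bp.dim U"
  shows "U = V"
proof -
  obtain B where B: "finite B" "B \<subseteq> U" "bp.independent B" "U \<subseteq> bp.span B" "card B = bp.dim U"
    using basis_forms_exists[of U s] assms by (metis subset_trans)
  obtain C where C: "finite C" "C \<subseteq> V" "V \<subseteq> bp.span C" "card C = bp.dim V"
    using basis_forms_exists[OF assms(3)] by metis
  have "bp.span B = bp.span C"
    by (rule span_eq_by_card) (use B C assms in auto)
  moreover have "bp.span B \<subseteq> U" using B(2) assms(1) by (rule bp.span_minimal)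
  ultimately show ?thesis using C(3) assms(2) by blast
qed

section \<open>Pluecker coordinates\<close>

text \<open>
  Laplace expansion of a maximal minor of \<open>v # B\<close> along its first row. It is linear both in the
  Pluecker coordinates \<open>z\<close> of \<open>B\<close> and in \<open>v\<close>, so the membership of \<open>v\<close> in the span of \<open>B\<close>
  becomes a system of bilinear equations.
\<close>

definition pluecker_form ::
    "nat \<Rightarrow> (nat \<Rightarrow> nat \<times> nat) \<Rightarrow> ((nat \<Rightarrow> nat \<times> nat) \<Rightarrow> complex) \<Rightarrow> bpoly \<Rightarrow> complex" where
  "pluecker_form k I z v =
     (\<Sum>c<Suc k. bcoeff v (I c) * ((-1) ^ c * z (\<lambda>m. I (if m < c then m else Suc m))))"

lemma pluecker_form_pluecker:
  "pluecker_form (length B) I (pluecker B) v = pluecker (v # B) I"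
proof -
  let ?n = "Suc (length B)"
  let ?A = "mat ?n ?n (\<lambda>(a, b). bcoeff ((v # B) ! a) (I b))"
  have "pluecker (v # B) I = det ?A" by (simp add: pluecker_def)
  also have "\<dots> = (\<Sum>c<?n. ?A $$ (0, c) * cofactor ?A 0 c)"
    by (rule laplace_expansion_row) auto
  also have "\<dots> = pluecker_form (length B) I (pluecker B) v"
    unfolding pluecker_form_def
  proof (intro sum.cong refl)
    fix c assume c: "c \<in> {..<?n}"
    have "mat_delete ?A 0 c = mat (length B) (length B) (\<lambda>(a, b). bcoeff (B ! a) (I (if b < c then b else Suc b)))"
      by (rule eq_matI) (use c in \<open>auto simp: mat_delete_def\<close>)
    then show "?A $$ (0, c) * cofactor ?A 0 c =
        bcoeff v (I c) * ((-1) ^ c * pluecker B (\<lambda>m. I (if m < c then m else Suc m)))"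
      using c by (simp add: cofactor_def pluecker_def)
  qed
  finally show ?thesis ..
qed

lemma independent_list_relation:
  assumes "distinct B" "bp.independent (set B)" "(\<Sum>b<length B. c b *\<^sub>b (B ! b)) = 0" "b < length B"
  shows "c b = 0"
proof -
  let ?i = "the_inv_into {..<length B} ((!) B)"
  have inj: "inj_on ((!) B) {..<length B}" using assms(1) by (simp add: inj_on_nth)
  have im: "(!) B ` {..<length B} = set B" by (auto simp: in_set_conv_nth)
  have "(\<Sum>x\<in>set B. c (?i x) *\<^sub>b x) = (\<Sum>b<length B. c b *\<^sub>b (B ! b))"
    unfolding im[symmetric] using inj by (subst sum.reindex) (auto simp: the_inv_into_f_f)
  then have "c (?i (B ! b)) = 0"
    using bp.independentD[of "set B" "set B" "\<lambda>x. c (?i x)" "B ! b"] assms by auto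
  then show ?thesis using inj assms(4) by (simp add: the_inv_into_f_f)
qed

lemma pluecker_Cons_zero_iff:
  assumes B: "distinct B" "bp.independent (set B)"
  shows "(\<forall>I. pluecker (v # B) I = 0) \<longleftrightarrow> v \<in> bp.span (set B)"
proof
  assume v: "v \<in> bp.span (set B)"
  have im: "(!) B ` {..<length B} = set B" by (auto simp: in_set_conv_nth)
  obtain c where c: "v = (\<Sum>i<length B. c i *\<^sub>b (B ! i))"
    using v span_family[of "(!) B" "length B"] unfolding im by blast
  show "\<forall>I. pluecker (v # B) I = 0"
  proof
    fix I
    let ?n = "Suc (length B)"
    let ?A = "mat ?n ?n (\<lambda>(a, b). bcoeff ((v # B) ! a) (I b))"
    let ?T = "mat ?n ?n (\<lambda>(a, b). bcoeff ((v # B) ! b) (I a))"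
    define x where "x = vec ?n (\<lambda>i. case i of 0 \<Rightarrow> 1 | Suc i \<Rightarrow> - c i)"
    have "x $ 0 = 1" by (simp add: x_def)
    then have "x \<noteq> 0\<^sub>v ?n" by auto
    moreover have "?T *\<^sub>v x = 0\<^sub>v ?n"
    proof (rule eq_vecI)
      fix a assume a: "a < dim_vec (0\<^sub>v ?n :: complex vec)"
      have "(?T *\<^sub>v x) $ a = (\<Sum>i<?n. bcoeff ((v # B) ! i) (I a) * (case i of 0 \<Rightarrow> 1 | Suc i \<Rightarrow> - c i))"
        using a by (simp add: scalar_prod_def x_def lessThan_atLeast0 del: sum.op_ivl_Suc)
      also have "\<dots> = bcoeff v (I a) - (\<Sum>i<length B. c i * bcoeff (B ! i) (I a))"
        unfolding sum.lessThan_Suc_shift by (simp add: sum_negf mult.commute)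
      also have "\<dots> = 0" by (simp add: c bcoeff_sum)
      finally show "(?T *\<^sub>v x) $ a = 0\<^sub>v ?n $ a" using a by simp
    qed simp
    moreover have "x \<in> carrier_vec ?n" by (simp add: x_def)
    ultimately have "det ?T = 0"
      using det_0_iff_vec_prod_zero[of ?T ?n] by auto
    moreover have "?T = transpose_mat ?A" by (rule eq_matI) auto
    moreover have "det (transpose_mat ?A) = det ?A" by (rule det_transpose[of _ ?n]) simp
    ultimately show "pluecker (v # B) I = 0" by (simp add: pluecker_def)
  qed
next
  assume all: "\<forall>I. pluecker (v # B) I = 0"
  show "v \<in> bp.span (set B)"
  proof (rule ccontr)
    assume n: "v \<notin> bp.span (set B)"
    then have d: "distinct (v # B)" using B bp.span_base by auto
    have i: "bp.independent (set (v # B))" using n B by (simp add: bp.independent_insertI)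
    let ?n = "length (v # B)"
    have "\<exists>I. det (mat ?n ?n (\<lambda>(a, b). bcoeff ((v # B) ! b) (I a))) \<noteq> 0"
    proof (rule exists_minor)
      fix c assume "\<And>X. (\<Sum>b<?n. c b * bcoeff ((v # B) ! b) X) = 0"
      then have "(\<Sum>b<?n. c b *\<^sub>b ((v # B) ! b)) = 0"
        by (intro bcoeff_eqI) (simp add: bcoeff_sum del: sum.lessThan_Suc)
      then show "\<forall>b<?n. c b = 0" using independent_list_relation[OF d i] by blast
    qed
    then obtain I where I: "det (mat ?n ?n (\<lambda>(a, b). bcoeff ((v # B) ! b) (I a))) \<noteq> 0" by blast
    let ?A = "mat ?n ?n (\<lambda>(a, b). bcoeff ((v # B) ! a) (I b))"
    have "mat ?n ?n (\<lambda>(a, b). bcoeff ((v # B) ! b) (I a)) = transpose_mat ?A" by (rule eq_matI) auto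
    moreover have "det (transpose_mat ?A) = det ?A" by (rule det_transpose[of _ ?n]) simp
    ultimately have "pluecker (v # B) I \<noteq> 0" using I by (simp add: pluecker_def)
    then show False using all by blast
  qed
qed

section \<open>Apolarity as annihilation of a sequence\<close>

lemma bcoeff_dy: "bcoeff (dy f) (i, k) = of_nat (Suc k) * bcoeff f (i, Suc k)"
  by (simp add: bcoeff_def dy_def coeff_pderiv of_nat_poly del: of_nat_Suc)

lemma bcoeff_dx: "bcoeff (dx f) (i, k) = of_nat (Suc i) * bcoeff f (Suc i, k)"
  by (simp add: bcoeff_def dx_def coeff_map_poly coeff_pderiv del: of_nat_Suc)

lemma bcoeff_dy_power: "bcoeff ((dy ^^ q) f) (i, k) = fact (k + q) / fact k * bcoeff f (i, k + q)"
proof (induction q arbitrary: k)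
  case (Suc q)
  show ?case using of_nat_neq_0[of k, where 'a = complex] by (simp add: bcoeff_dy Suc.IH divide_simps)
qed simp

lemma bcoeff_dx_power: "bcoeff ((dx ^^ p) f) (i, k) = fact (i + p) / fact i * bcoeff f (i + p, k)"
proof (induction p arbitrary: i)
  case (Suc p)
  show ?case using of_nat_neq_0[of i, where 'a = complex] by (simp add: bcoeff_dx Suc.IH divide_simps)
qed simp

text \<open>
  A sequence regarded as a linear functional on polynomials.
\<close>

definition pairing :: "(nat \<Rightarrow> complex) \<Rightarrow> complex poly \<Rightarrow> complex" where
  "pairing c p = (\<Sum>i\<le>degree p. coeff p i * c i)"

lemma pairing_eq: "degree p \<le> N \<Longrightarrow> pairing c p = (\<Sum>i\<le>N. coeff p i * c i)"
  unfolding pairing_def by (rule sum.mono_neutral_left) (auto simp: coeff_eq_0)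

lemma pairing_cong: "(\<And>i. i \<le> degree p \<Longrightarrow> c i = c' i) \<Longrightarrow> pairing c p = pairing c' p"
  unfolding pairing_def by (intro sum.cong) auto

lemma pairing_0 [simp]: "pairing c 0 = 0" by (simp add: pairing_def)

lemma pairing_add: "pairing c (p + q) = pairing c p + pairing c q"
proof -
  let ?N = "max (degree p) (degree q)"
  have "pairing c (p + q) = (\<Sum>i\<le>?N. coeff (p + q) i * c i)" by (rule pairing_eq[OF degree_add_le_max])
  also have "\<dots> = pairing c p + pairing c q"
    by (simp add: pairing_eq[of p ?N] pairing_eq[of q ?N] sum.distrib distrib_right)
  finally show ?thesis .
qed

lemma pairing_smult: "pairing c (smult a p) = a * pairing c p"
  by (simp add: pairing_eq[of "smult a p" "degree p"] pairing_def sum_distrib_left mult.assoc)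

lemma pairing_sum: "pairing c (\<Sum>i\<in>A. p i) = (\<Sum>i\<in>A. pairing c (p i))"
  by (induction A rule: infinite_finite_induct) (auto simp: pairing_add)

lemma pairing_add_left: "pairing (\<lambda>i. c i + c' i) p = pairing c p + pairing c' p"
  by (simp add: pairing_def sum.distrib distrib_left)

lemma pairing_scale_left: "pairing (\<lambda>i. a * c i) p = a * pairing c p"
  by (simp add: pairing_def sum_distrib_left algebra_simps)

lemma pairing_monom_mult: "pairing c (monom 1 k * p) = pairing (\<lambda>i. c (k + i)) p"
proof -
  have "degree (monom 1 k * p) \<le> k + degree p"
    using degree_mult_le[of "monom 1 k" p] by (simp add: degree_monom_eq)
  then have "pairing c (monom 1 k * p) = (\<Sum>i\<le>k + degree p. coeff (monom 1 k * p) i * c i)" by (rule pairing_eq)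
  also have "\<dots> = (\<Sum>i\<in>{k..k + degree p}. coeff p (i - k) * c i)"
    by (rule sum.mono_neutral_cong_right) (auto simp: coeff_monom_mult)
  also have "\<dots> = pairing (\<lambda>i. c (k + i)) p"
    unfolding pairing_def by (rule sum.reindex_bij_witness[of _ "\<lambda>i. k + i" "\<lambda>i. i - k"]) auto
  finally show ?thesis .
qed

text \<open>
  The action of the shift operator \<open>p\<close> on the sequence \<open>c\<close>; under \<open>dual_seq\<close> it becomes the
  action of differential operators on forms.
\<close>

definition contract :: "complex poly \<Rightarrow> (nat \<Rightarrow> complex) \<Rightarrow> nat \<Rightarrow> complex" where
  "contract p c k = pairing (\<lambda>i. c (k + i)) p"

lemma pairing_contract: "pairing (contract p c) q = pairing c (p * q)"
proof -
  have "pairing c (p * q) = pairing c (\<Sum>k\<le>degree q. smult (coeff q k) (monom 1 k * p))"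
  proof (rule arg_cong[of _ _ "pairing c"])
    have "p * q = (\<Sum>k\<le>degree q. monom (coeff q k) k) * p" by (simp add: poly_as_sum_of_monoms)
    also have "\<dots> = (\<Sum>k\<le>degree q. smult (coeff q k) (monom 1 k * p))"
      unfolding sum_distrib_right
      by (intro sum.cong refl) (metis mult_smult_left smult_monom mult.right_neutral)
    finally show "p * q = \<dots>" .
  qed
  also have "\<dots> = pairing (contract p c) q"
    unfolding pairing_sum pairing_smult pairing_monom_mult contract_def[abs_def] by (simp add: pairing_def)
  finally show ?thesis ..
qed

lemma contract_mult: "contract (p * q) c = contract q (contract p c)"
proof
  fix k
  have "contract (p * q) c k = pairing c (monom 1 k * (p * q))" by (simp add: contract_def pairing_monom_mult)
  also have "\<dots> = pairing (contract p c) (monom 1 k * q)" by (simp add: pairing_contract mult.left_commute)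
  also have "\<dots> = contract q (contract p c) k" by (simp add: contract_def pairing_monom_mult)
  finally show "contract (p * q) c k = contract q (contract p c) k" .
qed

text \<open>
  If \<open>c\<close> is the sequence of a form of degree \<open>d\<close> and \<open>p\<close> is an operator of degree \<open>s\<close>, then \<open>p\<close>
  annihilates the form iff \<open>kills c (d - s) p\<close>; the bound \<open>d - s\<close> is the degree of the resulting
  form.
\<close>

definition kills :: "(nat \<Rightarrow> complex) \<Rightarrow> nat \<Rightarrow> complex poly \<Rightarrow> bool" where
  "kills c e p \<longleftrightarrow> (\<forall>h. degree h \<le> e \<longrightarrow> pairing c (p * h) = 0)"

lemma killsD: "kills c e p \<Longrightarrow> degree h \<le> e \<Longrightarrow> pairing c (p * h) = 0"
  by (simp add: kills_def)

lemma kills_iff: "kills c e p \<longleftrightarrow> (\<forall>k\<le>e. contract p c k = 0)"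
proof
  assume "kills c e p"
  then show "\<forall>k\<le>e. contract p c k = 0"
    unfolding contract_def pairing_monom_mult[symmetric] using killsD[of c e p "monom 1 _"]
    by (auto simp: degree_monom_eq mult.commute)
next
  assume a: "\<forall>k\<le>e. contract p c k = 0"
  show "kills c e p"
    unfolding kills_def pairing_contract[symmetric] using a by (simp add: pairing_def)
qed

lemma kills_mult_iff: "kills c e (p * q) \<longleftrightarrow> kills (contract p c) e q"
  by (simp add: kills_iff contract_mult)

lemma kills_mult: "kills c e p \<Longrightarrow> degree h + e' \<le> e \<Longrightarrow> kills c e' (p * h)"
  unfolding kills_def
proof (intro allI impI)
  fix h' :: "complex poly" assume a: "\<forall>h. degree h \<le> e \<longrightarrow> pairing c (p * h) = 0" "degree h + e' \<le> e" "degree h' \<le> e'"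
  have "degree (h * h') \<le> e" using degree_mult_le[of h h'] a by linarith
  then show "pairing c (p * h * h') = 0" using a(1) by (simp add: mult.assoc)
qed

text \<open>
  The values on \<open>f\<close>, with coefficients \<open>z\<close>, of the monomials of degree \<open>d\<close> in the derivations.
\<close>

definition dual_seq :: "nat \<Rightarrow> (nat \<times> nat \<Rightarrow> complex) \<Rightarrow> nat \<Rightarrow> complex" where
  "dual_seq d z i = fact i * fact (d - i) * z (i, d - i)"

lemma bcoeff_diff_action:
  assumes g: "g \<in> forms s" and f: "f \<in> forms (s + e)"
  shows "bcoeff (diff_action g f) (p, q) =
    (if p + q = e then contract (to_poly g) (dual_seq (s + e) (bcoeff f)) p / (fact p * fact q) else 0)"
proof -
  define X where "X i k = fact (p + i) / fact p * (fact (q + k) / fact q) * bcoeff f (p + i, q + k)" for i k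
  have "bcoeff (diff_action g f) (p, q) =
      (\<Sum>k\<le>degree g. \<Sum>i\<le>degree (coeff g k). bcoeff g (i, k) * X i k)"
    unfolding diff_action_def bcoeff_sum X_def
    by (intro sum.cong refl) (simp add: bcoeff_dx_power bcoeff_dy_power)
  also have "\<dots> = (\<Sum>k\<le>degree g. if k \<le> s then bcoeff g (s - k, k) * X (s - k) k else 0)"
  proof (intro sum.cong refl)
    fix k
    have "(\<Sum>i\<le>degree (coeff g k). bcoeff g (i, k) * X i k) =
        (\<Sum>i\<le>degree (coeff g k). if i = s - k then (if k \<le> s then bcoeff g (i, k) * X i k else 0) else 0)"
      using formsD[OF g] by (intro sum.cong refl) fastforce
    also have "\<dots> = (if k \<le> s then bcoeff g (s - k, k) * X (s - k) k else 0)"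
      by (auto simp: sum.delta bcoeff_def coeff_eq_0)
    finally show "(\<Sum>i\<le>degree (coeff g k). bcoeff g (i, k) * X i k) =
        (if k \<le> s then bcoeff g (s - k, k) * X (s - k) k else 0)" .
  qed
  also have "\<dots> = (\<Sum>k\<le>s. bcoeff g (s - k, k) * X (s - k) k)"
  proof -
    have "(\<Sum>k\<le>degree g. if k \<le> s then bcoeff g (s - k, k) * X (s - k) k else 0) =
        (\<Sum>k\<le>max s (degree g). if k \<le> s then bcoeff g (s - k, k) * X (s - k) k else 0)"
      by (rule sum.mono_neutral_left) (auto simp: bcoeff_def coeff_eq_0)
    also have "\<dots> = (\<Sum>k\<le>s. bcoeff g (s - k, k) * X (s - k) k)"
      by (rule sum.mono_neutral_cong_right) auto
    finally show ?thesis .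
  qed
  also have "\<dots> = (\<Sum>i\<le>s. bcoeff g (i, s - i) * X i (s - i))"
    by (rule sum.reindex_bij_witness[of _ "\<lambda>i. s - i" "\<lambda>i. s - i"]) auto
  also have "\<dots> = (if p + q = e then contract (to_poly g) (dual_seq (s + e) (bcoeff f)) p / (fact p * fact q) else 0)"
  proof (cases "p + q = e")
    case True
    have "X i (s - i) = dual_seq (s + e) (bcoeff f) (p + i) / (fact p * fact q)" if "i \<le> s" for i
    proof -
      have "s + e - (p + i) = q + (s - i)" using that True by simp
      then show ?thesis by (simp add: X_def dual_seq_def)
    qed
    then show ?thesis using True
      by (simp add: contract_def pairing_eq[OF degree_to_poly[OF g]] coeff_to_poly[OF g] sum_divide_distrib)
  next
    case False
    have "X i (s - i) = 0" if "i \<le> s" for i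
    proof -
      have "p + i + (q + (s - i)) \<noteq> s + e" using that False by simp
      then show ?thesis using formsD[OF f, of "p + i" "q + (s - i)"] by (auto simp: X_def)
    qed
    then show ?thesis using False by simp
  qed
  finally show ?thesis .
qed

lemma diff_action_forms: "g \<in> forms s \<Longrightarrow> f \<in> forms (s + e) \<Longrightarrow> diff_action g f \<in> forms e"
  by (auto simp: forms_def[of e] bcoeff_diff_action split: if_splits)

lemma diff_action_eq_0_iff:
  assumes g: "g \<in> forms s" and f: "f \<in> forms (s + e)"
  shows "diff_action g f = 0 \<longleftrightarrow> kills (dual_seq (s + e) (bcoeff f)) e (to_poly g)"
proof
  assume 0: "diff_action g f = 0"
  show "kills (dual_seq (s + e) (bcoeff f)) e (to_poly g)"
    unfolding kills_iff
  proof (intro allI impI)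
    fix k assume "k \<le> e"
    then have "contract (to_poly g) (dual_seq (s + e) (bcoeff f)) k / (fact k * fact (e - k)) = 0"
      using bcoeff_diff_action[OF g f, of k "e - k"] by (simp add: 0)
    then show "contract (to_poly g) (dual_seq (s + e) (bcoeff f)) k = 0" by simp
  qed
next
  assume "kills (dual_seq (s + e) (bcoeff f)) e (to_poly g)"
  then show "diff_action g f = 0"
    by (intro bcoeff_eqI) (auto simp: bcoeff_diff_action[OF g f] kills_iff split_paired_all)
qed

lemma contract_sum: "contract (\<Sum>i\<in>A. smult (r i) (p i)) c k = (\<Sum>i\<in>A. r i * contract (p i) c k)"
  by (simp add: contract_def pairing_sum pairing_smult)

lemma diff_action_lincomb:
  assumes g: "\<And>a. a < k \<Longrightarrow> g a \<in> forms s" and f: "f \<in> forms (s + e)"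
  shows "diff_action (\<Sum>a<k. r a *\<^sub>b g a) f = (\<Sum>a<k. r a *\<^sub>b diff_action (g a) f)"
proof (rule bcoeff_eqI)
  fix x :: "nat \<times> nat"
  obtain p q :: nat where x: "x = (p, q)" by (cases x)
  have "(\<Sum>a<k. r a *\<^sub>b g a) \<in> forms s"
    using g by (auto intro!: bp.subspace_sum[OF subspace_forms] bp.subspace_scale[OF subspace_forms])
  then have "bcoeff (diff_action (\<Sum>a<k. r a *\<^sub>b g a) f) (p, q) = (if p + q = e
      then contract (to_poly (\<Sum>a<k. r a *\<^sub>b g a)) (dual_seq (s + e) (bcoeff f)) p / (fact p * fact q) else 0)"
    by (rule bcoeff_diff_action[OF _ f])
  also have "\<dots> = (\<Sum>a<k. r a * (if p + q = e
      then contract (to_poly (g a)) (dual_seq (s + e) (bcoeff f)) p / (fact p * fact q) else 0))"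
    by (simp add: to_poly_sum contract_sum sum_divide_distrib)
  also have "\<dots> = (\<Sum>a<k. r a * bcoeff (diff_action (g a) f) (p, q))"
    by (intro sum.cong refl) (simp add: bcoeff_diff_action[OF g f])
  finally show "bcoeff (diff_action (\<Sum>a<k. r a *\<^sub>b g a) f) x = bcoeff (\<Sum>a<k. r a *\<^sub>b diff_action (g a) f) x"
    by (simp add: x bcoeff_sum)
qed

lemma diff_action_add:
  assumes g: "g \<in> forms s" and h: "h \<in> forms s" and f: "f \<in> forms (s + e)"
  shows "diff_action (g + h) f = diff_action g f + diff_action h f"
proof (rule bcoeff_eqI)
  fix x :: "nat \<times> nat"
  obtain p q :: nat where x: "x = (p, q)" by (cases x)
  show "bcoeff (diff_action (g + h) f) x = bcoeff (diff_action g f + diff_action h f) x"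
    unfolding x using bp.subspace_add[OF subspace_forms g h] g h f
    by (simp add: bcoeff_diff_action contract_def pairing_add add_divide_distrib)
qed

lemma dual_seq_scale: "dual_seq d (\<lambda>i. a * z i) = (\<lambda>i. a * dual_seq d z i)"
  by (auto simp: dual_seq_def)

lemma dual_seq_add: "dual_seq d (\<lambda>i. z i + z' i) = (\<lambda>i. dual_seq d z i + dual_seq d z' i)"
  by (auto simp: dual_seq_def algebra_simps)

lemma kills_scale_left: "kills c e p \<Longrightarrow> kills (\<lambda>i. a * c i) e p"
  by (simp add: kills_def pairing_scale_left)

lemma kills_scale_left_iff: "a \<noteq> 0 \<Longrightarrow> kills (\<lambda>i. a * c i) e p \<longleftrightarrow> kills c e p"
  by (simp add: kills_def pairing_scale_left)

lemma span_single: "bp.span {f} = range (\<lambda>a. a *\<^sub>b f)"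
  by (rule bp.span_singleton)

text \<open>
  The annihilator of \<open>f\<close> only depends on the sequence of \<open>f\<close>; all later arguments about \<open>perp\<close>
  use this description.
\<close>

lemma perp_span:
  assumes f: "f \<in> forms (s + e)"
  shows "perp s (bp.span {f}) = {g \<in> forms s. kills (dual_seq (s + e) (bcoeff f)) e (to_poly g)}"
proof -
  have "diff_action g (a *\<^sub>b f) = 0" if g: "g \<in> forms s" and k: "kills (dual_seq (s + e) (bcoeff f)) e (to_poly g)" for g a
  proof -
    have "a *\<^sub>b f \<in> forms (s + e)" using f subspace_forms bp.subspace_scale by blast
    moreover have "bcoeff (a *\<^sub>b f) = (\<lambda>i. a * bcoeff f i)" by auto
    ultimately show ?thesis
      using diff_action_eq_0_iff[OF g, of "a *\<^sub>b f" e] kills_scale_left[OF k] by (simp add: dual_seq_scale)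
  qed
  then have "diff_action g f' = 0" if "f' \<in> bp.span {f}" "g \<in> forms s" "kills (dual_seq (s + e) (bcoeff f)) e (to_poly g)" for g f'
    using that unfolding span_single by blast
  moreover have "f \<in> bp.span {f}" by (simp add: bp.span_base)
  ultimately show ?thesis
    unfolding perp_def using diff_action_eq_0_iff[OF _ f] by blast
qed

text \<open>
  No nonzero form of degree \<open>e\<close> annihilates the form of degree \<open>s + e\<close> with sequence \<open>c\<close>.
  Dually, the operators of degree \<open>s\<close> map that form onto all forms of degree \<open>e\<close>.
\<close>

definition nondegenerate :: "(nat \<Rightarrow> complex) \<Rightarrow> nat \<Rightarrow> nat \<Rightarrow> bool" where
  "nondegenerate c e s \<longleftrightarrow> (\<forall>h. degree h \<le> e \<longrightarrow> kills c s h \<longrightarrow> h = 0)"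

lemma nondegenerate_minor:
  assumes "nondegenerate c e s"
  shows "\<exists>I. det (mat (Suc e) (Suc e) (\<lambda>(a, b). if I a \<le> s then c (b + I a) else 0)) \<noteq> 0"
proof -
  have "\<exists>I. det (mat (Suc e) (Suc e) (\<lambda>(a, b). (\<lambda>b X. if X \<le> s then c (b + X) else 0) b (I a))) \<noteq> 0"
  proof (rule exists_minor)
    fix h assume h: "\<And>X. (\<Sum>b<Suc e. h b * (if X \<le> s then c (b + X) else 0)) = 0"
    define p where "p = (\<Sum>b<Suc e. monom (h b) b)"
    have cp: "coeff p b = (if b < Suc e then h b else 0)" for b
      by (simp add: p_def coeff_sum sum.delta del: sum.lessThan_Suc)
    have dp: "degree p \<le> e" by (rule degree_le) (simp add: cp)
    have "contract p c k = 0" if "k \<le> s" for k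
      using h[of k] that by (simp add: contract_def pairing_eq[OF dp] lessThan_Suc_atMost cp add.commute del: sum.lessThan_Suc)
    then have "p = 0" using assms dp by (simp add: nondegenerate_def kills_iff)
    then show "\<forall>b<Suc e. h b = 0" using cp by (metis coeff_0)
  qed
  then show ?thesis by simp
qed

text \<open>
  A nonvanishing maximal minor of the catalecticant selects \<open>e + 1\<close> monomials whose images form
  a basis of the forms of degree \<open>e\<close>; together with a basis of the annihilator these monomials
  form a basis of the forms of degree \<open>s\<close>.
\<close>

lemma nondegenerate_dimensions:
  assumes f: "f \<in> forms (s + e)" and nd: "nondegenerate (dual_seq (s + e) (bcoeff f)) e s"
  shows "bp.dim ((\<lambda>g. diff_action g f) ` forms s) = Suc e"
    and "bp.dim (perp s (bp.span {f})) + e = s"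
proof -
  let ?c = "dual_seq (s + e) (bcoeff f)"
  obtain I where I: "det (mat (Suc e) (Suc e) (\<lambda>(a, b). if I a \<le> s then ?c (b + I a) else 0)) \<noteq> 0"
    using nondegenerate_minor[OF nd] by blast
  define M where "M a = to_form s (monom 1 (I a))" for a
  define v where "v a = diff_action (M a) f" for a
  have M: "M a \<in> forms s" for a by (simp add: M_def)
  have v: "v a \<in> forms e" for a unfolding v_def by (rule diff_action_forms[OF M f])
  have dM: "to_poly (M a) = (if I a \<le> s then monom 1 (I a) else 0)" for a
    by (rule poly_eqI) (simp add: M_def coeff_to_poly[OF to_form_forms] bcoeff_to_form)
  have bv: "bcoeff (v a) (b, e - b) = (if I a \<le> s then ?c (b + I a) else 0) / (fact b * fact (e - b))"
    if "b < Suc e" for a b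
    using that pairing_monom_mult[of _ "I a" 1]
    by (auto simp: v_def bcoeff_diff_action[OF M f] dM contract_def pairing_def)
  have indep: "\<forall>a<Suc e. r a = 0" if "(\<Sum>a<Suc e. r a *\<^sub>b v a) = 0" for r
  proof (rule det_rows_independent[OF I])
    fix b assume b: "b < Suc e"
    have "0 = bcoeff (\<Sum>a<Suc e. r a *\<^sub>b v a) (b, e - b)" using that by (simp del: sum.lessThan_Suc)
    also have "\<dots> = (\<Sum>a<Suc e. r a * (if I a \<le> s then ?c (b + I a) else 0)) / (fact b * fact (e - b))"
      unfolding bcoeff_sum bcoeff_scale bv[OF b] by (simp add: sum_divide_distrib del: sum.lessThan_Suc)
    finally show "(\<Sum>a<Suc e. r a * (if I a \<le> s then ?c (b + I a) else 0)) = 0" by (simp del: sum.lessThan_Suc)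
  qed
  note fi = family_independent[OF indep]
  have spv: "bp.span (v ` {..<Suc e}) = forms e"
    unfolding forms_eq_span[symmetric]
    by (rule span_eq_by_card) (use fi v in \<open>auto simp: forms_basis(2) forms_eq_span simp del: lessThan_Suc\<close>)
  show "bp.dim ((\<lambda>g. diff_action g f) ` forms s) = Suc e"
  proof -
    have "v ` {..<Suc e} \<subseteq> (\<lambda>g. diff_action g f) ` forms s" using M by (auto simp: v_def)
    moreover have "(\<lambda>g. diff_action g f) ` forms s \<subseteq> bp.span (v ` {..<Suc e})"
      unfolding spv using diff_action_forms f by blast
    ultimately show ?thesis using bp.basis_card_eq_dim fi(1,3) by metis
  qed
  let ?P = "perp s (bp.span {f})"
  have Pf: "?P \<subseteq> forms s" by (auto simp: perp_def)
  have P0: "g \<in> ?P \<longleftrightarrow> g \<in> forms s \<and> diff_action g f = 0" for g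
    unfolding perp_span[OF f] using diff_action_eq_0_iff[OF _ f] by blast
  have subP: "bp.subspace ?P"
    unfolding perp_span[OF f] bp.subspace_def kills_def using subspace_forms
    by (auto simp: bp.subspace_def pairing_add distrib_right pairing_smult)
  obtain B where B: "finite B" "B \<subseteq> ?P" "bp.independent B" "?P \<subseteq> bp.span B" "card B = bp.dim ?P"
    using basis_forms_exists[OF Pf] by metis
  have spB: "bp.span B = ?P" using B subP by (simp add: bp.span_minimal subset_antisym)
  have ext: "bp.independent (B \<union> M ` {..<Suc e}) \<and> inj_on M {..<Suc e} \<and> card (B \<union> M ` {..<Suc e}) = card B + Suc e"
  proof (rule family_extend[OF B(1,3)])
    fix r assume "(\<Sum>a<Suc e. r a *\<^sub>b M a) \<in> bp.span B"
    then have "diff_action (\<Sum>a<Suc e. r a *\<^sub>b M a) f = 0" unfolding spB P0 by simp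
    then have "(\<Sum>a<Suc e. r a *\<^sub>b v a) = 0" using diff_action_lincomb[of "Suc e" M s f e r] M f by (simp add: v_def del: sum.lessThan_Suc)
    then show "\<forall>a<Suc e. r a = 0" by (rule indep)
  qed
  have "forms s \<subseteq> bp.span (B \<union> M ` {..<Suc e})"
  proof
    fix g assume g: "g \<in> forms s"
    have "diff_action g f \<in> bp.span (v ` {..<Suc e})" unfolding spv by (rule diff_action_forms[OF g f])
    then obtain r where r: "diff_action g f = (\<Sum>a<Suc e. r a *\<^sub>b v a)" unfolding span_family by blast
    let ?h = "\<Sum>a<Suc e. r a *\<^sub>b M a"
    have hf: "?h \<in> forms s" using M subspace_forms by (auto intro!: bp.subspace_sum bp.subspace_scale simp del: sum.lessThan_Suc)
    have "diff_action ?h f = diff_action g f"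
      unfolding r using diff_action_lincomb[of "Suc e" M s f e r] M f by (simp add: v_def del: sum.lessThan_Suc)
    moreover have "diff_action (g - ?h + ?h) f = diff_action (g - ?h) f + diff_action ?h f"
      by (rule diff_action_add[OF bp.subspace_diff[OF subspace_forms g hf] hf f])
    then have "diff_action g f = diff_action (g - ?h) f + diff_action ?h f" by (simp only: diff_add_cancel)
    ultimately have "g - ?h \<in> ?P" using bp.subspace_diff[OF subspace_forms g hf] by (simp add: P0 del: sum.lessThan_Suc)
    then have "g - ?h \<in> bp.span (B \<union> M ` {..<Suc e})" using spB bp.span_mono[of B "B \<union> M ` {..<Suc e}"] by auto
    moreover have "?h \<in> bp.span (B \<union> M ` {..<Suc e})"
      by (intro bp.span_sum bp.span_scale bp.span_base) auto
    ultimately have "(g - ?h) + ?h \<in> bp.span (B \<union> M ` {..<Suc e})" by (rule bp.span_add)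
    then show "g \<in> bp.span (B \<union> M ` {..<Suc e})" by simp
  qed
  moreover have "B \<union> M ` {..<Suc e} \<subseteq> forms s" using B(2) Pf M by auto
  ultimately have "card (B \<union> M ` {..<Suc e}) = bp.dim (forms s)"
    using bp.basis_card_eq_dim ext by blast
  also have "\<dots> = Suc s" unfolding forms_eq_span[symmetric]
    using bp.dim_span_eq_card_independent forms_basis by metis
  finally show "bp.dim ?P + e = s" using ext B(5) by simp
qed

section \<open>Zariski closures in projective space\<close>

lemma PP_forms_iff: "L \<in> PP (forms d) \<longleftrightarrow> (\<exists>f\<in>forms d. f \<noteq> 0 \<and> L = bp.span {f})"
proof
  assume L: "L \<in> PP (forms d)"
  then have sub: "bp.subspace L" "L \<subseteq> forms d" and dim: "bp.dim L = 1" by (auto simp: PP_def Gr_def)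
  obtain B where B: "finite B" "B \<subseteq> L" "bp.independent B" "L \<subseteq> bp.span B" "card B = bp.dim L"
    using basis_forms_exists[OF sub(2)] by metis
  obtain f where f: "B = {f}" using B(5) dim by (auto simp: card_Suc_eq numeral_eq_Suc dest: card_1_singletonE)
  have "L = bp.span {f}" using B sub(1) unfolding f by (simp add: bp.span_minimal subset_antisym)
  then show "\<exists>f\<in>forms d. f \<noteq> 0 \<and> L = bp.span {f}" using B sub(2) unfolding f by auto
next
  assume "\<exists>f\<in>forms d. f \<noteq> 0 \<and> L = bp.span {f}"
  then obtain f where f: "f \<in> forms d" "f \<noteq> 0" "L = bp.span {f}" by blast
  have "bp.dim L = 1" using f by (simp add: bp.dim_eq_card_independent)
  then show "L \<in> PP (forms d)"
    using f bp.span_minimal[of "{f}" "forms d"] subspace_forms by (simp add: PP_def Gr_def bp.subspace_span)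
qed

lemma zariski_closure_superset: "A \<subseteq> U \<Longrightarrow> A \<subseteq> zariski_closure hc U A"
  unfolding zariski_closure_def by blast

lemma proj_closureI:
  assumes "L \<in> PP V" and "\<And>e F z. homog_poly e F \<Longrightarrow> \<forall>a\<in>A. \<forall>z\<in>point_coords a. F z = 0 \<Longrightarrow>
    z \<in> point_coords L \<Longrightarrow> F z = 0"
  shows "L \<in> proj_closure V A"
  unfolding proj_closure_def zariski_closure_def using assms by simp

lemma proj_closure_PP: "L \<in> proj_closure V A \<Longrightarrow> L \<in> PP V"
  unfolding proj_closure_def zariski_closure_def by simp

lemma proj_closureD:
  assumes "L \<in> proj_closure V A" "homog_poly e F" "\<forall>a\<in>A. \<forall>z\<in>point_coords a. F z = 0" "z \<in> point_coords L"
  shows "F z = 0"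
  using assms unfolding proj_closure_def zariski_closure_def by simp

lemma proj_closure_separate:
  assumes "L \<in> PP V" and "L \<notin> proj_closure V A"
  shows "\<exists>e F z. homog_poly e F \<and> (\<forall>a\<in>A. \<forall>z\<in>point_coords a. F z = 0) \<and> z \<in> point_coords L \<and> F z \<noteq> 0"
  using assms unfolding proj_closure_def zariski_closure_def by simp blast

lemma proj_closure_least:
  assumes "A \<subseteq> proj_closure V B"
  shows "proj_closure V A \<subseteq> proj_closure V B"
proof
  fix L assume L: "L \<in> proj_closure V A"
  show "L \<in> proj_closure V B"
  proof (rule proj_closureI[OF proj_closure_PP[OF L]])
    fix e F z assume F: "homog_poly e F" "\<forall>a\<in>B. \<forall>z\<in>point_coords a. F z = 0" and z: "z \<in> point_coords L"
    have "\<forall>a\<in>A. \<forall>z\<in>point_coords a. F z = 0"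
      using assms by (auto intro!: proj_closureD[OF _ F])
    then show "F z = 0" by (rule proj_closureD[OF L F(1) _ z])
  qed
qed

lemma proj_closure_superset: "A \<subseteq> PP V \<Longrightarrow> A \<subseteq> proj_closure V A"
  unfolding proj_closure_def by (rule zariski_closure_superset)

lemma homog_poly_nonzero_generator:
  assumes "homog_poly e F" "z \<in> point_coords (bp.span {f})" "F z \<noteq> 0"
  shows "F (bcoeff f) \<noteq> 0"
proof -
  obtain t where "z = bcoeff (t *\<^sub>b f)" using assms(2) by (auto simp: point_coords_def span_single)
  then have "z = (\<lambda>i. t * bcoeff f i)" by auto
  then show ?thesis using assms(3) homog_poly_scaling[OF assms(1), of t "bcoeff f"] by auto
qed

lemma generator_coords: "f \<noteq> 0 \<Longrightarrow> bcoeff f \<in> point_coords (bp.span {f})"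
  unfolding point_coords_def by (intro imageI) (simp add: bp.span_base)

text \<open>
  A product of separating polynomials separates from both sets. All coordinate vectors of a
  point are proportional, so the two polynomials may be compared at one of them.
\<close>

lemma proj_closure_Un:
  "proj_closure (forms d) (A \<union> B) \<subseteq> proj_closure (forms d) A \<union> proj_closure (forms d) B"
proof (rule subsetI, rule ccontr)
  fix L assume L: "L \<in> proj_closure (forms d) (A \<union> B)"
    and n: "L \<notin> proj_closure (forms d) A \<union> proj_closure (forms d) B"
  obtain f where f: "f \<noteq> 0" "L = bp.span {f}"
    using proj_closure_PP[OF L] unfolding PP_forms_iff by blast
  have "L \<notin> proj_closure (forms d) A" "L \<notin> proj_closure (forms d) B" using n by auto
  note sep = this[THEN proj_closure_separate[OF proj_closure_PP[OF L]]]
  from sep(1) obtain e F z where F: "homog_poly e F" "\<forall>a\<in>A. \<forall>z\<in>point_coords a. F z = 0" "z \<in> point_coords L" "F z \<noteq> 0"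
    by blast
  from sep(2) obtain e' G z' where G: "homog_poly e' G" "\<forall>a\<in>B. \<forall>z\<in>point_coords a. G z = 0" "z' \<in> point_coords L" "G z' \<noteq> 0"
    by blast
  have "\<forall>a\<in>A \<union> B. \<forall>z\<in>point_coords a. F z * G z = 0" using F(2) G(2) by auto
  then have "F (bcoeff f) * G (bcoeff f) = 0"
    using proj_closureD[OF L homog_poly.mult[OF F(1) G(1)]] generator_coords[OF f(1)] f(2) by blast
  moreover have "F (bcoeff f) \<noteq> 0" "G (bcoeff f) \<noteq> 0"
    using homog_poly_nonzero_generator[OF F(1)] homog_poly_nonzero_generator[OF G(1)] F(3,4) G(3,4) f(2) by auto
  ultimately show False by simp
qed

lemma proj_closure_empty: "proj_closure (forms d) {} = {}"
proof -
  have False if L: "L \<in> proj_closure (forms d) {}" for L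
  proof -
    obtain f where f: "f \<noteq> 0" "L = bp.span {f}"
      using proj_closure_PP[OF L] unfolding PP_forms_iff by blast
    have "(1::complex) = 0"
      using proj_closureD[OF L homog_poly.const[of 1]] generator_coords[OF f(1)] f(2) by auto
    then show False by simp
  qed
  then show ?thesis by blast
qed

lemma proj_closure_UN:
  "finite I \<Longrightarrow> proj_closure (forms d) (\<Union>i\<in>I. A i) \<subseteq> (\<Union>i\<in>I. proj_closure (forms d) (A i))"
proof (induction I rule: finite_induct)
  case empty
  then show ?case by (simp add: proj_closure_empty)
next
  case (insert i I)
  then show ?case using proj_closure_Un[of d "A i" "\<Union>i\<in>I. A i"] by auto
qed

section \<open>Products of linear forms\<close>

text \<open>
  The dehomogenization of the linear form with coefficients \<open>a i\<close>, \<open>b i\<close>. Its zero lies at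
  infinity if \<open>a i = 0\<close>.
\<close>

definition lfac :: "(nat \<Rightarrow> complex) \<Rightarrow> (nat \<Rightarrow> complex) \<Rightarrow> nat \<Rightarrow> complex poly" where
  "lfac a b i = [:b i, a i:]"

definition lprod :: "nat \<Rightarrow> (nat \<Rightarrow> nat) \<Rightarrow> (nat \<Rightarrow> complex) \<Rightarrow> (nat \<Rightarrow> complex) \<Rightarrow> complex poly" where
  "lprod n e a b = (\<Prod>i<n. lfac a b i ^ e i)"

definition proper :: "nat \<Rightarrow> (nat \<Rightarrow> complex) \<Rightarrow> (nat \<Rightarrow> complex) \<Rightarrow> bool" where
  "proper n a b \<longleftrightarrow> (\<forall>i<n. (a i, b i) \<noteq> (0, 0))"

text \<open>
  Pairwise independent linear forms, all with a zero in the affine chart.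
\<close>

definition generic :: "nat \<Rightarrow> (nat \<Rightarrow> complex) \<Rightarrow> (nat \<Rightarrow> complex) \<Rightarrow> bool" where
  "generic n a b \<longleftrightarrow> (\<forall>i<n. a i \<noteq> 0) \<and> (\<forall>i<n. \<forall>j<n. i \<noteq> j \<longrightarrow> a i * b j \<noteq> a j * b i)"

lemma generic_proper: "generic n a b \<Longrightarrow> proper n a b"
  by (simp add: generic_def proper_def)

lemma lfac_nonzero: "proper n a b \<Longrightarrow> i < n \<Longrightarrow> lfac a b i \<noteq> 0"
  by (auto simp: proper_def lfac_def)

lemma lprod_nonzero: "proper n a b \<Longrightarrow> lprod n e a b \<noteq> 0"
  by (auto simp: lprod_def lfac_nonzero)

lemma degree_lfac: "degree (lfac a b i) \<le> 1"
  by (simp add: lfac_def)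

lemma degree_lprod: "degree (lprod n e a b) \<le> (\<Sum>i<n. e i)"
proof -
  have "degree (lprod n e a b) \<le> (\<Sum>i<n. degree (lfac a b i ^ e i))"
    unfolding lprod_def using degree_prod_sum_le[of "{..<n}" "\<lambda>i. lfac a b i ^ e i"] by (simp add: o_def)
  also have "\<dots> \<le> (\<Sum>i<n. e i)"
    by (rule sum_mono) (use degree_lfac in \<open>auto intro: order_trans[OF degree_power_le]\<close>)
  finally show ?thesis .
qed

definition lroot :: "(nat \<Rightarrow> complex) \<Rightarrow> (nat \<Rightarrow> complex) \<Rightarrow> nat \<Rightarrow> complex" where
  "lroot a b i = - b i / a i"

lemma poly_lfac_root_iff:
  assumes "generic n a b" "i < n" "j < n"
  shows "poly (lfac a b j) (lroot a b i) = 0 \<longleftrightarrow> i = j"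
proof -
  have "a i \<noteq> 0" "i \<noteq> j \<Longrightarrow> a i * b j \<noteq> a j * b i" using assms by (auto simp: generic_def)
  then show ?thesis by (auto simp: lfac_def lroot_def field_simps)
qed

lemma lroot_inj: "generic n a b \<Longrightarrow> inj_on (lroot a b) {..<n}"
  by (rule inj_onI) (use poly_lfac_root_iff in \<open>metis lessThan_iff\<close>)

lemma zero_of_many_roots:
  assumes "generic n a b" "degree p < n" "\<And>i. i < n \<Longrightarrow> poly p (lroot a b i) = 0"
  shows "p = 0"
proof (rule ccontr)
  assume p: "p \<noteq> 0"
  have "n = card (lroot a b ` {..<n})" using lroot_inj[OF assms(1)] by (simp add: card_image)
  also have "\<dots> \<le> card {x. poly p x = 0}" by (rule card_mono) (use assms(3) poly_roots_finite[OF p] in auto)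
  also have "\<dots> \<le> degree p" by (rule card_poly_roots_bound[OF p])
  finally show False using assms(2) by simp
qed

text \<open>
  The products of all but one factor; they play the role of the Lagrange basis in
  \<open>interpolation\<close>.
\<close>

definition others :: "nat \<Rightarrow> (nat \<Rightarrow> complex) \<Rightarrow> (nat \<Rightarrow> complex) \<Rightarrow> nat \<Rightarrow> complex poly" where
  "others n a b i = (\<Prod>j\<in>{..<n} - {i}. lfac a b j)"

lemma degree_others: "i < n \<Longrightarrow> degree (others n a b i) \<le> n - 1"
proof -
  assume i: "i < n"
  have "degree (others n a b i) \<le> (\<Sum>j\<in>{..<n} - {i}. degree (lfac a b j))"
    unfolding others_def using degree_prod_sum_le[of "{..<n} - {i}" "lfac a b"] by (simp add: o_def)
  also have "\<dots> \<le> (\<Sum>j\<in>{..<n} - {i}. 1)" by (rule sum_mono) (rule degree_lfac)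
  finally show ?thesis using i by simp
qed

lemma lfac_others: "i < n \<Longrightarrow> lfac a b i * others n a b i = (\<Prod>j<n. lfac a b j)"
  unfolding others_def by (simp add: prod.remove[of "{..<n}" i])

lemma poly_others_root:
  assumes "generic n a b" "i < n" "j < n"
  shows "poly (others n a b i) (lroot a b j) \<noteq> 0 \<longleftrightarrow> i = j"
  using assms by (auto simp: others_def poly_prod poly_lfac_root_iff)

lemma lprod_pred_others:
  assumes e: "\<And>i. i < n \<Longrightarrow> e i > 0" and i: "i < n"
  shows "lfac a b i ^ (e i - 1) * (\<Prod>j\<in>{..<n} - {i}. lfac a b j ^ e j) = lprod n (\<lambda>i. e i - 1) a b * others n a b i"
proof -
  have "(\<Prod>j\<in>{..<n} - {i}. lfac a b j ^ e j) = (\<Prod>j\<in>{..<n} - {i}. lfac a b j ^ (e j - 1) * lfac a b j)"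
    by (rule prod.cong[OF refl]) (use e in \<open>auto simp: power_Suc2[symmetric] simp del: power_Suc2\<close>)
  also have "\<dots> = (\<Prod>j\<in>{..<n} - {i}. lfac a b j ^ (e j - 1)) * others n a b i"
    by (simp add: prod.distrib others_def)
  finally have "lfac a b i ^ (e i - 1) * (\<Prod>j\<in>{..<n} - {i}. lfac a b j ^ e j) =
      (lfac a b i ^ (e i - 1) * (\<Prod>j\<in>{..<n} - {i}. lfac a b j ^ (e j - 1))) * others n a b i" by simp
  also have "lfac a b i ^ (e i - 1) * (\<Prod>j\<in>{..<n} - {i}. lfac a b j ^ (e j - 1)) = lprod n (\<lambda>i. e i - 1) a b"
    unfolding lprod_def using i by (simp add: prod.remove[of "{..<n}" i])
  finally show ?thesis .
qed

lemma lprod_pred_prod: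
  assumes e: "\<And>i. i < n \<Longrightarrow> e i > 0"
  shows "lprod n e a b = lprod n (\<lambda>i. e i - 1) a b * (\<Prod>j<n. lfac a b j)"
  unfolding lprod_def prod.distrib[symmetric] using e
  by (intro prod.cong refl) (auto simp: power_Suc2[symmetric] simp del: power_Suc2)

lemma lead_prod_lfac: "coeff (\<Prod>j<n. lfac a b j) n = (\<Prod>j<n. a j)"
proof (induction n)
  case (Suc n)
  have "degree (\<Prod>j<n. lfac a b j) \<le> n" using degree_lprod[of n "\<lambda>_. 1" a b] by (simp add: lprod_def)
  then have "coeff (\<Prod>j<n. lfac a b j) (Suc n) = 0" by (intro coeff_eq_0) simp
  then show ?case using Suc by (simp add: lfac_def coeff_pCons mult.commute[of _ "[:b n, a n:]"] del: mult_pCons_right)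
qed simp

lemma degree_prod_lfac: "degree (\<Prod>j<n. lfac a b j) \<le> n"
  using degree_lprod[of n "\<lambda>_. 1" a b] by (simp add: lprod_def)

lemma interpolation:
  assumes g: "generic n a b" and h: "degree h \<le> n"
  shows "\<exists>c k. h = smult c (\<Prod>j<n. lfac a b j) + (\<Sum>i<n. smult (k i) (others n a b i))"
proof -
  \<comment> \<open>The constant \<open>c\<close> accounts for the coefficient of degree \<open>n\<close>, the Lagrange basis for the
  rest.\<close>
  define c where "c = coeff h n / (\<Prod>j<n. a j)"
  define k where "k i = poly h (lroot a b i) / poly (others n a b i) (lroot a b i)" for i
  define r where "r = h - smult c (\<Prod>j<n. lfac a b j) - (\<Sum>i<n. smult (k i) (others n a b i))"
  have an: "(\<Prod>j<n. a j) \<noteq> 0" using g by (auto simp: generic_def)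
  have "r = 0"
  proof (cases "n = 0")
    case True
    then show ?thesis using h by (auto simp: r_def c_def degree_eq_zeroE elim: degree_eq_zeroE)
  next
    case False
    have do: "coeff (others n a b i) n = 0" if "i < n" for i
      by (rule coeff_eq_0) (use degree_others[OF that, of a b] False in simp)
    have "degree r \<le> n" unfolding r_def
      by (intro degree_diff_le h order_trans[OF degree_smult_le] degree_sum_le degree_prod_lfac)
        (auto intro: order_trans[OF degree_smult_le] order_trans[OF degree_others])
    moreover have "coeff r n = 0"
      using an do by (simp add: r_def coeff_sum lead_prod_lfac c_def)
    ultimately have "degree r < n" using False by (metis le_neq_implies_less leading_coeff_0_iff degree_0 neq0_conv)
    moreover have "poly r (lroot a b j) = 0" if j: "j < n" for j
    proof -
      have "poly (\<Sum>i<n. smult (k i) (others n a b i)) (lroot a b j) =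
          (\<Sum>i<n. if i = j then k j * poly (others n a b j) (lroot a b j) else 0)"
        unfolding poly_sum poly_smult using poly_others_root[OF g _ j] by (intro sum.cong refl) auto
      also have "\<dots> = poly h (lroot a b j)" using j poly_others_root[OF g j j] by (simp add: k_def)
      finally have 1: "poly (\<Sum>i<n. smult (k i) (others n a b i)) (lroot a b j) = poly h (lroot a b j)" .
      have 2: "poly (\<Prod>j<n. lfac a b j) (lroot a b j) = 0"
        using poly_lfac_root_iff[OF g j j] j by (auto simp: poly_prod)
      show ?thesis unfolding r_def poly_diff 1 poly_smult 2 by simp
    qed
    ultimately show ?thesis using zero_of_many_roots[OF g] by blast
  qed
  then show ?thesis unfolding r_def by (intro exI[of _ c] exI[of _ k]) (simp add: algebra_simps)
qed

section \<open>Coefficientwise limits and derivatives\<close>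

lemma eventually_poly_nonzero:
  assumes "p \<noteq> 0"
  shows "\<forall>\<^sub>F x in at (0::complex). poly p x \<noteq> 0"
proof -
  have "open (- ({x. poly p x = 0} - {0}))"
    by (intro open_Compl finite_imp_closed finite_Diff poly_roots_finite assms)
  then have "\<forall>\<^sub>F x in at (0::complex). x \<in> - ({x. poly p x = 0} - {0})"
    by (intro eventually_at_in_open') auto
  moreover have "\<forall>\<^sub>F x in at (0::complex). x \<noteq> 0" by (simp add: eventually_at_filter)
  ultimately show ?thesis by eventually_elim auto
qed

text \<open>
  A perturbation that makes any family of linear forms generic. The slopes \<open>of_nat i\<close> are
  pairwise distinct, which makes every condition a nonzero polynomial in \<open>x\<close>.
\<close>

lemma eventually_generic:
  "\<forall>\<^sub>F x in at (0::complex). generic n (\<lambda>i. a i + x) (\<lambda>i. b i + x * of_nat i)"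
proof -
  have "\<forall>\<^sub>F x in at 0. \<forall>i\<in>{..<n}. a i + x \<noteq> 0"
    unfolding eventually_ball_finite_distrib[OF finite_lessThan]
    using eventually_poly_nonzero[of "[:a _, 1:]"] by simp
  moreover have "\<forall>\<^sub>F x in at 0. \<forall>i\<in>{..<n}. \<forall>j\<in>{..<n}. i \<noteq> j \<longrightarrow>
      (a i + x) * (b j + x * of_nat j) \<noteq> (a j + x) * (b i + x * of_nat i)"
    unfolding eventually_ball_finite_distrib[OF finite_lessThan]
  proof (intro ballI)
    fix i j
    show "\<forall>\<^sub>F x in at 0. i \<noteq> j \<longrightarrow> (a i + x) * (b j + x * of_nat j) \<noteq> (a j + x) * (b i + x * of_nat i)"
    proof (cases "i = j")
      case False
      let ?p = "[:a i, 1:] * [:b j, of_nat j:] - [:a j, 1:] * [:b i, of_nat i:]"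
      have "coeff ?p 2 = of_nat j - of_nat i" by (simp add: numeral_2_eq_2)
      then have "?p \<noteq> 0" using False by (metis coeff_0 eq_iff_diff_eq_0 of_nat_eq_iff)
      from eventually_poly_nonzero[OF this] show ?thesis
        by eventually_elim (auto simp: algebra_simps)
    qed simp
  qed
  ultimately show ?thesis unfolding generic_def by eventually_elim auto
qed

definition coeff_tendsto :: "(complex \<Rightarrow> complex poly) \<Rightarrow> complex poly \<Rightarrow> complex filter \<Rightarrow> bool" where
  "coeff_tendsto Q p F \<longleftrightarrow> (\<forall>i. ((\<lambda>x. coeff (Q x) i) \<longlongrightarrow> coeff p i) F)"

lemma coeff_tendsto_const: "coeff_tendsto (\<lambda>_. p) p F"
  by (simp add: coeff_tendsto_def)

lemma coeff_tendsto_mult: "coeff_tendsto Q p F \<Longrightarrow> coeff_tendsto R q F \<Longrightarrow> coeff_tendsto (\<lambda>x. Q x * R x) (p * q) F"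
  unfolding coeff_tendsto_def coeff_mult by (auto intro!: tendsto_sum tendsto_mult)

lemma coeff_tendsto_power: "coeff_tendsto Q p F \<Longrightarrow> coeff_tendsto (\<lambda>x. Q x ^ e) (p ^ e) F"
  by (induction e) (auto intro: coeff_tendsto_const coeff_tendsto_mult)

lemma coeff_tendsto_prod:
  "(\<And>i. i \<in> A \<Longrightarrow> coeff_tendsto (Q i) (p i) F) \<Longrightarrow> coeff_tendsto (\<lambda>x. \<Prod>i\<in>A. Q i x) (\<Prod>i\<in>A. p i) F"
  by (induction A rule: infinite_finite_induct) (auto intro: coeff_tendsto_const coeff_tendsto_mult)

lemma coeff_tendsto_lfac: "coeff_tendsto (\<lambda>x. lfac (\<lambda>i. a i + x) (\<lambda>i. b i + x * of_nat i) i) (lfac a b i) (at 0)"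
  unfolding coeff_tendsto_def
proof
  fix k
  show "((\<lambda>x. coeff (lfac (\<lambda>i. a i + x) (\<lambda>i. b i + x * of_nat i) i) k) \<longlongrightarrow> coeff (lfac a b i) k) (at 0)"
    by (cases k; cases "k - 1") (auto simp: lfac_def intro!: tendsto_eq_intros)
qed

lemma coeff_tendsto_lprod:
  "coeff_tendsto (\<lambda>x. lprod n e (\<lambda>i. a i + x) (\<lambda>i. b i + x * of_nat i)) (lprod n e a b) (at 0)"
  unfolding lprod_def by (intro coeff_tendsto_prod coeff_tendsto_power coeff_tendsto_lfac)

lemma tendsto_bcoeff_to_form: "coeff_tendsto Q p F \<Longrightarrow> ((\<lambda>x. bcoeff (to_form s (Q x)) y) \<longlongrightarrow> bcoeff (to_form s p) y) F"
  by (cases y) (auto simp: bcoeff_to_form coeff_tendsto_def)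

definition coeff_deriv :: "(complex \<Rightarrow> complex poly) \<Rightarrow> complex poly \<Rightarrow> bool" where
  "coeff_deriv Q q \<longleftrightarrow> (\<forall>i. ((\<lambda>t. coeff (Q t) i) has_field_derivative coeff q i) (at 0))"

lemma coeff_deriv_mult:
  assumes "coeff_deriv Q q" "coeff_deriv R r"
  shows "coeff_deriv (\<lambda>t. Q t * R t) (q * R 0 + r * Q 0)"
  unfolding coeff_deriv_def coeff_mult
proof
  fix i
  have "((\<lambda>t. \<Sum>j\<le>i. coeff (Q t) j * coeff (R t) (i - j)) has_field_derivative
      (\<Sum>j\<le>i. coeff q j * coeff (R 0) (i - j) + coeff r (i - j) * coeff (Q 0) j)) (at 0)"
    using assms by (intro DERIV_sum DERIV_mult) (auto simp: coeff_deriv_def)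
  also have "(\<Sum>j\<le>i. coeff q j * coeff (R 0) (i - j) + coeff r (i - j) * coeff (Q 0) j) = coeff (q * R 0 + Q 0 * r) i"
    by (simp only: coeff_add coeff_mult sum.distrib mult.commute[of "coeff r _"])
  finally show "((\<lambda>t. \<Sum>j\<le>i. coeff (Q t) j * coeff (R t) (i - j)) has_field_derivative coeff (q * R 0 + r * Q 0) i) (at 0)"
    by (simp only: mult.commute[of r])
qed

lemma coeff_deriv_const: "coeff_deriv (\<lambda>_. p) 0"
  by (simp add: coeff_deriv_def)

lemma coeff_deriv_power:
  assumes "coeff_deriv Q q"
  shows "coeff_deriv (\<lambda>t. Q t ^ e) (of_nat e * q * Q 0 ^ (e - 1))"
proof (induction e)
  case 0
  then show ?case by (simp add: coeff_deriv_const)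
next
  case (Suc e)
  have "coeff_deriv (\<lambda>t. Q t * Q t ^ e) (q * Q 0 ^ e + of_nat e * q * Q 0 ^ (e - 1) * Q 0)"
    by (rule coeff_deriv_mult[OF assms Suc])
  also have "q * Q 0 ^ e + of_nat e * q * Q 0 ^ (e - 1) * Q 0 = of_nat (Suc e) * q * Q 0 ^ e"
    by (cases e) (simp_all add: algebra_simps)
  finally show ?case by simp
qed

lemma coeff_deriv_prod:
  assumes "finite A" "\<And>i. i \<in> A \<Longrightarrow> coeff_deriv (Q i) (q i)"
  shows "coeff_deriv (\<lambda>t. \<Prod>i\<in>A. Q i t) (\<Sum>i\<in>A. q i * (\<Prod>j\<in>A - {i}. Q j 0))"
  using assms
proof (induction A rule: finite_induct)
  case empty
  then show ?case by (simp add: coeff_deriv_const)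
next
  case (insert x A)
  have "coeff_deriv (\<lambda>t. Q x t * (\<Prod>i\<in>A. Q i t))
      (q x * (\<Prod>i\<in>A. Q i 0) + (\<Sum>i\<in>A. q i * (\<Prod>j\<in>A - {i}. Q j 0)) * Q x 0)"
    using insert by (intro coeff_deriv_mult) auto
  also have "(\<Sum>i\<in>A. q i * (\<Prod>j\<in>A - {i}. Q j 0)) * Q x 0 = (\<Sum>i\<in>A. q i * (\<Prod>j\<in>insert x A - {i}. Q j 0))"
    unfolding sum_distrib_right
  proof (intro sum.cong refl)
    fix i assume "i \<in> A"
    then have "insert x A - {i} = insert x (A - {i})" using insert.hyps by auto
    then show "q i * (\<Prod>j\<in>A - {i}. Q j 0) * Q x 0 = q i * (\<Prod>j\<in>insert x A - {i}. Q j 0)"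
      using insert.hyps by (simp add: mult.commute)
  qed
  finally show ?case using insert.hyps by simp
qed

lemma smult_sum_right: "smult c (\<Sum>i\<in>A. p i) = (\<Sum>i\<in>A. smult c (p i))" for c :: complex
  by (induction A rule: infinite_finite_induct) (auto simp: smult_add_right)

section \<open>Tangent spaces of coincident root loci\<close>

definition locus :: "nat \<Rightarrow> (nat \<Rightarrow> nat) \<Rightarrow> bpoly set set" where
  "locus n e = {bp.span {to_form (\<Sum>i<n. e i) (lprod n e a b)} | a b. proper n a b}"

lemma to_form_lprod_nonzero: "proper n a b \<Longrightarrow> to_form (\<Sum>i<n. e i) (lprod n e a b) \<noteq> 0"
  using lprod_nonzero to_form_eq_0 degree_lprod by blast

lemma vanishing_on_locus:
  assumes F: "\<forall>p\<in>locus n e. \<forall>z\<in>point_coords p. F z = 0" and "proper n a b" "c \<noteq> 0"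
  shows "F (bcoeff (to_form (\<Sum>i<n. e i) (smult c (lprod n e a b)))) = 0"
proof -
  let ?f = "to_form (\<Sum>i<n. e i) (lprod n e a b)"
  have "bp.span {?f} \<in> locus n e" using assms(2) by (auto simp: locus_def)
  moreover have "c *\<^sub>b ?f \<in> bp.span {?f} - {0}"
    using assms(3) to_form_lprod_nonzero[OF assms(2)] by (auto simp: span_single)
  ultimately show ?thesis using F by (auto simp: point_coords_def to_form_smult)
qed

text \<open>
  Moving the zeros and the scalar factor gives curves in the root locus through the point. By
  Lagrange interpolation their velocities fill all multiples of \<open>\<Prod> l_i ^ (e_i - 1)\<close> of the right
  degree.
\<close>

lemma tangent_contains_generic:
  fixes e :: "nat \<Rightarrow> nat" and n :: nat
  defines "s \<equiv> \<Sum>i<n. e i"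
  assumes F: "\<forall>p\<in>locus n e. \<forall>z\<in>point_coords p. F z = 0" and D: "is_differential F D"
    and e: "\<And>i. i < n \<Longrightarrow> e i > 0" and g: "generic n a b" and c: "c \<noteq> 0" and h: "degree h \<le> n"
  shows "D (bcoeff (to_form s (smult c (lprod n e a b)))) (bcoeff (to_form s (lprod n (\<lambda>i. e i - 1) a b * h))) = 0"
proof -
  obtain c' k where hk: "h = smult c' (\<Prod>j<n. lfac a b j) + (\<Sum>i<n. smult (k i) (others n a b i))"
    using interpolation[OF g h] by blast
  \<comment> \<open>Velocities of the constant coefficients, scaled so that the factors \<open>e i\<close> and \<open>c\<close> arising
  from differentiation cancel.\<close>
  define q where "q i = k i / (c * of_nat (e i))" for i
  define b' where "b' t i = b i + t * q i" for t i
  define Q where "Q t = smult (c + t * c') (lprod n e a (b' t))" for t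
  let ?P = "lprod n (\<lambda>i. e i - 1) a b"
  have lin0: "lfac a (b' 0) = lfac a b" by (auto simp: lfac_def b'_def)
  have dlin: "coeff_deriv (\<lambda>t. lfac a (b' t) i) [:q i:]" for i
    unfolding coeff_deriv_def
  proof
    fix m
    show "((\<lambda>t. coeff (lfac a (b' t) i) m) has_field_derivative coeff [:q i:] m) (at 0)"
      by (cases m; cases "m - 1") (auto simp: lfac_def b'_def intro!: derivative_eq_intros)
  qed
  have dpl: "coeff_deriv (\<lambda>t. lprod n e a (b' t))
      (\<Sum>i<n. (of_nat (e i) * [:q i:] * lfac a b i ^ (e i - 1)) * (\<Prod>j\<in>{..<n} - {i}. lfac a b j ^ e j))"
    unfolding lprod_def
    using coeff_deriv_prod[of "{..<n}" "\<lambda>i t. lfac a (b' t) i ^ e i", OF finite_lessThan coeff_deriv_power[OF dlin]]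
    by (simp add: lin0)
  note Pi = lprod_pred_others[where n = n and e = e and a = a and b = b, OF e]
    and PW = lprod_pred_prod[where n = n and e = e and a = a and b = b, OF e]
  have dpl': "coeff_deriv (\<lambda>t. lprod n e a (b' t)) (smult (1 / c) (\<Sum>i<n. smult (k i) (?P * others n a b i)))"
  proof -
    have "(\<Sum>i<n. (of_nat (e i) * [:q i:] * lfac a b i ^ (e i - 1)) * (\<Prod>j\<in>{..<n} - {i}. lfac a b j ^ e j)) =
        smult (1 / c) (\<Sum>i<n. smult (k i) (?P * others n a b i))"
      unfolding smult_sum_right
    proof (intro sum.cong refl)
      fix i assume i: "i \<in> {..<n}"
      then have "of_nat (e i) * [:q i:] = [:k i / c:]" using e[of i] by (simp add: of_nat_poly q_def)
      then have "(of_nat (e i) * [:q i:] * lfac a b i ^ (e i - 1)) * (\<Prod>j\<in>{..<n} - {i}. lfac a b j ^ e j) =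
         [:k i / c:] * (lfac a b i ^ (e i - 1) * (\<Prod>j\<in>{..<n} - {i}. lfac a b j ^ e j))" by (simp only: mult.assoc)
      also have "\<dots> = smult (1 / c) (smult (k i) (?P * others n a b i))" using Pi[of i] i by simp
      finally show "(of_nat (e i) * [:q i:] * lfac a b i ^ (e i - 1)) * (\<Prod>j\<in>{..<n} - {i}. lfac a b j ^ e j) =
         smult (1 / c) (smult (k i) (?P * others n a b i))" .
    qed
    then show ?thesis using dpl by (simp only:)
  qed
  have dQ: "coeff_deriv Q (?P * h)"
  proof -
    have "coeff_deriv (\<lambda>t. [:c + t * c':]) [:c':]"
      unfolding coeff_deriv_def
    proof
      fix m show "((\<lambda>t. coeff [:c + t * c':] m) has_field_derivative coeff [:c':] m) (at 0)"
        by (cases m) (auto intro!: derivative_eq_intros)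
    qed
    from coeff_deriv_mult[OF this dpl']
    have "coeff_deriv (\<lambda>t. [:c + t * c':] * lprod n e a (b' t))
        ([:c':] * lprod n e a (b' 0) + smult (1 / c) (\<Sum>i<n. smult (k i) (?P * others n a b i)) * [:c + 0 * c':])" .
    moreover have "lprod n e a (b' 0) = lprod n e a b" by (simp add: lprod_def lin0)
    moreover have "[:c':] * lprod n e a b + smult (1 / c) (\<Sum>i<n. smult (k i) (?P * others n a b i)) * [:c + 0 * c':] = ?P * h"
      using c by (simp add: PW hk distrib_left sum_distrib_left)
    ultimately show ?thesis by (simp add: Q_def[abs_def])
  qed
  define cv where "cv t = bcoeff (to_form s (Q t))" for t
  have "((\<lambda>t. cv t y) has_field_derivative bcoeff (to_form s (?P * h)) y) (at 0)" for y
    unfolding cv_def using dQ by (cases y) (auto simp: bcoeff_to_form coeff_deriv_def)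
  then have "((\<lambda>t. F (cv t)) has_field_derivative D (cv 0) (bcoeff (to_form s (?P * h)))) (at 0)"
    by (rule is_differential_derivative[OF D])
  moreover have "cv 0 = bcoeff (to_form s (smult c (lprod n e a b)))"
    by (simp add: cv_def Q_def lprod_def lin0)
  moreover have "((\<lambda>t. F (cv t)) has_field_derivative 0) (at 0)"
  proof -
    have "((\<lambda>t. c + t * c') \<longlongrightarrow> c + 0 * c') (nhds 0)" by (intro tendsto_intros filterlim_ident)
    then have "\<forall>\<^sub>F t in nhds 0. c + t * c' \<noteq> 0" using c by (intro tendsto_imp_eventually_ne) auto
    then have "\<forall>\<^sub>F t in nhds 0. F (cv t) = 0"
    proof eventually_elim
      case (elim t)
      have "proper n a (b' t)" using g by (simp add: proper_def generic_def)
      from vanishing_on_locus[OF F this elim] show ?case by (simp add: cv_def Q_def s_def)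
    qed
    then have "((\<lambda>t. F (cv t)) has_field_derivative 0) (at 0) \<longleftrightarrow> ((\<lambda>t. 0) has_field_derivative 0) (at (0::complex))"
      by (intro DERIV_cong_ev) auto
    then show ?thesis by simp
  qed
  ultimately show ?thesis using DERIV_unique by fastforce
qed

text \<open>
  When factors coincide, curves of this kind do not reach all of these directions. The statement
  is instead the limit of the generic one, as the differential depends continuously on the
  point.
\<close>

lemma tangent_contains:
  fixes e :: "nat \<Rightarrow> nat" and n :: nat
  defines "s \<equiv> \<Sum>i<n. e i"
  assumes e: "\<And>i. i < n \<Longrightarrow> e i > 0" and ab: "proper n a b" and h: "degree h \<le> n"
  shows "to_form s (lprod n (\<lambda>i. e i - 1) a b * h) \<in> tangent (forms s) (locus n e) (bp.span {to_form s (lprod n e a b)})"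
  unfolding tangent_def
proof (intro CollectI conjI allI impI ballI)
  let ?P = "\<lambda>a b. lprod n (\<lambda>i. e i - 1) a b"
  fix d F x
  assume F: "homog_poly d F" "\<forall>p\<in>locus n e. \<forall>z\<in>point_coords p. F z = 0"
    and x: "x \<in> bp.span {to_form s (lprod n e a b)} - {0}"
  obtain D where D: "is_differential F D" using homog_poly_differential[OF F(1)] by blast
  obtain c where c: "x = to_form s (smult c (lprod n e a b))" "c \<noteq> 0"
    using x by (auto simp: span_single to_form_smult)
  let ?v = "to_form s (?P a b * h)"
  have "D (bcoeff x) (bcoeff ?v) = 0"
  proof (rule tendsto_unique[of "at (0::complex)"])
    let ?a = "\<lambda>x i. a i + x" and ?b = "\<lambda>x i. b i + x * of_nat i"
    show "((\<lambda>\<epsilon>. D (bcoeff (to_form s (smult c (lprod n e (?a \<epsilon>) (?b \<epsilon>))))) (bcoeff (to_form s (?P (?a \<epsilon>) (?b \<epsilon>) * h))))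
        \<longlongrightarrow> D (bcoeff x) (bcoeff ?v)) (at 0)"
    proof (rule is_differential_tendsto[OF D])
      fix i
      have "coeff_tendsto (\<lambda>\<epsilon>. [:c:] * lprod n e (?a \<epsilon>) (?b \<epsilon>)) ([:c:] * lprod n e a b) (at 0)"
        by (intro coeff_tendsto_mult coeff_tendsto_const coeff_tendsto_lprod)
      then show "((\<lambda>\<epsilon>. bcoeff (to_form s (smult c (lprod n e (?a \<epsilon>) (?b \<epsilon>)))) i) \<longlongrightarrow> bcoeff x i) (at 0)"
        unfolding c(1) by (intro tendsto_bcoeff_to_form) simp
      show "((\<lambda>\<epsilon>. bcoeff (to_form s (?P (?a \<epsilon>) (?b \<epsilon>) * h)) i) \<longlongrightarrow> bcoeff ?v i) (at 0)"
        by (intro tendsto_bcoeff_to_form coeff_tendsto_mult coeff_tendsto_const coeff_tendsto_lprod)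
    qed
    have "\<forall>\<^sub>F \<epsilon> in at 0. D (bcoeff (to_form s (smult c (lprod n e (?a \<epsilon>) (?b \<epsilon>))))) (bcoeff (to_form s (?P (?a \<epsilon>) (?b \<epsilon>) * h))) = 0"
      using eventually_generic[of n a b]
    proof eventually_elim
      case (elim \<epsilon>)
      show ?case unfolding s_def by (rule tangent_contains_generic[OF F(2) D e elim c(2) h])
    qed
    then show "((\<lambda>\<epsilon>. D (bcoeff (to_form s (smult c (lprod n e (?a \<epsilon>) (?b \<epsilon>))))) (bcoeff (to_form s (?P (?a \<epsilon>) (?b \<epsilon>) * h)))) \<longlongrightarrow> 0) (at 0)"
      by (rule tendsto_eventually)
  qed simp
  moreover have "((\<lambda>t. F (bcoeff (x + t *\<^sub>b ?v))) has_field_derivative D (bcoeff (x + 0 *\<^sub>b ?v)) (bcoeff ?v)) (at 0)"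
    by (rule is_differential_derivative[OF D]) (auto intro!: derivative_eq_intros)
  ultimately show "((\<lambda>t. F (bcoeff (x + t *\<^sub>b ?v))) has_field_derivative 0) (at 0)" by simp
qed simp

section \<open>Smoothness at generic points\<close>

text \<open>
  The numerator of the logarithmic derivative of \<open>lprod n e a b\<close>, with respect to the
  denominator \<open>\<Prod>j<n. lfac a b j\<close>.
\<close>

definition logder :: "nat \<Rightarrow> (nat \<Rightarrow> nat) \<Rightarrow> (nat \<Rightarrow> complex) \<Rightarrow> (nat \<Rightarrow> complex) \<Rightarrow> complex poly" where
  "logder n e a b = (\<Sum>i<n. smult (of_nat (e i) * a i) (others n a b i))"

lemma pderiv_lprod:
  assumes e: "\<And>i. i < n \<Longrightarrow> e i > 0"
  shows "pderiv (lprod n e a b) = lprod n (\<lambda>i. e i - 1) a b * logder n e a b"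
proof -
  have "pderiv (lprod n e a b) = (\<Sum>i<n. (\<Prod>j\<in>{..<n} - {i}. lfac a b j ^ e j) * pderiv (lfac a b i ^ e i))"
    unfolding lprod_def by (rule pderiv_prod)
  also have "\<dots> = (\<Sum>i<n. smult (of_nat (e i) * a i) (lprod n (\<lambda>i. e i - 1) a b * others n a b i))"
  proof (intro sum.cong refl)
    fix i assume "i \<in> {..<n}"
    then have i: "i < n" by simp
    have "pderiv (lfac a b i ^ e i) = smult (of_nat (e i) * a i) (lfac a b i ^ (e i - 1))"
      by (simp add: pderiv_power lfac_def pderiv_pCons)
    then have "(\<Prod>j\<in>{..<n} - {i}. lfac a b j ^ e j) * pderiv (lfac a b i ^ e i) =
        smult (of_nat (e i) * a i) (lfac a b i ^ (e i - 1) * (\<Prod>j\<in>{..<n} - {i}. lfac a b j ^ e j))"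
      by (simp add: mult.commute)
    then show "(\<Prod>j\<in>{..<n} - {i}. lfac a b j ^ e j) * pderiv (lfac a b i ^ e i) =
        smult (of_nat (e i) * a i) (lprod n (\<lambda>i. e i - 1) a b * others n a b i)"
      using lprod_pred_others[where n = n and e = e and a = a and b = b, OF e i] by simp
  qed
  also have "\<dots> = lprod n (\<lambda>i. e i - 1) a b * logder n e a b"
    by (simp add: logder_def sum_distrib_left)
  finally show ?thesis .
qed

lemma degree_logder: "n > 0 \<Longrightarrow> degree (logder n e a b) \<le> n - 1"
  unfolding logder_def
  by (intro degree_sum_le) (auto intro: order_trans[OF degree_smult_le] order_trans[OF degree_others])

lemma poly_logder_root:
  assumes g: "generic n a b" and i: "i < n"
  shows "poly (logder n e a b) (lroot a b i) = of_nat (e i) * a i * poly (others n a b i) (lroot a b i)"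
proof -
  have "poly (logder n e a b) (lroot a b i) =
      (\<Sum>j<n. if j = i then of_nat (e i) * a i * poly (others n a b i) (lroot a b i) else 0)"
    unfolding logder_def poly_sum poly_smult
    using poly_others_root[OF g _ i] by (intro sum.cong refl) auto
  then show ?thesis using i by simp
qed

lemma lfac_root: "a i \<noteq> 0 \<Longrightarrow> lfac a b i = smult (a i) [:- lroot a b i, 1:]"
  by (simp add: lfac_def lroot_def)

text \<open>
  If \<open>v\<close> vanishes at the zero of \<open>lfac a b i\<close> to an order \<open>k < e i - 1\<close>, then the second
  polynomial in the assumption vanishes there to order exactly \<open>k\<close>: its leading coefficient is a
  nonzero multiple of \<open>k - e i\<close>.
\<close>

lemma power_dvd_of_wronskian_dvd:
  assumes g: "generic n a b" and i: "i < n" and e: "e i > 0"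
    and dvd: "lfac a b i ^ (e i - 1) dvd (\<Prod>j<n. lfac a b j) * pderiv v - logder n e a b * v"
  shows "[:- lroot a b i, 1:] ^ (e i - 1) dvd v"
proof (cases "v = 0")
  case False
  let ?p = "lroot a b i" and ?V = "logder n e a b"
  let ?q = "[:- ?p, 1:]"
  define k where "k = order ?p v"
  obtain w where w: "v = ?q ^ k * w" "\<not> ?q dvd w" using order_decomp[OF False] unfolding k_def by blast
  have ai: "a i \<noteq> 0" using g i by (simp add: generic_def)
  have "e i - 1 \<le> k"
  proof (rule ccontr)
    assume "\<not> e i - 1 \<le> k"
    then have k: "k < e i - 1" by simp
    define Wi where "Wi = smult (a i) (others n a b i)"
    have W: "(\<Prod>j<n. lfac a b j) = ?q * Wi"
      unfolding lfac_others[OF i, symmetric] Wi_def lfac_root[of a i b, OF ai]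
      by (simp only: mult_smult_left mult_smult_right)
    have "?q ^ Suc k dvd ?q ^ (e i - 1)" using k by (intro le_imp_power_dvd) simp
    also have "?q ^ (e i - 1) dvd lfac a b i ^ (e i - 1)"
      unfolding lfac_root[of a i b, OF ai] by (intro dvd_power_same dvd_smult dvd_refl)
    also note dvd
    finally have d: "?q ^ Suc k dvd (?q * Wi) * pderiv v - ?V * v" unfolding W .
    have dv: "?q * pderiv v = ?q ^ k * (smult (of_nat k) w + ?q * pderiv w)"
    proof (cases k)
      case 0
      then show ?thesis by (simp add: w(1))
    next
      case (Suc k')
      have "pderiv v = ?q ^ k * pderiv w + smult (of_nat k) (?q ^ k') * w"
        unfolding w(1) pderiv_mult pderiv_power by (simp add: Suc pderiv_pCons mult.commute)
      then have "?q * pderiv v = ?q ^ k * (?q * pderiv w) + smult (of_nat k) (?q ^ Suc k' * w)"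
        by (simp only: distrib_left mult_smult_left mult_smult_right power_Suc mult.assoc mult.left_commute)
      then show ?thesis by (simp only: Suc distrib_left mult_smult_right add.commute)
    qed
    have Vv: "?V * v = ?q ^ k * (?V * w)" by (simp only: w(1) mult.left_commute)
    have "(?q * Wi) * pderiv v - ?V * v = Wi * (?q * pderiv v) - ?V * v" by (simp only: mult_ac)
    also have "\<dots> = ?q ^ k * (smult (of_nat k) (Wi * w) + ?q * (Wi * pderiv w) - ?V * w)"
      unfolding dv Vv by (simp only: algebra_simps mult_smult_left mult_smult_right)
    finally have "?q ^ k * ?q dvd ?q ^ k * (smult (of_nat k) (Wi * w) + ?q * (Wi * pderiv w) - ?V * w)"
      using d by (simp only: power_Suc2)
    then have "?q dvd smult (of_nat k) (Wi * w) + ?q * (Wi * pderiv w) - ?V * w"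
      by (subst (asm) dvd_mult_cancel_left) auto
    then have "poly (smult (of_nat k) (Wi * w) + ?q * (Wi * pderiv w) - ?V * w) ?p = 0"
      by (simp only: poly_eq_0_iff_dvd)
    then have "(of_nat k - of_nat (e i)) * (poly Wi ?p * poly w ?p) = 0"
      using poly_logder_root[OF g i, of e] by (simp add: Wi_def algebra_simps)
    moreover have "poly Wi ?p \<noteq> 0" using poly_others_root[OF g i i] ai by (simp add: Wi_def)
    moreover have "poly w ?p \<noteq> 0" using w(2) by (simp add: poly_eq_0_iff_dvd)
    ultimately have "of_nat k = (of_nat (e i) :: complex)" by simp
    then have "k = e i" by (simp only: of_nat_eq_iff)
    then show False using k by simp
  qed
  then have "?q ^ (e i - 1) dvd ?q ^ k" by (rule le_imp_power_dvd)
  then show ?thesis unfolding w(1) by (rule dvd_mult2)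
qed simp

lemma lprod_dvd:
  assumes g: "generic n a b" and d: "\<And>i. i < n \<Longrightarrow> [:- lroot a b i, 1:] ^ e i dvd v"
  shows "lprod n e a b dvd v"
proof -
  have "m \<le> n \<Longrightarrow> lprod m e a b dvd v" for m
  proof (induction m)
    case 0
    then show ?case by (simp add: lprod_def)
  next
    case (Suc m)
    then obtain u where u: "v = lprod m e a b * u" by (auto elim: dvdE)
    have am: "a m \<noteq> 0" and mn: "m < n" using g Suc.prems by (auto simp: generic_def)
    have "lfac a b m ^ e m dvd u"
    proof (cases "u = 0")
      case False
      have nz0: "poly (lprod m e a b) (lroot a b m) \<noteq> 0"
        unfolding lprod_def poly_prod poly_power using poly_lfac_root_iff[OF g mn] mn by auto
      then have "lprod m e a b * u \<noteq> 0" using False by auto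
      then have "order (lroot a b m) v = order (lroot a b m) u"
        unfolding u using order_mult[of "lprod m e a b" u] order_0I[OF nz0] by (metis add_0)
      moreover have "v \<noteq> 0" using u \<open>lprod m e a b * u \<noteq> 0\<close> by simp
      ultimately have "[:- lroot a b m, 1:] ^ e m dvd u" using d[OF mn] order_divides by metis
      moreover have "lfac a b m ^ e m = smult (a m ^ e m) ([:- lroot a b m, 1:] ^ e m)"
        by (simp only: lfac_root[of a m b, OF am] smult_power)
      ultimately show ?thesis using am by (simp only: smult_dvd_iff) simp
    qed simp
    then have "lprod m e a b * lfac a b m ^ e m dvd v" unfolding u by (rule mult_dvd_mono[OF dvd_refl])
    then show ?case by (simp add: lprod_def)
  qed
  then show ?thesis by blast
qed

lemma lprod_pred_dvd:
  assumes g: "generic n a b" and e: "\<And>i. i < n \<Longrightarrow> e i > 0"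
    and dvd: "lprod n (\<lambda>i. e i - 1) a b dvd (\<Prod>j<n. lfac a b j) * pderiv v - logder n e a b * v"
  shows "lprod n (\<lambda>i. e i - 1) a b dvd v"
proof (rule lprod_dvd[OF g])
  fix i assume i: "i < n"
  have "lfac a b i ^ (e i - 1) dvd lprod n (\<lambda>i. e i - 1) a b"
    unfolding lprod_def using i by (intro dvd_prodI) auto
  then show "[:- lroot a b i, 1:] ^ (e i - 1) dvd v"
    by (intro power_dvd_of_wronskian_dvd[where e = e, OF g i e[OF i]] dvd_trans[OF _ dvd])
qed

lemma degree_lprod_generic: "generic n a b \<Longrightarrow> degree (lprod n e a b) = (\<Sum>i<n. e i)"
proof -
  assume g: "generic n a b"
  have "degree (lprod n e a b) = (\<Sum>i<n. degree (lfac a b i ^ e i))"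
    unfolding lprod_def using lfac_nonzero[OF generic_proper[OF g]] by (intro degree_prod_eq_sum_degree) auto
  also have "\<dots> = (\<Sum>i<n. e i)"
    using lfac_nonzero[OF generic_proper[OF g]] g by (intro sum.cong refl) (auto simp: degree_power_eq, simp add: lfac_def generic_def)
  finally show ?thesis .
qed

lemma sum_lessThan_add: "(\<Sum>c<n + m. f c) = (\<Sum>c<n. f c) + (\<Sum>c<m. f (n + c))"
  for f :: "nat \<Rightarrow> 'a::comm_monoid_add"
  by (induction m) (simp_all add: add.assoc)

lemma sum_three_blocks:
  "(\<Sum>c<Suc (n + n). f c) = f 0 + ((\<Sum>c<n. f (Suc c)) + (\<Sum>c<n. f (Suc (n + c))))"
  for f :: "nat \<Rightarrow> 'a::comm_monoid_add"
  unfolding sum.lessThan_Suc_shift sum_lessThan_add ..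

text \<open>
  For a member \<open>z\<close> of the root locus, write \<open>z = P W\<close> and \<open>z' = P V\<close> as in \<open>lprod_pred_prod\<close> and
  \<open>pderiv_lprod\<close>. The pair \<open>(A, B) = (-V, W)\<close> is a solution of \<open>A z + B z' = 0\<close> with \<open>A\<close> of
  degree less than \<open>n\<close> and \<open>B\<close> of degree at most \<open>n\<close>. So the \<open>2n + 1\<close> columns \<open>M c z\<close> are
  dependent, and their minors are equations of the root locus. At the generic point the first
  column vanishes and the others are independent, hence the derivative of a minor in direction
  \<open>v\<close> is the minor with the first column replaced by \<open>W v' - V v\<close>. All of these vanish only if
  \<open>W v' - V v\<close> is a combination of the other columns, which makes it divisible by \<open>P\<close>; then \<open>P\<close>
  divides \<open>v\<close> by \<open>lprod_pred_dvd\<close>.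
\<close>

lemma generic_tangent_dvd:
  fixes e :: "nat \<Rightarrow> nat" and n :: nat
  defines "s \<equiv> \<Sum>i<n. e i"
  assumes e: "\<And>i. i < n \<Longrightarrow> e i > 0" and g: "generic n a b" and n: "n > 0"
    and v: "degree v \<le> s" "to_form s v \<in> tangent (forms s) (locus n e) (bp.span {to_form s (lprod n e a b)})"
  shows "lprod n (\<lambda>i. e i - 1) a b dvd v"
proof (rule ccontr)
  let ?P = "lprod n (\<lambda>i. e i - 1) a b" and ?W = "\<Prod>j<n. lfac a b j" and ?V = "logder n e a b"
  let ?K = "Suc (n + n)" and ?z = "lprod n e a b"
  assume ndvd: "\<not> ?P dvd v"
  \<comment> \<open>The first column is the known relation. The pair \<open>(0, monom 1 n)\<close> is left out in exchange
  for it, which loses nothing because \<open>W\<close> has degree \<open>n\<close>.\<close>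
  define A where "A c = (if c = 0 then - ?V else if c \<le> n then monom 1 (c - 1) else 0)" for c
  define B where "B c = (if c = 0 then ?W else if c \<le> n then 0 else monom 1 (c - n - 1))" for c
  define M where "M c z = A c * z + B c * pderiv z" for c z
  have comb: "(\<Sum>c<?K. smult (r c) (M c z)) =
      (\<Sum>c<?K. smult (r c) (A c)) * z + (\<Sum>c<?K. smult (r c) (B c)) * pderiv z" for r z
    unfolding M_def sum_distrib_right sum.distrib[symmetric] by (simp add: smult_add_right del: sum.lessThan_Suc)
  have sumA: "(\<Sum>c<?K. smult (r c) (A c)) = smult (r 0) (- ?V) + (\<Sum>c<n. monom (r (Suc c)) c)" for r
    unfolding sum_three_blocks by (simp add: A_def smult_monom)
  have sumB: "(\<Sum>c<?K. smult (r c) (B c)) = smult (r 0) ?W + (\<Sum>c<n. monom (r (Suc (n + c))) c)" for r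
    unfolding sum_three_blocks by (simp add: B_def smult_monom)
  have low: "(\<Sum>c<n. monom (f c) c) = p"
    if "degree p \<le> n" "coeff p n = 0" "\<And>c. c < n \<Longrightarrow> f c = coeff p c" for f and p :: "complex poly"
  proof (rule poly_eqI)
    fix m
    have "coeff p m = 0" if "\<not> m < n" using that \<open>degree p \<le> n\<close> \<open>coeff p n = 0\<close>
      by (cases "m = n") (auto intro: coeff_eq_0)
    then show "coeff (\<Sum>c<n. monom (f c) c) m = coeff p m" using that(3) by (auto simp: coeff_sum sum.delta)
  qed
  have Wn: "coeff ?W n \<noteq> 0" using g by (auto simp: lead_prod_lfac generic_def)
  \<comment> \<open>All pairs of admissible degrees are combinations of the columns.\<close>
  have span: "\<exists>r. (\<Sum>c<?K. smult (r c) (A c)) = A' \<and> (\<Sum>c<?K. smult (r c) (B c)) = B'"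
    if "degree A' \<le> n - 1" "degree B' \<le> n" for A' B'
  proof -
    define r0 where "r0 = coeff B' n / coeff ?W n"
    define r where "r c = (if c = 0 then r0 else if c \<le> n then coeff (A' + smult r0 ?V) (c - 1)
        else coeff (B' - smult r0 ?W) (c - n - 1))" for c
    have dA: "degree (A' + smult r0 ?V) \<le> n - 1"
      using that(1) degree_logder[OF n, of e a b] by (intro degree_add_le order_trans[OF degree_smult_le]) auto
    have dA: "degree (A' + smult r0 ?V) \<le> n" "coeff (A' + smult r0 ?V) n = 0"
      using dA n by (simp, intro coeff_eq_0) simp
    have dB: "degree (B' - smult r0 ?W) \<le> n"
      using that(2) degree_prod_lfac by (intro degree_diff_le order_trans[OF degree_smult_le]) auto
    have dB0: "coeff (B' - smult r0 ?W) n = 0" using Wn by (simp add: r0_def)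
    have "(\<Sum>c<n. monom (r (Suc c)) c) = A' + smult r0 ?V"
      by (rule low[OF dA]) (simp add: r_def)
    moreover have "(\<Sum>c<n. monom (r (Suc (n + c))) c) = B' - smult r0 ?W"
      by (rule low[OF dB dB0]) (simp add: r_def)
    ultimately show ?thesis unfolding sumA sumB by (intro exI[of _ r]) (simp add: r_def)
  qed
  define w where "w c = (if c = 0 then M 0 v else M c ?z)" for c
  have zW: "?z = ?P * ?W" using lprod_pred_prod[where n = n and e = e and a = a and b = b, OF e] .
  have zV: "pderiv ?z = ?P * ?V" by (rule pderiv_lprod[OF e])
  have P0: "?P \<noteq> 0" using lprod_nonzero[OF generic_proper[OF g]] .
  have W0: "?W \<noteq> 0"
  proof
    assume W: "?W = 0"
    show False using Wn unfolding W by simp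
  qed
  have indep: "\<forall>c<?K. r c = 0" if r: "\<And>X. (\<Sum>c<?K. r c * coeff (w c) X) = 0" for r
  proof -
    have 0: "(\<Sum>c<?K. smult (r c) (w c)) = 0"
      by (rule poly_eqI) (use r in \<open>simp add: coeff_sum del: sum.lessThan_Suc\<close>)
    define r' where "r' = r(0 := 0)"
    define A' where "A' = (\<Sum>c<?K. smult (r' c) (A c))"
    define B' where "B' = (\<Sum>c<?K. smult (r' c) (B c))"
    have A': "A' = (\<Sum>c<n. monom (r (Suc c)) c)" and B': "B' = (\<Sum>c<n. monom (r (Suc (n + c))) c)"
      unfolding A'_def B'_def sumA sumB by (simp_all add: r'_def)
    have "(\<Sum>c<?K. smult (r c) (w c)) = smult (r 0) (M 0 v) + (\<Sum>c<?K. smult (r' c) (M c ?z))"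
      unfolding sum.lessThan_Suc_shift by (simp add: w_def r'_def)
    also have "(\<Sum>c<?K. smult (r' c) (M c ?z)) = ?P * (A' * ?W + B' * ?V)"
      unfolding comb zV unfolding zW A'_def[symmetric] B'_def[symmetric] by (simp add: algebra_simps)
    finally have eq: "smult (r 0) (M 0 v) + ?P * (A' * ?W + B' * ?V) = 0" using 0 by simp
    have r0: "r 0 = 0"
    proof (rule ccontr)
      assume "r 0 \<noteq> 0"
      have "smult (r 0) (M 0 v) = ?P * (- (A' * ?W + B' * ?V))" using eq by (simp only: eq_neg_iff_add_eq_0 mult_minus_right)
      then have "?P dvd smult (r 0) (M 0 v)" by simp
      then have "?P dvd M 0 v" using \<open>r 0 \<noteq> 0\<close> by (simp add: dvd_smult_iff)
      then have "?P dvd ?W * pderiv v - ?V * v" by (simp add: M_def A_def B_def)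
      then show False using lprod_pred_dvd[where e = e, OF g e] ndvd by blast
    qed
    then have AB: "A' * ?W + B' * ?V = 0" using eq P0 by simp
    have "degree B' \<le> n - 1" unfolding B'
      by (rule degree_sum_le) (auto intro: order_trans[OF degree_monom_le])
    then have dB: "degree B' < n" using n by simp
    have B0: "B' = 0"
    proof (rule zero_of_many_roots[OF g dB])
      fix i assume i: "i < n"
      have "poly ?W (lroot a b i) = 0" using poly_lfac_root_iff[OF g i i] i by (auto simp: poly_prod)
      then have "poly B' (lroot a b i) * poly ?V (lroot a b i) = 0"
        using arg_cong[OF AB, of "\<lambda>p. poly p (lroot a b i)"] by simp
      moreover have "poly ?V (lroot a b i) \<noteq> 0"
        unfolding poly_logder_root[OF g i] using poly_others_root[OF g i i] e[OF i] g i by (simp add: generic_def)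
      ultimately show "poly B' (lroot a b i) = 0" by simp
    qed
    then have A0: "A' = 0" using AB W0 by simp
    have rA: "r (Suc c) = 0" if "c < n" for c
    proof -
      have "coeff A' c = r (Suc c)" unfolding A' using that by (simp add: coeff_sum sum.delta)
      then show ?thesis using A0 by simp
    qed
    have rB: "r (Suc (n + c)) = 0" if "c < n" for c
    proof -
      have "coeff B' c = r (Suc (n + c))" unfolding B' using that by (simp add: coeff_sum sum.delta)
      then show ?thesis using B0 by simp
    qed
    show ?thesis
    proof (intro allI impI)
      fix c assume c: "c < ?K"
      consider "c = 0" | "c \<ge> 1" "c \<le> n" | "c > n" by linarith
      then show "r c = 0"
      proof cases
        case 2 then show ?thesis using rA[of "c - 1"] by simp
      next
        case 3 then show ?thesis using rB[of "c - n - 1"] c by simp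
      qed (simp add: r0)
    qed
  qed
  \<comment> \<open>If \<open>P\<close> does not divide \<open>v\<close>, the minor to be differentiated can be chosen with nonzero
  derivative.\<close>
  obtain I where I: "det (mat ?K ?K (\<lambda>(c, l). coeff (w c) (I l))) \<noteq> 0"
    using exists_minor_rows[where k = ?K and w = "\<lambda>c. coeff (w c)"] indep by blast
  define Z where "Z \<zeta> = (\<Sum>i\<le>s. monom (\<zeta> (i, s - i)) i)" for \<zeta> :: "nat \<times> nat \<Rightarrow> complex"
  define F where "F \<zeta> = det (mat ?K ?K (\<lambda>(c, l). coeff (M c (Z \<zeta>)) (I l)))" for \<zeta>
  have Zb: "Z (bcoeff (to_form s p)) = p" if "degree p \<le> s" for p
    using poly_as_sum_of_monoms'[OF that] by (simp add: Z_def bcoeff_to_form)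
  have MZ: "M c (Z \<zeta>) = (\<Sum>i\<le>s. smult (\<zeta> (i, s - i)) (M c (monom 1 i)))" for c \<zeta>
  proof -
    have z: "Z \<zeta> = (\<Sum>i\<le>s. smult (\<zeta> (i, s - i)) (monom 1 i))" unfolding Z_def by (simp add: smult_monom)
    have dz: "pderiv (Z \<zeta>) = (\<Sum>i\<le>s. smult (\<zeta> (i, s - i)) (pderiv (monom 1 i)))"
      unfolding z by (simp only: higher_pderiv_sum[of 1, simplified] pderiv_smult)
    show ?thesis unfolding M_def dz unfolding z
      by (simp add: sum_distrib_left sum.distrib smult_add_right)
  qed
  have homF: "homog_poly (\<Sum>c<?K. 1) F"
    unfolding F_def
  proof (rule homog.det)
    fix c l
    have "homog_poly 1 (\<lambda>\<zeta>. \<Sum>i\<le>s. \<zeta> (i, s - i) * coeff (M c (monom 1 i)) (I l))"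
      by (intro homog.sum homog.scale_right homog_poly.var)
    then show "homog_poly 1 (\<lambda>\<zeta>. coeff (M c (Z \<zeta>)) (I l))" by (simp add: MZ coeff_sum)
  qed
  have van: "\<forall>p\<in>locus n e. \<forall>\<zeta>\<in>point_coords p. F \<zeta> = 0"
  proof (intro ballI)
    fix p \<zeta> assume "p \<in> locus n e" "\<zeta> \<in> point_coords p"
    then obtain a' b' c' where ab: "proper n a' b'" and \<zeta>: "\<zeta> = bcoeff (c' *\<^sub>b to_form s (lprod n e a' b'))"
      by (auto simp: locus_def point_coords_def span_single s_def)
    let ?z' = "smult c' (lprod n e a' b')"
    let ?W' = "\<Prod>j<n. lfac a' b' j" and ?V' = "logder n e a' b'"
    have "Z \<zeta> = ?z'"
      unfolding \<zeta> to_form_smult[symmetric] s_def[symmetric]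
      by (rule Zb) (use degree_lprod[of n e a' b'] in \<open>auto simp: s_def intro: order_trans[OF degree_smult_le]\<close>)
    obtain r where r: "(\<Sum>c<?K. smult (r c) (A c)) = - ?V'" "(\<Sum>c<?K. smult (r c) (B c)) = ?W'"
      using span[of "- ?V'" ?W'] degree_logder[OF n, of e a' b'] degree_prod_lfac[where n = n and a = a' and b = b'] by auto
    have W': "lprod n e a' b' = lprod n (\<lambda>i. e i - 1) a' b' * ?W'"
      using lprod_pred_prod[where n = n and e = e and a = a' and b = b', OF e] .
    have V': "pderiv (lprod n e a' b') = lprod n (\<lambda>i. e i - 1) a' b' * ?V'" by (rule pderiv_lprod[OF e])
    have "- ?V' * lprod n e a' b' + ?W' * pderiv (lprod n e a' b') = 0"
      unfolding V' by (subst W') (simp only: mult_minus_left mult_ac add.left_inverse)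
    then have "(\<Sum>c<?K. smult (r c) (M c ?z')) = 0"
      unfolding comb r pderiv_smult mult_smult_right smult_add_right[symmetric] by (simp only: smult_0_right)
    then have "coeff (\<Sum>c<?K. smult (r c) (M c ?z')) l = 0" for l by (simp only: coeff_0)
    then have r0: "(\<Sum>c<?K. r c * coeff (M c ?z') l) = 0" for l
      by (simp only: coeff_sum coeff_smult)
    have "?W' \<noteq> 0" using lprod_nonzero[OF ab, of "\<lambda>_. 1"] by (simp add: lprod_def)
    have "\<exists>c0. c0 < ?K \<and> r c0 \<noteq> 0"
    proof (rule ccontr)
      assume "\<nexists>c0. c0 < ?K \<and> r c0 \<noteq> 0"
      then have "(\<Sum>c<?K. smult (r c) (B c)) = 0" by (intro sum.neutral) auto
      then show False using r(2) \<open>?W' \<noteq> 0\<close> by (simp only:)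
    qed
    then obtain c0 where c0: "c0 < ?K" "r c0 \<noteq> 0" by blast
    show "F \<zeta> = 0" unfolding F_def \<open>Z \<zeta> = ?z'\<close>
      by (rule det_dependent_rows[where r = r, OF _ c0]) (rule r0)
  qed
  have zdeg: "degree ?z \<le> s" unfolding s_def by (rule degree_lprod)
  have x: "to_form s ?z \<in> bp.span {to_form s ?z} - {0}"
    using to_form_lprod_nonzero[OF generic_proper[OF g], of e] by (simp add: bp.span_base s_def)
  have der: "((\<lambda>t. F (bcoeff (to_form s ?z + t *\<^sub>b to_form s v))) has_field_derivative 0) (at 0)"
    using v(2) homF van x unfolding tangent_def by blast
  \<comment> \<open>The first column is divisible by \<open>t\<close>, and \<open>\<phi>\<close> is the quotient of the minor by \<open>t\<close>.\<close>
  define \<phi> where "\<phi> t = det (mat ?K ?K (\<lambda>(c, l).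
      if c = 0 then coeff (M 0 v) (I l) else coeff (M c ?z) (I l) + t * coeff (M c v) (I l)))" for t
  have Mlin: "M c (?z + smult t v) = M c ?z + smult t (M c v)" for c t
    by (simp add: M_def pderiv_add pderiv_smult algebra_simps smult_add_right)
  have M0: "M 0 ?z = 0" unfolding M_def zV unfolding zW by (simp add: A_def B_def)
  have Ft: "F (bcoeff (to_form s ?z + t *\<^sub>b to_form s v)) = t * \<phi> t" for t
  proof -
    have "Z (bcoeff (to_form s ?z + t *\<^sub>b to_form s v)) = ?z + smult t v"
      unfolding to_form_smult[symmetric] to_form_add[symmetric]
      by (rule Zb) (use zdeg v(1) in \<open>intro degree_add_le order_trans[OF degree_smult_le]\<close>)
    then have "F (bcoeff (to_form s ?z + t *\<^sub>b to_form s v)) = det (mat ?K ?K (\<lambda>(c, l).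
       if c = 0 then t * coeff (M 0 v) (I l) else coeff (M c ?z) (I l) + t * coeff (M c v) (I l)))"
      unfolding F_def by (intro arg_cong[of _ _ det] eq_matI) (auto simp: Mlin M0)
    moreover obtain cof where cof: "\<And>p. det (mat ?K ?K (\<lambda>(c, l).
       if c = 0 then p l else coeff (M c ?z) (I l) + t * coeff (M c v) (I l))) = (\<Sum>i<?K. p i * cof i)"
      using det_row_linear[of 0 ?K "\<lambda>c l. coeff (M c ?z) (I l) + t * coeff (M c v) (I l)"] by auto
    ultimately show ?thesis
      unfolding \<phi>_def cof[of "\<lambda>l. t * coeff (M 0 v) (I l)"] cof[of "\<lambda>l. coeff (M 0 v) (I l)"]
      by (simp add: sum_distrib_left mult.assoc del: sum.lessThan_Suc)
  qed
  have "(\<phi> \<longlongrightarrow> det (mat ?K ?K (\<lambda>(c, l). coeff (w c) (I l)))) (at 0)"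
    unfolding \<phi>_def
  proof (rule tendsto_det)
    fix c l
    show "((\<lambda>t. if c = 0 then coeff (M 0 v) (I l) else coeff (M c ?z) (I l) + t * coeff (M c v) (I l))
       \<longlongrightarrow> coeff (w c) (I l)) (at 0)"
      by (auto simp: w_def intro!: tendsto_eq_intros)
  qed
  moreover have "(\<phi> \<longlongrightarrow> 0) (at 0)"
  proof -
    have "((\<lambda>t. (t * \<phi> t) / t) \<longlongrightarrow> 0) (at 0)"
      using der unfolding Ft has_field_derivative_iff by simp
    then show ?thesis
      by (rule Lim_transform_eventually) (simp add: eventually_at_filter)
  qed
  ultimately have "det (mat ?K ?K (\<lambda>(c, l). coeff (w c) (I l))) = 0"
    by (intro tendsto_unique[of "at (0::complex)" \<phi>]) auto
  then show False using I by blast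
qed

lemma pred_sum: "(\<And>i. i < n \<Longrightarrow> e i > 0) \<Longrightarrow> (\<Sum>i<n. e i - 1) + n = (\<Sum>i<n. e i)" for e :: "nat \<Rightarrow> nat"
proof -
  assume e: "\<And>i. i < n \<Longrightarrow> e i > 0"
  have "(\<Sum>i<n. e i) = (\<Sum>i<n. (e i - 1) + 1)" using e by (intro sum.cong) force+
  then show ?thesis by (simp add: sum.distrib del: add_Suc_right)
qed

lemma tangent_subset: "tangent V X x \<subseteq> V"
  by (auto simp: tangent_def)

lemma lprod_pred_degree:
  assumes e: "\<And>i. i < n \<Longrightarrow> e i > 0"
  shows "degree (lprod n (\<lambda>i. e i - 1) a b) + n \<le> (\<Sum>i<n. e i)"
  using degree_lprod[of n "\<lambda>i. e i - 1" a b] pred_sum[of n e, OF e] by linarith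

lemma generic_tangent:
  fixes e :: "nat \<Rightarrow> nat" and n :: nat
  defines "s \<equiv> \<Sum>i<n. e i"
  assumes e: "\<And>i. i < n \<Longrightarrow> e i > 0" and g: "generic n a b" and n: "n > 0"
  shows "tangent (forms s) (locus n e) (bp.span {to_form s (lprod n e a b)}) = {to_form s (lprod n (\<lambda>i. e i - 1) a b * h) | h. degree h \<le> n}"
    and "bp.span {to_form s (lprod n e a b)} \<in> smooth_points (forms s) n (locus n e)"
proof -
  let ?P = "lprod n (\<lambda>i. e i - 1) a b" and ?x = "bp.span {to_form s (lprod n e a b)}"
  have P0: "?P \<noteq> 0" using lprod_nonzero[OF generic_proper[OF g]] .
  have dP: "degree ?P + n = s" unfolding s_def degree_lprod_generic[OF g] by (rule pred_sum[OF e])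
  show t: "tangent (forms s) (locus n e) ?x = {to_form s (?P * h) | h. degree h \<le> n}"
  proof (intro equalityI subsetI)
    fix u assume u: "u \<in> tangent (forms s) (locus n e) ?x"
    then have uf: "u \<in> forms s" using tangent_subset by blast
    have "?P dvd to_poly u"
      using u to_form_to_poly[OF uf] degree_to_poly[OF uf] unfolding s_def by (intro generic_tangent_dvd[OF e g n]) simp_all
    then obtain h where h: "to_poly u = ?P * h" by (elim dvdE)
    have "degree h \<le> n"
    proof (cases "h = 0")
      case False
      then have "degree ?P + degree h \<le> s" using degree_to_poly[OF uf] h degree_mult_eq[OF P0 False] by simp
      then show ?thesis using dP by simp
    qed simp
    then show "u \<in> {to_form s (?P * h) | h. degree h \<le> n}" using h to_form_to_poly[OF uf] by auto
  next
    fix u assume "u \<in> {to_form s (?P * h) | h. degree h \<le> n}"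
    then show "u \<in> tangent (forms s) (locus n e) ?x"
      using tangent_contains[of n e a b, OF e generic_proper[OF g], folded s_def] by auto
  qed
  show "?x \<in> smooth_points (forms s) n (locus n e)"
    unfolding smooth_points_def
  proof (intro CollectI conjI)
    show "?x \<in> locus n e" using generic_proper[OF g] by (auto simp: locus_def s_def)
    show "bp.dim (tangent (forms s) (locus n e) ?x) = n + 1"
      unfolding t using dim_multiples[OF P0, of n s] dP by simp
  qed
qed

text \<open>
  At any smooth point the tangent space has the dimension of the space of multiples of \<open>P\<close>, and
  it contains that space.
\<close>

lemma smooth_point_tangent:
  fixes e :: "nat \<Rightarrow> nat" and n :: nat
  defines "s \<equiv> \<Sum>i<n. e i"
  assumes e: "\<And>i. i < n \<Longrightarrow> e i > 0" and x: "x \<in> smooth_points (forms s) n (locus n e)"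
  shows "\<exists>a b. proper n a b \<and> x = bp.span {to_form s (lprod n e a b)} \<and>
    tangent (forms s) (locus n e) x = {to_form s (lprod n (\<lambda>i. e i - 1) a b * h) | h. degree h \<le> n}"
proof -
  obtain a b where ab: "proper n a b" "x = bp.span {to_form s (lprod n e a b)}"
    using x by (auto simp: smooth_points_def locus_def s_def)
  let ?P = "lprod n (\<lambda>i. e i - 1) a b"
  let ?U = "{to_form s (?P * h) | h. degree h \<le> n}"
  have P0: "?P \<noteq> 0" using lprod_nonzero[OF ab(1)] .
  have dP: "degree ?P + n \<le> s" unfolding s_def by (rule lprod_pred_degree[OF e])
  have "bp.subspace ?U"
    unfolding to_form_mult_family_independent(3)[OF P0 dP, symmetric] by (rule bp.subspace_span)
  moreover have "?U \<subseteq> tangent (forms s) (locus n e) x"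
    using tangent_contains[of n e a b, OF e ab(1), folded s_def] ab(2) by auto
  moreover have "bp.dim (tangent (forms s) (locus n e) x) \<le> bp.dim ?U"
    using x dim_multiples[OF P0 dP] by (simp add: smooth_points_def)
  ultimately have "?U = tangent (forms s) (locus n e) x"
    by (intro subspace_dim_equal_forms[where s = s]) (auto simp: tangent_subset)
  then show ?thesis using ab by blast
qed

section \<open>Root loci of lists of multiplicities\<close>

lemma lprod_permute:
  assumes "p permutes {..<n}"
  shows "lprod n e a b = lprod n (e \<circ> p) (a \<circ> p) (b \<circ> p)"
  unfolding lprod_def lfac_def by (subst prod.permute[OF assms]) (simp add: o_def)

lemma proper_permute: "p permutes {..<n} \<Longrightarrow> proper n a b \<Longrightarrow> proper n (a \<circ> p) (b \<circ> p)"
  unfolding proper_def using permutes_in_image[of p "{..<n}"] by auto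

lemma generic_permute: "p permutes {..<n} \<Longrightarrow> generic n a b \<Longrightarrow> generic n (a \<circ> p) (b \<circ> p)"
  unfolding generic_def o_def
  using permutes_in_image[of p "{..<n}"] permutes_inj[of p "{..<n}"] by (metis injD lessThan_iff)

text \<open>
  The factors can be listed in any order, so statements about a partition may be proved for one
  list of its parts.
\<close>

lemma lprod_reorder:
  assumes "mset xs = mset ys"
  obtains p where "p permutes {..<length ys}"
    "\<And>a b. lprod (length xs) ((!) xs) (a \<circ> p) (b \<circ> p) = lprod (length ys) ((!) ys) a b"
proof -
  obtain p where p: "p permutes {..<length ys}" "permute_list p ys = xs"
    using mset_eq_permutation[OF assms] by metis
  have l: "length xs = length ys" using p(2) by auto
  have "lprod (length xs) ((!) xs) (a \<circ> p) (b \<circ> p) = lprod (length ys) ((!) ys) a b" for a b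
  proof -
    have "lprod (length ys) ((!) ys) a b = lprod (length ys) ((!) ys \<circ> p) (a \<circ> p) (b \<circ> p)"
      by (rule lprod_permute[OF p(1)])
    also have "\<dots> = lprod (length xs) ((!) xs) (a \<circ> p) (b \<circ> p)"
      unfolding lprod_def l using p by (intro prod.cong) (auto simp: permute_list_nth)
    finally show ?thesis ..
  qed
  then show ?thesis using that p(1) by blast
qed

lemma sum_list_nth: "sum_list xs = (\<Sum>i<length xs. xs ! i)" for xs :: "nat list"
  by (simp add: sum_list_sum_nth lessThan_atLeast0)

lemma root_locus_eq_locus: "root_locus (mset xs) = locus (length xs) ((!) xs)"
proof (intro equalityI subsetI)
  fix x assume "x \<in> root_locus (mset xs)"
  then obtain ys ls where ys: "mset ys = mset xs" and ls: "\<And>i. i < length ys \<Longrightarrow> ls i \<in> forms 1 \<and> ls i \<noteq> 0"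
    and x: "x = bp.span {\<Prod>i<length ys. ls i ^ (ys ! i)}" unfolding root_locus_def by blast
  let ?n = "length ys"
  define a b where "a i = coeff (to_poly (ls i)) 1" and "b i = coeff (to_poly (ls i)) 0" for i
  have dl: "to_poly (ls i) = lfac a b i" if "i < ?n" for i
  proof (rule poly_eqI)
    fix m
    have "degree (to_poly (ls i)) \<le> 1" using ls[OF that] degree_to_poly by blast
    then show "coeff (to_poly (ls i)) m = coeff (lfac a b i) m"
      by (cases m; cases "m - 1") (auto simp: lfac_def a_def b_def intro: coeff_eq_0)
  qed
  have ab: "proper ?n a b" unfolding proper_def
  proof (intro allI impI notI)
    fix i assume i: "i < ?n" "(a i, b i) = (0, 0)"
    then have "to_poly (ls i) = to_poly 0" using dl[OF i(1)] by (simp add: lfac_def)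
    then have "ls i = 0" using ls[OF i(1)] bp.subspace_0[OF subspace_forms] by (intro to_poly_eqD[of _ 1]) auto
    then show False using ls[OF i(1)] by simp
  qed
  let ?f = "\<Prod>i<?n. ls i ^ (ys ! i)"
  have f: "?f \<in> forms (\<Sum>i<?n. ys ! i)"
    using forms_prod[of "{..<?n}" "\<lambda>i. ls i ^ (ys ! i)" "\<lambda>i. ys ! i * 1"] forms_power[of _ 1] ls by auto
  have "to_poly ?f = lprod ?n ((!) ys) a b" unfolding to_poly_prod lprod_def by (intro prod.cong) (auto simp: dl)
  then have fh: "?f = to_form (\<Sum>i<?n. ys ! i) (lprod ?n ((!) ys) a b)" using to_form_to_poly[OF f] by simp
  obtain p where p: "p permutes {..<?n}" "\<And>a b. lprod (length xs) ((!) xs) (a \<circ> p) (b \<circ> p) = lprod ?n ((!) ys) a b"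
    using lprod_reorder[OF ys[symmetric]] by blast
  have "?n = length xs" "sum_list ys = sum_list xs" using ys by (metis size_mset, metis sum_mset_sum_list)
  then show "x \<in> locus (length xs) ((!) xs)"
    unfolding locus_def x fh
    by (intro CollectI, rule_tac x = "a \<circ> p" in exI, rule_tac x = "b \<circ> p" in exI)
      (use proper_permute[OF p(1) ab] p(2)[of a b] in \<open>simp add: sum_list_nth\<close>)
next
  fix x assume "x \<in> locus (length xs) ((!) xs)"
  then obtain a b where ab: "proper (length xs) a b"
    and x: "x = bp.span {to_form (\<Sum>i<length xs. xs ! i) (lprod (length xs) ((!) xs) a b)}" unfolding locus_def by blast
  define ls where "ls i = to_form 1 (lfac a b i)" for i
  have ls: "ls i \<in> forms 1 \<and> ls i \<noteq> 0" if "i < length xs" for i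
    using lfac_nonzero[OF ab that] to_form_eq_0[OF degree_lfac] by (auto simp: ls_def)
  let ?f = "\<Prod>i<length xs. ls i ^ (xs ! i)"
  have f: "?f \<in> forms (\<Sum>i<length xs. xs ! i)"
    using forms_prod[of "{..<length xs}" "\<lambda>i. ls i ^ (xs ! i)" "\<lambda>i. xs ! i * 1"] forms_power[of _ 1] ls by auto
  have "to_poly ?f = lprod (length xs) ((!) xs) a b"
    unfolding to_poly_prod lprod_def by (intro prod.cong) (auto simp: ls_def to_poly_to_form[OF degree_lfac] simp del: One_nat_def)
  then have "?f = to_form (\<Sum>i<length xs. xs ! i) (lprod (length xs) ((!) xs) a b)" using to_form_to_poly[OF f] by simp
  then show "x \<in> root_locus (mset xs)"
    unfolding root_locus_def x using ls by (auto intro!: exI[of _ xs] exI[of _ ls])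
qed

section \<open>Forms annihilated by a product of linear forms\<close>

text \<open>
  For \<open>d = \<Sum> e_i + n\<close> these are the forms annihilated by some \<open>\<Prod> l_i ^ e_i\<close>.
\<close>

definition killed_locus :: "nat \<Rightarrow> nat \<Rightarrow> (nat \<Rightarrow> nat) \<Rightarrow> bpoly set set" where
  "killed_locus d n e = {bp.span {f} | f. f \<in> forms d \<and> f \<noteq> 0 \<and>
     (\<exists>a b. proper n a b \<and> kills (dual_seq d (bcoeff f)) n (lprod n e a b))}"

lemma contract_lfac: "contract (lfac a b i) c k = b i * c k + a i * c (Suc k)"
  unfolding contract_def pairing_eq[OF degree_lfac] by (simp add: lfac_def)

text \<open>
  The form of degree \<open>\<alpha>\<close> with dehomogenization \<open>q\<close> vanishes at the zero of \<open>lfac a b i\<close>, which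
  is the point at infinity if \<open>a i = 0\<close>.
\<close>

definition form_zero :: "(nat \<Rightarrow> complex) \<Rightarrow> (nat \<Rightarrow> complex) \<Rightarrow> nat \<Rightarrow> nat \<Rightarrow> complex poly \<Rightarrow> bool" where
  "form_zero a b \<alpha> i q \<longleftrightarrow> (if a i = 0 then coeff q \<alpha> = 0 else poly q (lroot a b i) = 0)"

lemma form_zero_factor:
  assumes "(a i, b i) \<noteq> (0, 0)" "q \<noteq> 0" "degree q \<le> \<alpha>" "form_zero a b \<alpha> i q"
  shows "\<exists>q'. q = lfac a b i * q' \<and> q' \<noteq> 0 \<and> Suc (degree q') \<le> \<alpha>"
proof (cases "a i = 0")
  case True
  then have "b i \<noteq> 0" "coeff q \<alpha> = 0" using assms by (auto simp: form_zero_def)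
  then have "degree q < \<alpha>" using assms(2,3) by (metis le_neq_implies_less leading_coeff_0_iff)
  then show ?thesis using True \<open>b i \<noteq> 0\<close> assms(2)
    by (intro exI[of _ "smult (1 / b i) q"]) (simp add: lfac_def)
next
  case False
  then obtain u where u: "q = [:- lroot a b i, 1:] * u"
    using assms(4) by (auto simp: form_zero_def poly_eq_0_iff_dvd elim: dvdE)
  have u0: "u \<noteq> 0" using u assms(2) by auto
  have "q = lfac a b i * smult (1 / a i) u"
    unfolding u lfac_root[of a i b, OF False] using False by (simp only: mult_smult_left mult_smult_right smult_smult) simp
  moreover have "degree q = Suc (degree u)" unfolding u using u0 by (subst degree_mult_eq) auto
  ultimately show ?thesis using u0 False assms(3) by (intro exI[of _ "smult (1 / a i) u"]) auto
qed

text \<open>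
  If \<open>lfac a b i\<close> annihilates a sequence, that sequence is geometric with ratio the zero of the
  linear form, or it is concentrated in its last entry if the zero is at infinity. Such a
  sequence is not annihilated by a \<open>q\<close> without this zero. Induction over the factors reduces to
  this case.
\<close>

lemma killed_by_coprime:
  assumes "finite J" and "\<And>i. i \<in> J \<Longrightarrow> (a i, b i) \<noteq> (0, 0)" and "\<And>i. i \<in> J \<Longrightarrow> \<not> form_zero a b \<alpha> i q"
    and "degree q \<le> \<alpha>" and "kills F (D - \<alpha>) q" and "kills F (D - card J) (\<Prod>i\<in>J. lfac a b i)"
    and "card J + \<alpha> \<le> D + 1"
  shows "kills F D 1"
  using assms
proof (induction J arbitrary: F D rule: finite_induct)
  case empty
  then show ?case by simp
next
  case (insert i J)
  have aD: "\<alpha> \<le> D" using insert.prems(6) insert.hyps by simp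
  let ?F = "contract (lfac a b i) F"
  have kJ: "kills ?F (D - 1 - card J) (\<Prod>i\<in>J. lfac a b i)"
    using insert.prems(5) insert.hyps by (simp add: kills_mult_iff[symmetric])
  \<comment> \<open>If \<open>J\<close> is empty, \<open>D - 1 - \<alpha>\<close> may be a truncated difference, and the induction hypothesis
  does not apply.\<close>
  have "kills ?F (D - 1) 1"
  proof (cases "J = {}")
    case True
    then show ?thesis using kJ by simp
  next
    case False
    then have cJ: "card J \<ge> 1" using insert.hyps by (simp add: Suc_leI card_gt_0_iff)
    show ?thesis
    proof (rule insert.IH)
      show "kills ?F (D - 1 - \<alpha>) q"
        unfolding kills_mult_iff[symmetric] using cJ insert.prems(6) insert.hyps degree_lfac[of a b i]
        by (subst mult.commute) (rule kills_mult[OF insert.prems(4)], simp)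
    qed (use insert.prems insert.hyps kJ cJ in auto)
  qed
  then have rec: "b i * F k + a i * F (Suc k) = 0" if "k < D" for k
    using that by (auto simp: kills_iff contract_def[of 1] pairing_def contract_lfac)
  have nzi: "(a i, b i) \<noteq> (0, 0)" and ndi: "\<not> form_zero a b \<alpha> i q" using insert.prems(1,2) by auto
  have "F k = 0" if "k \<le> D" for k
  proof (cases "a i = 0")
    case True
    then have bi: "b i \<noteq> 0" and qa: "coeff q \<alpha> \<noteq> 0" using nzi ndi by (auto simp: form_zero_def)
    have lo: "F k = 0" if "k < D" for k using rec[OF that] True bi by simp
    have "contract q F (D - \<alpha>) = 0" using insert.prems(4) by (simp add: kills_iff)
    moreover have "contract q F (D - \<alpha>) = (\<Sum>m\<le>\<alpha>. if m = \<alpha> then coeff q \<alpha> * F D else 0)"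
      unfolding contract_def pairing_eq[OF insert.prems(3)] using aD lo by (intro sum.cong refl) auto
    ultimately have "F D = 0" using qa by simp
    then show ?thesis using lo that by (cases "k = D") auto
  next
    case False
    let ?\<rho> = "lroot a b i"
    have pow: "F k = ?\<rho> ^ k * F 0" if "k \<le> D" for k
      using that
    proof (induction k)
      case (Suc k)
      have "F (Suc k) = ?\<rho> * F k" using rec[of k] Suc.prems False
        by (simp add: lroot_def field_simps add_eq_0_iff)
      then show ?case using Suc by simp
    qed simp
    have "contract q F 0 = 0" using insert.prems(4) by (simp add: kills_iff)
    moreover have "contract q F 0 = (\<Sum>m\<le>\<alpha>. coeff q m * ?\<rho> ^ m) * F 0"
      unfolding contract_def pairing_eq[OF insert.prems(3)] sum_distrib_right
    proof (intro sum.cong refl)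
      fix m assume "m \<in> {..\<alpha>}"
      then have "F m = ?\<rho> ^ m * F 0" using aD by (intro pow) simp
      then show "coeff q m * F (0 + m) = coeff q m * ?\<rho> ^ m * F 0" by simp
    qed
    moreover have "(\<Sum>m\<le>\<alpha>. coeff q m * ?\<rho> ^ m) = poly q ?\<rho>"
      unfolding poly_altdef using insert.prems(3) by (intro sum.mono_neutral_right) (auto simp: coeff_eq_0)
    moreover have "poly q ?\<rho> \<noteq> 0" using ndi False by (simp add: form_zero_def)
    ultimately have "F 0 = 0" by simp
    then show ?thesis using pow[OF that] by simp
  qed
  then show ?case by (simp add: kills_iff contract_def pairing_def)
qed

text \<open>
  Common factors of \<open>q\<close> and the product are contracted away until the remaining forms are
  coprime.
\<close>

lemma killed_by_few_factors:
  assumes "finite J" and "\<And>i. i \<in> J \<Longrightarrow> (a i, b i) \<noteq> (0, 0)" and "q \<noteq> 0" and "degree q \<le> \<alpha>"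
    and "kills F (D - \<alpha>) q" and "kills F (D - card J) (\<Prod>i\<in>J. lfac a b i)" and "card J + \<alpha> \<le> D + 1"
  shows "\<exists>I\<subseteq>J. card I \<le> \<alpha> \<and> kills F (D - card I) (\<Prod>i\<in>I. lfac a b i)"
  using assms
proof (induction "card J" arbitrary: J F D q \<alpha>)
  case 0
  then show ?case by (intro exI[of _ "{}"]) simp
next
  case (Suc m)
  show ?case
  proof (cases "\<exists>i\<in>J. form_zero a b \<alpha> i q")
    case False
    then have "kills F D 1"
      using killed_by_coprime[of J a b \<alpha> q F D] Suc.prems by blast
    then show ?thesis by (intro exI[of _ "{}"]) simp
  next
    case True
    then obtain i where i: "i \<in> J" "form_zero a b \<alpha> i q" by blast
    obtain q' where q': "q = lfac a b i * q'" "q' \<noteq> 0" "Suc (degree q') \<le> \<alpha>"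
      using form_zero_factor[of a i b q \<alpha>] Suc.prems i by metis
    let ?F = "contract (lfac a b i) F"
    have cJ: "card (J - {i}) = m" "card J = Suc m" using Suc i by auto
    have "\<exists>I\<subseteq>J - {i}. card I \<le> \<alpha> - 1 \<and> kills ?F (D - 1 - card I) (\<Prod>i\<in>I. lfac a b i)"
    proof (rule Suc.hyps(1))
      show "kills ?F (D - 1 - (\<alpha> - 1)) q'"
        using Suc.prems(5) q' unfolding kills_mult_iff[symmetric] by (simp add: Suc_diff_le)
      show "kills ?F (D - 1 - card (J - {i})) (\<Prod>i\<in>J - {i}. lfac a b i)"
        using Suc.prems(6) cJ prod.remove[OF Suc.prems(1) i(1), of "lfac a b"]
        unfolding kills_mult_iff[symmetric] by simp
    qed (use Suc.prems q' cJ in auto)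
    then obtain I where I: "I \<subseteq> J - {i}" "card I \<le> \<alpha> - 1" "kills ?F (D - 1 - card I) (\<Prod>i\<in>I. lfac a b i)" by blast
    have "finite I" using I(1) Suc.prems(1) finite_subset by blast
    moreover have "i \<notin> I" using I(1) by auto
    ultimately show ?thesis
      using I q'(3) i(1) by (intro exI[of _ "insert i I"]) (auto simp: kills_mult_iff)
  qed
qed

text \<open>
  The exponents outside \<open>I\<close> drop by one, and those of the set \<open>Z\<close> would drop to zero. The bound
  on the number of exponents equal to one provides equally many indices \<open>Y\<close> in \<open>I\<close> with exponent
  at least two. One copy of each factor in \<open>Y\<close> is moved to a place in \<open>Z\<close>.
\<close>

lemma exchange:
  fixes e :: "nat \<Rightarrow> nat"
  assumes e: "\<And>i. i < n \<Longrightarrow> e i > 0" and I: "I \<subseteq> {..<n}" "card I = n - j" and j: "j \<le> n"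
    and ones: "j \<le> n - card {i. i < n \<and> e i = 1}" and ab: "proper n a b"
  shows "\<exists>\<epsilon> a' b'. (\<forall>i<n. \<epsilon> i \<le> 1 \<and> \<epsilon> i < e i) \<and> (\<Sum>i<n. \<epsilon> i) = j \<and> proper n a' b' \<and>
    lprod n (\<lambda>i. e i - \<epsilon> i) a' b' = lprod n (\<lambda>i. e i - 1) a b * (\<Prod>i\<in>I. lfac a b i)"
proof -
  define O1 where "O1 = {i. i < n \<and> e i = 1}"
  define Z where "Z = O1 - I"
  define N where "N = I - O1"
  have fin: "finite I" "finite O1" "finite Z" "finite N"
    using I(1) finite_subset by (auto simp: O1_def Z_def N_def)
  have "card O1 \<le> n" using card_mono[of "{..<n}" O1] by (auto simp: O1_def)
  then have "card O1 \<le> n - j" using ones j unfolding O1_def[symmetric] by simp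
  moreover have "card O1 = card Z + card (O1 \<inter> I)"
    unfolding Z_def using card_Int_Diff[OF fin(2), of I] by simp
  moreover have "card I = card N + card (O1 \<inter> I)"
    unfolding N_def using card_Int_Diff[OF fin(1), of O1] by (simp add: Int_commute)
  ultimately have "card Z \<le> card N" using I(2) by simp
  then obtain Y where Y: "Y \<subseteq> N" "card Y = card Z" using obtain_subset_with_card_n by metis
  have finY: "finite Y" using Y(1) fin(4) finite_subset by blast
  obtain \<pi> where \<pi>: "bij_betw \<pi> Z Y" using finite_same_card_bij[OF fin(3) finY] Y(2) by auto
  have Yn: "Y \<subseteq> {..<n}" "Y \<subseteq> I" and YZ: "Y \<inter> Z = {}" and Zn: "Z \<subseteq> {..<n}"
    using Y(1) I(1) by (auto simp: N_def Z_def O1_def)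
  define \<epsilon> where "\<epsilon> i = (if i \<in> Z then 0 else if i \<in> Y then 1 else if i \<in> I then 0 else (1::nat))" for i
  \<comment> \<open>The places in \<open>Z\<close> receive the factors in \<open>Y\<close>.\<close>
  define a' b' where "a' i = (if i \<in> Z then a (\<pi> i) else a i)" and "b' i = (if i \<in> Z then b (\<pi> i) else b i)" for i
  have "\<epsilon> i \<le> 1 \<and> \<epsilon> i < e i" if "i < n" for i
    using e[OF that] that Y(1) by (auto simp: \<epsilon>_def Z_def N_def O1_def)
  moreover have "(\<Sum>i<n. \<epsilon> i) = j"
  proof -
    have "(\<Sum>i<n. \<epsilon> i) = card (({..<n} - I - Z) \<union> Y)"
    proof -
      have "(\<Sum>i<n. \<epsilon> i) = (\<Sum>i\<in>({..<n} - I - Z) \<union> Y. 1)"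
        by (rule sum.mono_neutral_cong_right) (use Yn YZ in \<open>auto simp: \<epsilon>_def\<close>)
      then show ?thesis by simp
    qed
    also have "\<dots> = card ({..<n} - I - Z) + card Y"
      using Yn finY by (intro card_Un_disjoint) auto
    also have "card ({..<n} - I - Z) = card ({..<n} - I) - card Z"
      using Zn fin by (intro card_Diff_subset) (auto simp: Z_def)
    also have "card ({..<n} - I) = j" using I j fin by (simp add: card_Diff_subset)
    moreover have "card Z \<le> card ({..<n} - I)" using Zn by (intro card_mono) (auto simp: Z_def)
    ultimately show ?thesis using Y(2) I j fin by (simp add: card_Diff_subset)
  qed
  moreover have "proper n a' b'"
    unfolding proper_def
  proof (intro allI impI)
    fix i assume i: "i < n"
    show "(a' i, b' i) \<noteq> (0, 0)"
    proof (cases "i \<in> Z")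
      case True
      then have "\<pi> i < n" using bij_betw_apply[OF \<pi>] Yn(1) by auto
      then show ?thesis using True ab by (simp add: a'_def b'_def proper_def)
    next
      case False
      then show ?thesis using i ab by (simp add: a'_def b'_def proper_def)
    qed
  qed
  moreover have "lprod n (\<lambda>i. e i - \<epsilon> i) a' b' = lprod n (\<lambda>i. e i - 1) a b * (\<Prod>i\<in>I. lfac a b i)"
  proof -
    define h where "h i = (if i \<in> Z then 1 else lfac a b i ^ (e i - \<epsilon> i))" for i
    have restrict: "(\<Prod>i\<in>S. f i) = (\<Prod>i<n. if i \<in> S then f i else 1)" if "S \<subseteq> {..<n}" for S and f :: "nat \<Rightarrow> complex poly"
      using that by (simp add: prod.inter_restrict[symmetric] Int_absorb1)
    have "lprod n (\<lambda>i. e i - \<epsilon> i) a' b' = (\<Prod>i<n. h i * (if i \<in> Z then lfac a b (\<pi> i) else 1))"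
      unfolding lprod_def by (intro prod.cong refl) (auto simp: h_def a'_def b'_def lfac_def \<epsilon>_def Z_def O1_def)
    also have "\<dots> = (\<Prod>i<n. h i) * (\<Prod>i\<in>Z. lfac a b (\<pi> i))"
      unfolding prod.distrib restrict[OF Zn] ..
    also have "(\<Prod>i\<in>Z. lfac a b (\<pi> i)) = (\<Prod>i\<in>Y. lfac a b i)"
      by (rule prod.reindex_bij_betw[OF \<pi>])
    also have "(\<Prod>i<n. h i) * (\<Prod>i\<in>Y. lfac a b i) = (\<Prod>i<n. h i * (if i \<in> Y then lfac a b i else 1))"
      unfolding prod.distrib restrict[OF Yn(1)] ..
    also have "\<dots> = (\<Prod>i<n. lfac a b i ^ (e i - 1) * (if i \<in> I then lfac a b i else 1))"
    proof (intro prod.cong refl)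
      fix i assume "i \<in> {..<n}"
      then have ei: "e i > 0" using e by simp
      have pe: "lfac a b i ^ (e i - 1) * lfac a b i = lfac a b i ^ e i"
        using ei by (metis power_minus_mult)
      show "h i * (if i \<in> Y then lfac a b i else 1) = lfac a b i ^ (e i - 1) * (if i \<in> I then lfac a b i else 1)"
        using YZ Yn(2) pe by (auto simp: h_def \<epsilon>_def Z_def O1_def)
    qed
    also have "\<dots> = lprod n (\<lambda>i. e i - 1) a b * (\<Prod>i\<in>I. lfac a b i)"
      unfolding prod.distrib lprod_def restrict[OF I(1)] ..
    finally show ?thesis .
  qed
  ultimately show ?thesis by blast
qed

section \<open>Incidence conditions in Pluecker coordinates\<close>

lemma multihomog_coeff_lfac: "multihomog {#Suc i#} (\<lambda>(z, a, b). coeff (lfac a b i) m)"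
proof -
  consider "m = 0" | "m = 1" | l where "m = Suc (Suc l)" by (metis One_nat_def not0_implies_Suc)
  then show ?thesis
  proof cases
    case 1
    then show ?thesis using multihomog.var_b[of i] by (simp add: lfac_def)
  next
    case 2
    then show ?thesis using multihomog.var_a[of i] by (simp add: lfac_def)
  next
    case 3
    then show ?thesis using multihomog.zero[of "{#Suc i#}"] by (simp add: lfac_def split_def)
  qed
qed

definition multihomog_poly ::
    "nat multiset \<Rightarrow> (('i \<Rightarrow> complex) \<times> (nat \<Rightarrow> complex) \<times> (nat \<Rightarrow> complex) \<Rightarrow> complex poly) \<Rightarrow> bool" where
  "multihomog_poly D Q \<longleftrightarrow> (\<forall>m. multihomog D (\<lambda>y. coeff (Q y) m))"

lemma multihomog_poly_mult:
  assumes "multihomog_poly D Q" "multihomog_poly E R"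
  shows "multihomog_poly (D + E) (\<lambda>y. Q y * R y)"
  unfolding multihomog_poly_def coeff_mult
  using assms by (intro allI mh.sum multihomog.mult) (auto simp: multihomog_poly_def)

lemma multihomog_poly_const: "multihomog_poly {#} (\<lambda>_. p)"
  unfolding multihomog_poly_def by (intro allI multihomog.const)

lemma multihomog_poly_power: "multihomog_poly D Q \<Longrightarrow> multihomog_poly (\<Sum>_<e. D) (\<lambda>y. Q y ^ e)" for e :: nat
proof (induction e)
  case 0 then show ?case by (simp add: multihomog_poly_const)
next
  case (Suc e)
  then show ?case using multihomog_poly_mult[of "\<Sum>_<e. D" "\<lambda>y. Q y ^ e" D Q] by (simp add: mult.commute)
qed

lemma multihomog_poly_lprod:
  "multihomog_poly (\<Sum>i<n. \<Sum>_<e i. {#Suc i#}) (\<lambda>(z, a, b). lprod n e a b)"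
proof (induction n)
  case 0
  then show ?case using multihomog_poly_const[of 1] by (simp add: lprod_def split_def)
next
  case (Suc n)
  have "multihomog_poly {#Suc n#} (\<lambda>(z, a, b). lfac a b n)"
    unfolding multihomog_poly_def split_def by (intro allI) (rule multihomog_coeff_lfac[unfolded split_def])
  from multihomog_poly_mult[OF Suc multihomog_poly_power[OF this, of "e n"]]
  show ?case by (simp add: lprod_def split_def)
qed

lemma degree_bound_lprod:
  fixes e :: "nat \<Rightarrow> nat"
  shows "set_mset (\<Sum>i<n. \<Sum>_<e i. {#Suc i#}) \<subseteq> {..n}"
  by (auto simp: set_mset_sum split: if_splits)

lemma multihomog_pluecker_form:
  assumes "multihomog_poly D (\<lambda>(z :: (nat \<Rightarrow> nat \<times> nat) \<Rightarrow> complex, a, b). Q a b)"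
  shows "multihomog (D + {#0#}) (\<lambda>(z, a, b). pluecker_form k I z (to_form s (Q a b)))"
proof -
  have "multihomog (D + {#0#}) (\<lambda>y. \<Sum>c<Suc k. (\<lambda>(z, a, b). bcoeff (to_form s (Q a b)) (I c)) y *
      ((\<lambda>(z, a, b). (-1) ^ c * z (\<lambda>m. I (if m < c then m else Suc m))) y))"
  proof (intro mh.sum multihomog.mult)
    fix c
    have "multihomog D (\<lambda>(z :: (nat \<Rightarrow> nat \<times> nat) \<Rightarrow> complex, a, b). coeff (Q a b) (fst (I c)))"
      using assms[unfolded multihomog_poly_def split_def, rule_format, of "fst (I c)"] unfolding split_def .
    then show "multihomog D (\<lambda>(z :: (nat \<Rightarrow> nat \<times> nat) \<Rightarrow> complex, a, b). bcoeff (to_form s (Q a b)) (I c))"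
      by (cases "I c"; cases "fst (I c) + snd (I c) = s") (simp_all add: bcoeff_to_form split_def multihomog.zero)
    show "multihomog {#0#} (\<lambda>(z, a, b). (-1) ^ c * z (\<lambda>m. I (if m < c then m else Suc m)))"
      using mh.scale[OF multihomog.var_z] by (simp add: split_def)
  qed
  then show ?thesis by (simp add: pluecker_form_def split_def)
qed

lemma pluecker_form_lincomb:
  "pluecker_form k I z (\<Sum>v<m. c v *\<^sub>b w v) = (\<Sum>v<m. c v * pluecker_form k I z (w v))"
  unfolding pluecker_form_def bcoeff_sum bcoeff_scale sum_distrib_left sum_distrib_right
  by (subst sum.swap) (simp add: mult.assoc)

text \<open>
  Equations in the Pluecker coordinates \<open>z\<close> of a subspace of dimension \<open>k\<close> and in linear forms
  \<open>l_i\<close>. The first kind says that \<open>\<Prod> l_i ^ e_i\<close> lies in the subspace, the second kind that any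
  \<open>n - j + 1\<close> multiples of \<open>\<Prod> l_i ^ (e_i - 1)\<close> of degree \<open>r\<close> are linearly dependent modulo the
  subspace.
\<close>

definition incidence ::
    "nat \<Rightarrow> nat \<Rightarrow> nat \<Rightarrow> (nat \<Rightarrow> nat) \<Rightarrow> nat \<Rightarrow>
     (((nat \<Rightarrow> nat \<times> nat) \<Rightarrow> complex) \<times> (nat \<Rightarrow> complex) \<times> (nat \<Rightarrow> complex) \<Rightarrow> complex) set" where
  "incidence k r n e j =
     {\<lambda>(z, a, b). pluecker_form k I z (to_form r (lprod n e a b)) | I. True} \<union>
     {\<lambda>(z, a, b). det (mat (Suc (n - j)) (Suc (n - j))
         (\<lambda>(v, u). pluecker_form k (I u) z (to_form r (lprod n (\<lambda>i. e i - 1) a b * h v)))) | I h. \<forall>v. degree (h v) \<le> n}"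

lemma incidence_multihomog:
  assumes "G \<in> incidence k r n e j"
  shows "\<exists>D. multihomog D G \<and> set_mset D \<subseteq> {..n}"
proof -
  let ?D = "\<lambda>e. (\<Sum>i<n. \<Sum>_<e i. {#Suc i#})"
  from assms consider I where "G = (\<lambda>(z, a, b). pluecker_form k I z (to_form r (lprod n e a b)))"
    | I h where "G = (\<lambda>(z, a, b). det (mat (Suc (n - j)) (Suc (n - j))
         (\<lambda>(v, u). pluecker_form k (I u) z (to_form r (lprod n (\<lambda>i. e i - 1) a b * h v)))))"
    unfolding incidence_def by blast
  then show ?thesis
  proof cases
    case 1
    have "multihomog (?D e + {#0#}) G" unfolding 1 by (rule multihomog_pluecker_form[OF multihomog_poly_lprod])
    moreover have "set_mset (?D e + {#0#}) \<subseteq> {..n}" using degree_bound_lprod[where n = n and e = e] by simp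
    ultimately show ?thesis by blast
  next
    case 2
    let ?E = "?D (\<lambda>i. e i - 1)"
    have "multihomog (\<Sum>v<Suc (n - j). ?E + {#0#}) (\<lambda>y. det (mat (Suc (n - j)) (Suc (n - j))
         (\<lambda>(v, u). (\<lambda>(z, a, b). pluecker_form k (I u) z (to_form r (lprod n (\<lambda>i. e i - 1) a b * h v))) y)))"
    proof (rule mh.det)
      fix v u
      have "multihomog_poly (?E + {#}) (\<lambda>y. (\<lambda>(z, a, b). lprod n (\<lambda>i. e i - 1) a b) y * h v)"
        by (rule multihomog_poly_mult[OF multihomog_poly_lprod multihomog_poly_const])
      then have "multihomog_poly ?E (\<lambda>(z, a, b). lprod n (\<lambda>i. e i - 1) a b * h v)" by (simp add: split_def)
      then show "multihomog (?E + {#0#}) (\<lambda>(z, a, b). pluecker_form k (I u) z (to_form r (lprod n (\<lambda>i. e i - 1) a b * h v)))"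
        by (rule multihomog_pluecker_form)
    qed
    then have "multihomog (\<Sum>v<Suc (n - j). ?E + {#0#}) G" unfolding 2 by (simp add: split_def del: sum.lessThan_Suc)
    moreover have "set_mset (\<Sum>v<Suc (n - j). ?E + {#0#}) \<subseteq> {..n}"
      using degree_bound_lprod[where n = n and e = "\<lambda>i. e i - 1"] by (auto simp: set_mset_sum simp del: sum.lessThan_Suc)
    ultimately show ?thesis by blast
  qed
qed

lemma pluecker_form_zero_iff:
  assumes "distinct B" "bp.independent (set B)"
  shows "(\<forall>I. pluecker_form (length B) I (pluecker B) v = 0) \<longleftrightarrow> v \<in> bp.span (set B)"
  unfolding pluecker_form_pluecker by (rule pluecker_Cons_zero_iff[OF assms])

text \<open>
  The multiples of \<open>\<Prod> l_i ^ (e_i - 1)\<close> form a space of dimension \<open>n + 1\<close>. If \<open>H\<close> contains a part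
  of it of dimension \<open>j + 1\<close>, then any \<open>n - j + 1\<close> of the multiples have a nontrivial
  combination in \<open>H\<close>.
\<close>

lemma incidence_vanishes:
  fixes e :: "nat \<Rightarrow> nat" and n :: nat
  defines "r \<equiv> \<Sum>i<n. e i"
  assumes e: "\<And>i. i < n \<Longrightarrow> e i > 0" and ab: "proper n a b" and j: "j \<le> n"
    and B: "distinct B" "bp.independent (set B)" "bp.span (set B) = H" "H \<subseteq> forms r"
    and x: "to_form r (lprod n e a b) \<in> H"
    and dim: "j + 1 \<le> bp.dim (H \<inter> {to_form r (lprod n (\<lambda>i. e i - 1) a b * h) | h. degree h \<le> n})"
    and G: "G \<in> incidence (length B) r n e j"
  shows "G (pluecker B, a, b) = 0"
proof -
  let ?P = "lprod n (\<lambda>i. e i - 1) a b"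
  let ?T = "{to_form r (?P * h) | h. degree h \<le> n}"
  from G consider I where "G = (\<lambda>(z, a, b). pluecker_form (length B) I z (to_form r (lprod n e a b)))"
    | I h where "G = (\<lambda>(z, a, b). det (mat (Suc (n - j)) (Suc (n - j))
         (\<lambda>(v, u). pluecker_form (length B) (I u) z (to_form r (lprod n (\<lambda>i. e i - 1) a b * h v)))))" "\<forall>v. degree (h v) \<le> n"
    unfolding incidence_def by blast
  then show ?thesis
  proof cases
    case 1
    then show ?thesis using pluecker_form_zero_iff[OF B(1,2)] B(3) x by auto
  next
    case 2
    have P0: "?P \<noteq> 0" using lprod_nonzero[OF ab] .
    have dP: "degree ?P + n \<le> r" unfolding r_def by (rule lprod_pred_degree[OF e])
    note T = to_form_mult_family_independent[OF P0 dP]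
    have subH: "bp.subspace H" using B(3) bp.subspace_span by blast
    have "H \<inter> ?T \<subseteq> forms r" using B(4) by blast
    then obtain E where E: "finite E" "E \<subseteq> H \<inter> ?T" "bp.independent E" "card E = bp.dim (H \<inter> ?T)"
      by (rule basis_forms_exists)
    have "bp.span E \<subseteq> H" using E(2) subH by (intro bp.span_minimal) auto
    have "\<exists>c. (\<Sum>v<Suc (n - j). c v *\<^sub>b to_form r (?P * h v)) \<in> H \<and> \<not> (\<forall>v<Suc (n - j). c v = 0)"
    proof (rule ccontr)
      assume n: "\<nexists>c. (\<Sum>v<Suc (n - j). c v *\<^sub>b to_form r (?P * h v)) \<in> H \<and> \<not> (\<forall>v<Suc (n - j). c v = 0)"
      let ?S = "E \<union> (\<lambda>v. to_form r (?P * h v)) ` {..<Suc (n - j)}"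
      have "bp.independent ?S \<and> inj_on (\<lambda>v. to_form r (?P * h v)) {..<Suc (n - j)} \<and> card ?S = card E + Suc (n - j)"
        by (rule family_extend[OF E(1,3)]) (use n \<open>bp.span E \<subseteq> H\<close> in blast)
      moreover have "?S \<subseteq> ?T" using E(2) 2(2) by auto
      then have "card ?S \<le> Suc n"
        using bp.independent_span_bound[of "(\<lambda>i. to_form r (?P * monom 1 i)) ` {..<Suc n}" ?S] calculation T(2,3) by simp
      ultimately show False using dim E(4) j by simp
    qed
    then obtain c v0 where c: "(\<Sum>v<Suc (n - j). c v *\<^sub>b to_form r (?P * h v)) \<in> H" "v0 < Suc (n - j)" "c v0 \<noteq> 0" by blast
    have "(\<Sum>v<Suc (n - j). c v * pluecker_form (length B) I (pluecker B) (to_form r (?P * h v))) = 0" for I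
      using pluecker_form_zero_iff[OF B(1,2)] c(1) unfolding pluecker_form_lincomb[symmetric] B(3) by blast
    then show ?thesis unfolding 2 split by (intro det_dependent_rows[where r = c, OF _ c(2,3)])
  qed
qed

section \<open>Preimages of higher associated varieties\<close>

lemma subspace_basis_list:
  assumes "bp.subspace W" "W \<subseteq> forms s"
  obtains B where "distinct B" "bp.independent (set B)" "bp.span (set B) = W" "length B = bp.dim W"
proof -
  obtain C where C: "finite C" "C \<subseteq> W" "bp.independent C" "W \<subseteq> bp.span C" "card C = bp.dim W"
    by (rule basis_forms_exists[OF assms(2)])
  obtain B where B: "set B = C" "distinct B" using finite_distinct_list[OF C(1)] by blast
  have "bp.span C = W" using C assms(1) by (simp add: bp.span_minimal subset_antisym)
  then show ?thesis using that[of B] B C distinct_card[OF B(2)] by simp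
qed

lemma subspace_perp:
  assumes "f \<in> forms (s + e)"
  shows "bp.subspace (perp s (bp.span {f}))"
  unfolding perp_span[OF assms] bp.subspace_def kills_def using subspace_forms
  by (auto simp: bp.subspace_def pairing_add distrib_right pairing_smult)

lemma contract_monom: "contract (monom 1 k) c b = c (b + k)"
  using pairing_monom_mult[of "\<lambda>i. c (b + i)" k 1] by (simp add: contract_def pairing_def)

lemma contract_0: "contract 0 c b = 0"
  by (simp add: contract_def)

lemma perp_subset_forms: "perp s L \<subseteq> forms s"
  by (auto simp: perp_def)

text \<open>
  By elimination the incidence equations have a solution at every member of \<open>CH\<close>, not only at
  the subspaces of which \<open>CH\<close> is the closure. If \<open>P f\<close> were nondegenerate, some \<open>n - j + 1\<close>
  monomial multiples of \<open>P\<close> would be independent modulo the annihilator of \<open>f\<close>, contrary to the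
  second kind of equations.
\<close>

lemma perp_in_CH:
  fixes e :: "nat \<Rightarrow> nat" and n :: nat
  defines "r \<equiv> \<Sum>i<n. e i"
  assumes e: "\<And>i. i < n \<Longrightarrow> e i > 0" and j: "j \<le> n" and rn: "n + 1 + j \<le> r"
    and f: "f \<in> forms (r + (n - j))"
    and W: "perp r (bp.span {f}) \<in> CH r n j (locus n e)"
  defines "c \<equiv> dual_seq (r + (n - j)) (bcoeff f)"
  shows "\<exists>a b q. proper n a b \<and> kills c (n - j) (lprod n e a b) \<and> q \<noteq> 0 \<and> degree q \<le> n - j \<and>
    kills (contract (lprod n (\<lambda>i. e i - 1) a b) c) n q"
proof -
  let ?W = "perp r (bp.span {f})"
  define l where "l = int r - int n - 1 + int j"
  define A where "A = {H \<in> Gr l (forms r). \<exists>x \<in> smooth_points (forms r) n (locus n e).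
           x \<subseteq> H \<and> j + 1 \<le> bp.dim (H \<inter> tangent (forms r) (locus n e) x)}"
  have WA: "?W \<in> zariski_closure pluecker_coords (Gr l (forms r)) A"
    using W unfolding CH_def Let_def Gr_closure_def A_def l_def .
  then have WG: "bp.subspace ?W" "?W \<subseteq> forms r" "int (bp.dim ?W) = l + 1"
    by (auto simp: zariski_closure_def Gr_def)
  obtain B0 where B0: "distinct B0" "bp.independent (set B0)" "bp.span (set B0) = ?W" "length B0 = bp.dim ?W"
    by (rule subspace_basis_list[OF WG(1,2)])
  let ?k = "length B0"
  have zB0: "pluecker B0 \<in> pluecker_coords ?W" using B0 by (auto simp: pluecker_coords_def)
  have "\<exists>a b. proper n a b \<and> (\<forall>G\<in>incidence ?k r n e j. G (pluecker B0, a, b) = 0)"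
  proof (rule ccontr)
    assume no: "\<nexists>a b. proper n a b \<and> (\<forall>G\<in>incidence ?k r n e j. G (pluecker B0, a, b) = 0)"
    have "\<exists>d \<Phi>. homog_poly d \<Phi> \<and> \<Phi> (pluecker B0) \<noteq> 0 \<and>
      (\<forall>z a b. (\<forall>i<n. (a i, b i) \<noteq> (0, 0)) \<longrightarrow> (\<forall>G\<in>incidence ?k r n e j. G (z, a, b) = 0) \<longrightarrow> \<Phi> z = 0)"
    proof (rule elimination)
      show "\<exists>D. multihomog D G \<and> set_mset D \<subseteq> {..n}" if "G \<in> incidence ?k r n e j" for G
        by (rule incidence_multihomog[OF that])
      show "\<exists>G\<in>incidence ?k r n e j. G (pluecker B0, a, b) \<noteq> 0" if "\<forall>i<n. (a i, b i) \<noteq> (0, 0)" for a b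
        using no that unfolding proper_def by blast
    qed
    then obtain d \<Phi> where \<Phi>: "homog_poly d \<Phi>" "\<Phi> (pluecker B0) \<noteq> 0"
      "\<And>z a b. proper n a b \<Longrightarrow> (\<And>G. G \<in> incidence ?k r n e j \<Longrightarrow> G (z, a, b) = 0) \<Longrightarrow> \<Phi> z = 0"
      unfolding proper_def by blast
    have "\<Phi> z = 0" if H: "H \<in> A" and z: "z \<in> pluecker_coords H" for H z
    proof -
      obtain B where B: "distinct B" "bp.independent (set B)" "bp.span (set B) = H" "z = pluecker B"
        using z by (auto simp: pluecker_coords_def)
      obtain x where x: "x \<in> smooth_points (forms r) n (locus n e)" "x \<subseteq> H"
        "j + 1 \<le> bp.dim (H \<inter> tangent (forms r) (locus n e) x)" and HG: "H \<in> Gr l (forms r)"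
        using H by (auto simp: A_def)
      obtain a b where ab: "proper n a b" "x = bp.span {to_form r (lprod n e a b)}"
        "tangent (forms r) (locus n e) x = {to_form r (lprod n (\<lambda>i. e i - 1) a b * h) | h. degree h \<le> n}"
        using smooth_point_tangent[where n = n and e = e and x = x, OF e] x(1) unfolding r_def by blast
      have "length B = bp.dim H"
        using bp.dim_span_eq_card_independent[OF B(2)] B(3) distinct_card[OF B(1)] by simp
      then have lB: "length B = ?k" using HG WG(3) B0(4) by (simp add: Gr_def)
      have Hf: "H \<subseteq> forms r" using HG by (simp add: Gr_def)
      have xH: "to_form r (lprod n e a b) \<in> H" using x(2) ab(2) bp.span_base by blast
      have "G (z, a, b) = 0" if "G \<in> incidence ?k r n e j" for G
        unfolding B(4)
        by (rule incidence_vanishes[where e = e and n = n and j = j and H = H, folded r_def, OF e ab(1) j B(1-3) Hf xH])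
          (use x(3) that lB in \<open>simp_all add: ab(3)[unfolded ab(2)] ab(2)\<close>)
      then show ?thesis using \<Phi>(3)[OF ab(1)] by blast
    qed
    then have "\<Phi> (pluecker B0) = 0" using WA zB0 \<Phi>(1) unfolding zariski_closure_def by blast
    then show False using \<Phi>(2) by blast
  qed
  then obtain a b where ab: "proper n a b" and G: "\<And>G. G \<in> incidence ?k r n e j \<Longrightarrow> G (pluecker B0, a, b) = 0" by blast
  let ?P = "lprod n (\<lambda>i. e i - 1) a b"
  let ?m = "n - j"
  note pz = pluecker_form_zero_iff[OF B0(1,2), unfolded B0(3)]
  have killsW: "kills c ?m p" if "degree p \<le> r" "to_form r p \<in> ?W" for p
    using that unfolding perp_span[OF f] c_def by (simp add: to_poly_to_form)
  have "pluecker_form ?k I (pluecker B0) (to_form r (lprod n e a b)) = 0" for I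
    using G[of "\<lambda>(z, a, b). pluecker_form ?k I z (to_form r (lprod n e a b))"] by (auto simp: incidence_def)
  then have "to_form r (lprod n e a b) \<in> ?W" using pz by blast
  then have k1: "kills c ?m (lprod n e a b)" by (intro killsW) (simp add: r_def degree_lprod)
  \<comment> \<open>The same Hankel matrix serves for \<open>q\<close> acting on \<open>P f\<close> and for the multiples of \<open>P\<close> acting
  on \<open>f\<close>.\<close>
  have "\<not> nondegenerate (contract ?P c) ?m n"
  proof
    let ?F = "contract ?P c"
    assume "nondegenerate ?F ?m n"
    then obtain I where I: "det (mat (Suc ?m) (Suc ?m) (\<lambda>(v, b). if I v \<le> n then ?F (b + I v) else 0)) \<noteq> 0"
      using nondegenerate_minor by blast
    define h :: "nat \<Rightarrow> complex poly" where "h v = (if I v \<le> n then monom 1 (I v) else 0)" for v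
    have dh: "degree (h v) \<le> n" for v by (simp add: h_def degree_monom_eq)
    have hF: "contract (h v) ?F b = (if I v \<le> n then ?F (b + I v) else 0)" for v b
      by (simp add: h_def contract_monom contract_0)
    have indep: "\<forall>v<Suc ?m. g v = 0" if g: "(\<Sum>v<Suc ?m. g v *\<^sub>b to_form r (?P * h v)) \<in> ?W" for g
    proof (rule det_rows_independent[OF I])
      fix t assume t: "t < Suc ?m"
      let ?h = "\<Sum>v<Suc ?m. smult (g v) (h v)"
      have "(\<Sum>v<Suc ?m. g v *\<^sub>b to_form r (?P * h v)) = to_form r (?P * ?h)"
        unfolding sum_distrib_left to_form_sum by (intro sum.cong refl) (simp add: to_form_smult)
      moreover have "degree (?P * ?h) \<le> r"
      proof -
        have "degree ?h \<le> n" by (rule degree_sum_le) (auto simp: dh)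
        then show ?thesis using lprod_pred_degree[where n = n and e = e and a = a and b = b, OF e] degree_mult_le[of ?P ?h] unfolding r_def by linarith
      qed
      ultimately have "kills c ?m (?P * ?h)" using g by (intro killsW) simp_all
      then have "contract ?h ?F t = 0" using t by (simp add: contract_mult kills_iff del: sum.lessThan_Suc)
      then show "(\<Sum>v<Suc ?m. g v * (if I v \<le> n then ?F (t + I v) else 0)) = 0"
        unfolding contract_sum hF .
    qed
    have "\<exists>I. det (mat (Suc ?m) (Suc ?m) (\<lambda>(v, u). (\<lambda>v I. pluecker_form ?k I (pluecker B0) (to_form r (?P * h v))) v (I u))) \<noteq> 0"
    proof (rule exists_minor_rows)
      fix g assume "\<And>I. (\<Sum>v<Suc ?m. g v * pluecker_form ?k I (pluecker B0) (to_form r (?P * h v))) = 0"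
      then have "(\<Sum>v<Suc ?m. g v *\<^sub>b to_form r (?P * h v)) \<in> ?W"
        unfolding pluecker_form_lincomb[symmetric] using pz by blast
      then show "\<forall>v<Suc ?m. g v = 0" by (rule indep)
    qed
    then obtain I' where I': "det (mat (Suc ?m) (Suc ?m) (\<lambda>(v, u). pluecker_form ?k (I' u) (pluecker B0) (to_form r (?P * h v)))) \<noteq> 0"
      by blast
    have "(\<lambda>(z, a, b). det (mat (Suc ?m) (Suc ?m)
         (\<lambda>(v, u). pluecker_form ?k (I' u) z (to_form r (lprod n (\<lambda>i. e i - 1) a b * h v))))) \<in> incidence ?k r n e j"
      unfolding incidence_def using dh by blast
    from G[OF this] I' show False by simp
  qed
  then obtain q where "degree q \<le> ?m" "kills (contract ?P c) n q" "q \<noteq> 0"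
    unfolding nondegenerate_def by blast
  then show ?thesis using ab k1 by blast
qed

text \<open>
  The form \<open>P f\<close> is annihilated by \<open>\<Prod> l_i\<close> of degree \<open>n\<close> and by a form of degree \<open>n - j\<close>. The
  sum of these degrees does not exceed the degree \<open>2 n - j\<close> of \<open>P f\<close>, so \<open>killed_by_few_factors\<close>
  applies.
\<close>

lemma perp_in_CH_killed:
  fixes e :: "nat \<Rightarrow> nat" and n :: nat
  defines "r \<equiv> \<Sum>i<n. e i"
  assumes e: "\<And>i. i < n \<Longrightarrow> e i > 0" and j: "j \<le> n" and rn: "n + 1 + j \<le> r"
    and ones: "j \<le> n - card {i. i < n \<and> e i = 1}"
    and f: "f \<in> forms (r + (n - j))"
    and W: "perp r (bp.span {f}) \<in> CH r n j (locus n e)"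
  shows "\<exists>\<epsilon> a b. (\<forall>i<n. \<epsilon> i \<le> 1 \<and> \<epsilon> i < e i) \<and> (\<Sum>i<n. \<epsilon> i) = j \<and> proper n a b \<and>
    kills (dual_seq (r + (n - j)) (bcoeff f)) n (lprod n (\<lambda>i. e i - \<epsilon> i) a b)"
proof -
  define c where "c = dual_seq (r + (n - j)) (bcoeff f)"
  obtain a b q where ab: "proper n a b" and k: "kills c (n - j) (lprod n e a b)"
    and q: "q \<noteq> 0" "degree q \<le> n - j" "kills (contract (lprod n (\<lambda>i. e i - 1) a b) c) n q"
    using perp_in_CH[where n = n and e = e and j = j, OF e j] rn f W unfolding r_def c_def by blast
  let ?P = "lprod n (\<lambda>i. e i - 1) a b"
  let ?F = "contract ?P c" and ?D = "n + (n - j)"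
  have kL: "kills ?F (?D - card {..<n}) (\<Prod>i<n. lfac a b i)"
  proof -
    have "lprod n e a b = ?P * (\<Prod>i<n. lfac a b i)" by (rule lprod_pred_prod[OF e])
    then show ?thesis using k by (simp only: kills_mult_iff card_lessThan add_diff_cancel_left')
  qed
  have "\<exists>I\<subseteq>{..<n}. card I \<le> n - j \<and> kills ?F (?D - card I) (\<Prod>i\<in>I. lfac a b i)"
    by (rule killed_by_few_factors[OF finite_lessThan _ q(1,2) _ kL]) (use ab q(3) in \<open>auto simp: proper_def\<close>)
  then obtain I0 where I0: "I0 \<subseteq> {..<n}" "card I0 \<le> n - j" "kills ?F (?D - card I0) (\<Prod>i\<in>I0. lfac a b i)" by blast
  \<comment> \<open>Enlarging an annihilating product to exactly \<open>n - j\<close> factors does no harm.\<close>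
  obtain I where I: "I0 \<subseteq> I" "I \<subseteq> {..<n}" "card I = n - j"
    using exists_subset_between[OF I0(2) _ I0(1)] by auto
  have fin: "finite I" "finite I0" using I(2) I0(1) finite_subset by blast+
  have "degree (\<Prod>i\<in>I - I0. lfac a b i) \<le> (\<Sum>i\<in>I - I0. degree (lfac a b i))"
    using degree_prod_sum_le[of "I - I0" "lfac a b"] fin by (simp add: o_def)
  also have "\<dots> \<le> (\<Sum>i\<in>I - I0. 1)" by (rule sum_mono) (rule degree_lfac)
  also have "\<dots> = n - j - card I0" using I fin by (simp add: card_Diff_subset)
  finally have dI: "degree (\<Prod>i\<in>I - I0. lfac a b i) \<le> n - j - card I0" .
  have "(\<Prod>i\<in>I. lfac a b i) = (\<Prod>i\<in>I0. lfac a b i) * (\<Prod>i\<in>I - I0. lfac a b i)"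
    using prod.subset_diff[OF I(1) fin(1)] by (simp add: mult.commute)
  then have "kills ?F n (\<Prod>i\<in>I. lfac a b i)"
    using kills_mult[OF I0(3), of "\<Prod>i\<in>I - I0. lfac a b i" n] dI I0(2) by simp
  then have kI: "kills c n (?P * (\<Prod>i\<in>I. lfac a b i))" by (simp only: kills_mult_iff)
  obtain \<epsilon> a' b' where \<epsilon>: "\<forall>i<n. \<epsilon> i \<le> 1 \<and> \<epsilon> i < e i" "(\<Sum>i<n. \<epsilon> i) = j" "proper n a' b'"
    "lprod n (\<lambda>i. e i - \<epsilon> i) a' b' = ?P * (\<Prod>i\<in>I. lfac a b i)"
    using exchange[where n = n and e = e, OF e I(2,3) j ones ab] by blast
  from kI have "kills c n (lprod n (\<lambda>i. e i - \<epsilon> i) a' b')" by (simp only: \<epsilon>(4))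
  note all = \<epsilon>(1-3) this[unfolded c_def]
  show ?thesis
    by (rule exI[of _ \<epsilon>], rule exI[of _ a'], rule exI[of _ b']) (intro conjI all)
qed

lemma lprod_cong: "(\<And>i. i < n \<Longrightarrow> e i = e' i) \<Longrightarrow> lprod n e a b = lprod n e' a b"
  unfolding lprod_def by (intro prod.cong) auto

lemma locus_cong: "(\<And>i. i < n \<Longrightarrow> e i = e' i) \<Longrightarrow> locus n e = locus n e'"
proof -
  assume a: "\<And>i. i < n \<Longrightarrow> e i = e' i"
  have "lprod n e = lprod n e'" by (intro ext lprod_cong a)
  moreover have "(\<Sum>i<n. e i) = (\<Sum>i<n. e' i)" using a by (intro sum.cong) auto
  ultimately show ?thesis unfolding locus_def by (simp only:)
qed

lemma preimage_CH_subset: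
  assumes pos: "\<forall>x\<in>set xs. x > 0" and n: "n = length xs" and r: "r = sum_list xs"
    and j: "j \<le> n" and rn: "n + 1 + j \<le> r" and ones: "j \<le> n - count (mset xs) 1" and d: "d = r + (n - j)"
    and L: "L \<in> apolar_preimage d r (CH_root j (mset xs))"
  shows "\<exists>ys. mset ys \<in> FF j (mset xs) \<and> length ys = n \<and> L \<in> killed_locus d n ((!) ys)"
proof -
  have CH: "CH_root j (mset xs) = CH r n j (locus n ((!) xs))"
    by (simp add: CH_root_def root_locus_eq_locus n r sum_mset_sum_list)
  obtain f where f: "f \<in> forms d" "f \<noteq> 0" "L = bp.span {f}"
    using L PP_forms_iff by (auto simp: apolar_preimage_def apolar_dom_def)
  have rs: "r = (\<Sum>i<n. xs ! i)" by (simp add: r n sum_list_nth)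
  have "count (mset xs) 1 = card {i. i < n \<and> xs ! i = 1}"
    unfolding count_mset count_list_eq_length_filter length_filter_conv_card n by (rule arg_cong[of _ _ card]) auto
  then have ones': "j \<le> n - card {i. i < n \<and> xs ! i = 1}" using ones by simp
  have "\<exists>\<epsilon> a b. (\<forall>i<n. \<epsilon> i \<le> 1 \<and> \<epsilon> i < xs ! i) \<and> (\<Sum>i<n. \<epsilon> i) = j \<and> proper n a b \<and>
    kills (dual_seq (r + (n - j)) (bcoeff f)) n (lprod n (\<lambda>i. xs ! i - \<epsilon> i) a b)"
  proof (rule perp_in_CH_killed[where n = n and e = "(!) xs" and j = j, folded rs])
    show "0 < xs ! i" if "i < n" for i using pos that by (simp add: n)
    show "f \<in> forms (r + (n - j))" using f(1) d by simp
    show "perp r (bp.span {f}) \<in> CH r n j (locus n ((!) xs))"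
      using L f(3) CH by (simp add: apolar_preimage_def)
  qed (use j rn ones' in simp_all)
  then obtain \<epsilon> a b where \<epsilon>: "\<forall>i<n. \<epsilon> i \<le> 1 \<and> \<epsilon> i < xs ! i" "(\<Sum>i<n. \<epsilon> i) = j" "proper n a b"
    and k: "kills (dual_seq d (bcoeff f)) n (lprod n (\<lambda>i. xs ! i - \<epsilon> i) a b)" unfolding d by blast
  define es where "es = map \<epsilon> [0..<n]"
  define ys where "ys = map2 (-) xs es"
  have les: "length es = n" "length ys = n" by (simp_all add: es_def ys_def n)
  have ysi: "ys ! i = xs ! i - \<epsilon> i" if "i < n" for i using that by (simp add: ys_def es_def n)
  have "mset ys \<in> FF j (mset xs)"
    unfolding FF_def
  proof (intro CollectI exI conjI)
    show "mset ys = mset (map2 (-) xs es)" by (simp add: ys_def)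
    show "set es \<subseteq> {0, 1}" using \<epsilon>(1) by (auto simp: es_def le_Suc_eq)
    show "sum_list es = j" using \<epsilon>(2) by (simp add: sum_list_nth es_def)
    show "\<forall>y\<in>set (map2 (-) xs es). 0 < y"
      unfolding ys_def[symmetric] using ysi \<epsilon>(1) les by (auto simp: in_set_conv_nth)
  qed (simp_all add: les n)
  moreover have "lprod n ((!) ys) a b = lprod n (\<lambda>i. xs ! i - \<epsilon> i) a b" by (rule lprod_cong) (simp add: ysi)
  then have "L \<in> killed_locus d n ((!) ys)" unfolding killed_locus_def using f k \<epsilon>(3) by (metis (mono_tags, lifting) mem_Collect_eq)
  ultimately show ?thesis using les by blast
qed

text \<open>
  Generic factors yield smooth points of root loci, and nondegeneracy yields annihilators of the
  expected dimension.
\<close>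

definition generic_killed_locus :: "nat \<Rightarrow> nat \<Rightarrow> (nat \<Rightarrow> nat) \<Rightarrow> bpoly set set" where
  "generic_killed_locus d n e = {bp.span {f} | f. f \<in> forms d \<and> f \<noteq> 0 \<and>
     nondegenerate (dual_seq d (bcoeff f)) n (d - n) \<and>
     (\<exists>a b. generic n a b \<and> kills (dual_seq d (bcoeff f)) n (lprod n e a b))}"

lemma kills_mono: "kills c e p \<Longrightarrow> e' \<le> e \<Longrightarrow> kills c e' p"
  by (auto simp: kills_def)

lemma nondegenerate_mono: "nondegenerate c n s \<Longrightarrow> e \<le> n \<Longrightarrow> s \<le> t \<Longrightarrow> nondegenerate c e t"
  unfolding nondegenerate_def using kills_mono by (meson order_trans)

lemma nondegenerate_scale: "a \<noteq> 0 \<Longrightarrow> nondegenerate (\<lambda>i. a * c i) e s \<longleftrightarrow> nondegenerate c e s"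
  by (simp add: nondegenerate_def kills_scale_left_iff)

lemma lprod_add: "lprod n (\<lambda>i. e i + e' i) a b = lprod n e a b * lprod n e' a b"
  by (simp add: lprod_def power_add prod.distrib)

lemma apolar_dom_nondegenerate:
  assumes f: "f \<in> forms (s + e)" "f \<noteq> 0" and nd: "nondegenerate (dual_seq (s + e) (bcoeff f)) e s"
  shows "bp.span {f} \<in> apolar_dom (s + e) s"
  unfolding apolar_dom_def
proof (intro CollectI conjI ballI)
  show "bp.span {f} \<in> PP (forms (s + e))" unfolding PP_forms_iff using f by blast
  fix g assume "g \<in> bp.span {f} - {0}"
  then obtain a where a: "g = a *\<^sub>b f" "a \<noteq> 0" by (auto simp: span_single)
  have g: "g \<in> forms (s + e)" unfolding a using f(1) subspace_forms bp.subspace_scale by blast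
  have "bcoeff g = (\<lambda>i. a * bcoeff f i)" by (auto simp: a)
  then have "nondegenerate (dual_seq (s + e) (bcoeff g)) e s" using nd a(2) by (simp add: dual_seq_scale nondegenerate_scale)
  from nondegenerate_dimensions(1)[OF g this]
  show "bp.dim ((\<lambda>h. diff_action h g) ` forms s) = s + e - s + 1" by simp
qed

text \<open>
  Let \<open>Q = \<Prod> l_i ^ (e_i - \<epsilon>_i)\<close> annihilate \<open>f\<close>. The multiples of \<open>Q\<close> by forms of degree \<open>j\<close> lie
  both in the annihilator of \<open>f\<close> and in the tangent space at \<open>\<Prod> l_i ^ e_i\<close>, and they form a
  space of dimension \<open>j + 1\<close>.
\<close>

lemma generic_killed_subset_preimage:
  fixes e \<epsilon> :: "nat \<Rightarrow> nat" and n :: nat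
  defines "r \<equiv> \<Sum>i<n. e i"
  assumes n: "n > 0" and rn: "n \<le> r" and \<epsilon>: "\<And>i. i < n \<Longrightarrow> \<epsilon> i \<le> 1 \<and> \<epsilon> i < e i" "(\<Sum>i<n. \<epsilon> i) = j"
    and L: "L \<in> generic_killed_locus (r + (n - j)) n (\<lambda>i. e i - \<epsilon> i)"
  shows "L \<in> apolar_preimage (r + (n - j)) r (CH r n j (locus n e))"
proof -
  let ?d = "r + (n - j)"
  have "j \<le> (\<Sum>i<n. 1)" unfolding \<epsilon>(2)[symmetric] by (rule sum_mono) (use \<epsilon>(1) in auto)
  then have j: "j \<le> n" by simp
  have e: "\<And>i. i < n \<Longrightarrow> e i > 0" using \<epsilon>(1) by fastforce
  obtain f a b where f: "f \<in> forms ?d" "f \<noteq> 0" "L = bp.span {f}"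
    and nd0: "nondegenerate (dual_seq ?d (bcoeff f)) n (?d - n)"
    and g: "generic n a b" and k: "kills (dual_seq ?d (bcoeff f)) n (lprod n (\<lambda>i. e i - \<epsilon> i) a b)"
    using L unfolding generic_killed_locus_def by blast
  let ?c = "dual_seq ?d (bcoeff f)" and ?Q = "lprod n (\<lambda>i. e i - \<epsilon> i) a b" and ?P = "lprod n (\<lambda>i. e i - 1) a b"
  have nd: "nondegenerate ?c (n - j) r" by (rule nondegenerate_mono[OF nd0]) auto
  have dom: "L \<in> apolar_dom ?d r" unfolding f(3) by (rule apolar_dom_nondegenerate[OF f(1,2) nd])
  let ?W = "perp r L"
  have perp: "g \<in> ?W \<longleftrightarrow> g \<in> forms r \<and> kills ?c (n - j) (to_poly g)" for g
    unfolding f(3) perp_span[OF f(1)] by simp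
  have subW: "bp.subspace ?W" unfolding f(3) by (rule subspace_perp[OF f(1)])
  have dimW: "bp.dim ?W + (n - j) = r" unfolding f(3) by (rule nondegenerate_dimensions(2)[OF f(1) nd])
  let ?x = "bp.span {to_form r (lprod n e a b)}"
  have sm: "?x \<in> smooth_points (forms r) n (locus n e)"
    and tg: "tangent (forms r) (locus n e) ?x = {to_form r (?P * h) | h. degree h \<le> n}"
    unfolding r_def using generic_tangent[where n = n and e = e, OF e g n] by auto
  have sumd: "(\<Sum>i<n. e i - \<epsilon> i) + j = r"
  proof -
    have "(\<Sum>i<n. e i - \<epsilon> i) + (\<Sum>i<n. \<epsilon> i) = r"
      unfolding r_def sum.distrib[symmetric] by (intro sum.cong refl) (use \<epsilon>(1) in force)
    then show ?thesis using \<epsilon>(2) by simp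
  qed
  have dQ: "degree ?Q + j \<le> r" using degree_lprod[of n "\<lambda>i. e i - \<epsilon> i" a b] sumd by linarith
  have kQ: "to_form r (?Q * h) \<in> ?W" if h: "degree h \<le> j" for h
  proof -
    have "degree (?Q * h) \<le> r" using degree_mult_le[of ?Q h] h dQ by linarith
    moreover have "kills ?c (n - j) (?Q * h)" by (rule kills_mult[OF k]) (use h j in simp)
    ultimately show ?thesis by (simp add: perp to_poly_to_form)
  qed
  have eQ: "lprod n e a b = ?Q * lprod n \<epsilon> a b"
    unfolding lprod_add[symmetric] by (rule lprod_cong) (use \<epsilon>(1) in force)
  have "to_form r (lprod n e a b) \<in> ?W"
    unfolding eQ by (rule kQ) (use degree_lprod[of n \<epsilon> a b] \<epsilon>(2) in simp)
  then have xW: "?x \<subseteq> ?W" using subW by (intro bp.span_minimal) auto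
  have QP: "?Q = ?P * lprod n (\<lambda>i. 1 - \<epsilon> i) a b"
    unfolding lprod_add[symmetric] by (rule lprod_cong) (use \<epsilon>(1) in force)
  have d1: "degree (lprod n (\<lambda>i. 1 - \<epsilon> i) a b) \<le> n - j"
  proof -
    have "(\<Sum>i<n. 1 - \<epsilon> i) + (\<Sum>i<n. \<epsilon> i) = (\<Sum>i<n. 1)"
      unfolding sum.distrib[symmetric] by (intro sum.cong refl) (use \<epsilon>(1) in force)
    then show ?thesis using degree_lprod[of n "\<lambda>i. 1 - \<epsilon> i" a b] \<epsilon>(2) by simp
  qed
  have "{to_form r (?Q * h) | h. degree h \<le> j} \<subseteq> ?W \<inter> {to_form r (?P * h) | h. degree h \<le> n}"
  proof
    fix u assume "u \<in> {to_form r (?Q * h) | h. degree h \<le> j}"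
    then obtain h where h: "u = to_form r (?Q * h)" "degree h \<le> j" by blast
    have "degree (lprod n (\<lambda>i. 1 - \<epsilon> i) a b * h) \<le> n"
      using degree_mult_le[of "lprod n (\<lambda>i. 1 - \<epsilon> i) a b" h] d1 h(2) j by linarith
    moreover have "u = to_form r (?P * (lprod n (\<lambda>i. 1 - \<epsilon> i) a b * h))" unfolding h(1) QP by (simp only: mult.assoc)
    ultimately have "u \<in> {to_form r (?P * h) | h. degree h \<le> n}" by blast
    moreover have "u \<in> ?W" using kQ[OF h(2)] h(1) by simp
    ultimately show "u \<in> ?W \<inter> {to_form r (?P * h) | h. degree h \<le> n}" by blast
  qed
  then have "bp.dim {to_form r (?Q * h) | h. degree h \<le> j} \<le> bp.dim (?W \<inter> {to_form r (?P * h) | h. degree h \<le> n})"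
    by (rule dim_mono_forms[where s = r]) (auto simp: perp_def)
  then have dim: "j + 1 \<le> bp.dim (?W \<inter> tangent (forms r) (locus n e) ?x)"
    unfolding tg using dim_multiples[OF lprod_nonzero[OF generic_proper[OF g]] dQ] by simp
  have "?W \<in> Gr (int r - int n - 1 + int j) (forms r)"
    unfolding Gr_def using subW perp_subset_forms dimW j rn by auto
  then have "?W \<in> CH r n j (locus n e)"
    unfolding CH_def Let_def Gr_closure_def
    by (intro subsetD[OF zariski_closure_superset]) (use sm xW dim in auto)
  then show ?thesis using dom by (simp add: apolar_preimage_def)
qed

section \<open>Dual varieties\<close>

lemma dual_root_eq:
  assumes "n = length ys"
  shows "dual_root (image_mset Suc (mset ys)) = dual_variety (\<Sum>i<n. Suc (ys ! i)) n (locus n (\<lambda>i. Suc (ys ! i)))"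
proof -
  have "image_mset Suc (mset ys) = mset (map Suc ys)" by simp
  moreover have "locus n ((!) (map Suc ys)) = locus n (\<lambda>i. Suc (ys ! i))"
    by (rule locus_cong) (simp add: assms)
  moreover have "sum_list (map Suc ys) = (\<Sum>i<n. Suc (ys ! i))" by (simp add: sum_list_nth assms)
  ultimately show ?thesis
    unfolding dual_root_def by (simp only: root_locus_eq_locus sum_mset_sum_list size_mset length_map assms[symmetric])
qed

lemma perp_top:
  assumes f: "f \<in> forms d" and p: "degree p \<le> d"
  shows "to_form d p \<in> perp d (bp.span {f}) \<longleftrightarrow> pairing (dual_seq d (bcoeff f)) p = 0"
proof -
  have "to_form d p \<in> perp d (bp.span {f}) \<longleftrightarrow> kills (dual_seq d (bcoeff f)) 0 p"
    using perp_span[of f d 0] f by (simp add: to_poly_to_form[OF p])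
  also have "\<dots> \<longleftrightarrow> pairing (dual_seq d (bcoeff f)) p = 0"
    by (simp add: kills_iff contract_def)
  finally show ?thesis .
qed

text \<open>
  The tangent space of the root locus with exponents \<open>e_i + 1\<close> consists of the multiples of
  \<open>\<Prod> l_i ^ e_i\<close>, so the condition that it lies in the annihilator of \<open>f\<close> unfolds to \<open>kills\<close>.
\<close>

lemma conormal_iff_killed:
  fixes e :: "nat \<Rightarrow> nat" and n :: nat
  defines "d \<equiv> \<Sum>i<n. Suc (e i)"
  assumes f: "f \<in> forms d"
  shows "{to_form d (lprod n e a b * h) | h. degree h \<le> n} \<subseteq> perp d (bp.span {f}) \<longleftrightarrow>
    kills (dual_seq d (bcoeff f)) n (lprod n e a b)"
proof -
  have "degree (lprod n e a b * h) \<le> d" if "degree h \<le> n" for h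
    using degree_mult_le[of "lprod n e a b" h] degree_lprod[of n e a b] that by (simp add: d_def sum_Suc)
  then show ?thesis using perp_top[OF f] unfolding kills_def by blast
qed

lemma conormal_subset_killed:
  fixes e :: "nat \<Rightarrow> nat" and n :: nat
  defines "d \<equiv> \<Sum>i<n. Suc (e i)" and "X \<equiv> locus n (\<lambda>i. Suc (e i))"
  shows "{L \<in> PP (forms d). \<exists>x \<in> smooth_points (forms d) n X. tangent (forms d) X x \<subseteq> perp d L} \<subseteq> killed_locus d n e"
proof
  fix L assume "L \<in> {L \<in> PP (forms d). \<exists>x \<in> smooth_points (forms d) n X. tangent (forms d) X x \<subseteq> perp d L}"
  then obtain f x where f: "f \<in> forms d" "f \<noteq> 0" "L = bp.span {f}" and x: "x \<in> smooth_points (forms d) n X"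
    "tangent (forms d) X x \<subseteq> perp d L" unfolding PP_forms_iff by blast
  obtain a b where ab: "proper n a b" "tangent (forms d) X x = {to_form d (lprod n e a b * h) | h. degree h \<le> n}"
    using smooth_point_tangent[where n = n and e = "\<lambda>i. Suc (e i)" and x = x] x(1) unfolding d_def X_def by auto
  then have "kills (dual_seq d (bcoeff f)) n (lprod n e a b)"
    using conormal_iff_killed[where n = n and e = e, folded d_def, OF f(1)] x(2) f(3) by simp
  then show "L \<in> killed_locus d n e" unfolding killed_locus_def using f ab by blast
qed

lemma generic_killed_subset_conormal:
  fixes e :: "nat \<Rightarrow> nat" and n :: nat
  defines "d \<equiv> \<Sum>i<n. Suc (e i)" and "X \<equiv> locus n (\<lambda>i. Suc (e i))"
  assumes n: "n > 0"
  shows "generic_killed_locus d n e \<subseteq> {L \<in> PP (forms d). \<exists>x \<in> smooth_points (forms d) n X. tangent (forms d) X x \<subseteq> perp d L}"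
proof
  fix L assume "L \<in> generic_killed_locus d n e"
  then obtain f a b where f: "f \<in> forms d" "f \<noteq> 0" "L = bp.span {f}"
    and g: "generic n a b" and k: "kills (dual_seq d (bcoeff f)) n (lprod n e a b)"
    unfolding generic_killed_locus_def by blast
  let ?x = "bp.span {to_form d (lprod n (\<lambda>i. Suc (e i)) a b)}"
  have "?x \<in> smooth_points (forms d) n X" "tangent (forms d) X ?x = {to_form d (lprod n e a b * h) | h. degree h \<le> n}"
    unfolding d_def X_def using generic_tangent[where n = n and e = "\<lambda>i. Suc (e i)", OF _ g n] by auto
  moreover have "{to_form d (lprod n e a b * h) | h. degree h \<le> n} \<subseteq> perp d L"
    using conormal_iff_killed[where n = n and e = e, folded d_def, OF f(1)] k f(3) by simp
  ultimately show "L \<in> {L \<in> PP (forms d). \<exists>x \<in> smooth_points (forms d) n X. tangent (forms d) X x \<subseteq> perp d L}"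
    using f PP_forms_iff by auto
qed

section \<open>Density of the generic annihilated forms\<close>

lemma contract_cong: "(\<And>i. i \<le> degree p \<Longrightarrow> c (k + i) = c' (k + i)) \<Longrightarrow> contract p c k = contract p c' k"
  unfolding contract_def by (rule pairing_cong)

lemma kills_cong:
  assumes "\<And>i. i \<le> degree p + e \<Longrightarrow> c i = c' i"
  shows "kills c e p \<longleftrightarrow> kills c' e p"
proof -
  have "contract p c k = contract p c' k" if "k \<le> e" for k
    by (rule contract_cong) (use assms that in auto)
  then show ?thesis by (simp add: kills_iff)
qed

definition form_of :: "nat \<Rightarrow> (nat \<Rightarrow> complex) \<Rightarrow> bpoly" where
  "form_of d c = to_form d (\<Sum>i\<le>d. monom (c i / (fact i * fact (d - i))) i)"

lemma form_of_forms: "form_of d c \<in> forms d"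
  by (simp add: form_of_def)

lemma bcoeff_form_of: "bcoeff (form_of d c) (i, k) = (if i + k = d then c i / (fact i * fact k) else 0)"
  by (auto simp: form_of_def bcoeff_to_form coeff_sum sum.delta)

lemma dual_seq_form_of: "i \<le> d \<Longrightarrow> dual_seq d (bcoeff (form_of d c)) i = c i"
  by (simp add: dual_seq_def bcoeff_form_of)

lemma form_of_dual_seq:
  assumes "f \<in> forms d"
  shows "form_of d (dual_seq d (bcoeff f)) = f"
proof (rule bcoeff_eqI)
  fix x :: "nat \<times> nat"
  obtain i k where x: "x = (i, k)" by (cases x)
  show "bcoeff (form_of d (dual_seq d (bcoeff f))) x = bcoeff f x"
    unfolding x bcoeff_form_of using formsD[OF assms, of i k] by (auto simp: dual_seq_def)
qed

text \<open>
  The generating function is \<open>X ^ s\<close> divided by the reflected polynomial of \<open>p\<close>.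
\<close>

lemma recurrence_solution:
  fixes p :: "complex poly"
  assumes "degree p = Suc s"
  shows "\<exists>c. (\<forall>k. contract p c k = 0) \<and> (\<forall>i<s. c i = 0) \<and> c s \<noteq> 0"
proof -
  let ?R = "fps_of_poly (reflect_poly p)"
  have p0: "p \<noteq> 0" using assms by auto
  have R0: "fps_nth ?R 0 \<noteq> 0" using p0 by simp
  define C where "C = fps_X ^ s * inverse ?R"
  have RC: "?R * C = fps_X ^ s"
    unfolding C_def using inverse_mult_eq_1'[OF R0] by (simp add: mult.left_commute)
  define c where "c = fps_nth C"
  have ci: "c i = (if i < s then 0 else fps_nth (inverse ?R) (i - s))" for i
    by (simp add: c_def C_def fps_X_power_mult_nth)
  have "contract p c k = 0" for k
  proof -
    have "fps_nth (?R * C) (k + Suc s) = (\<Sum>i=0..k + Suc s. coeff (reflect_poly p) i * c (k + Suc s - i))"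
      by (simp add: fps_mult_nth c_def)
    also have "\<dots> = (\<Sum>i\<le>Suc s. coeff p (Suc s - i) * c (k + Suc s - i))"
      by (rule sum.mono_neutral_cong_right) (auto simp: coeff_reflect_poly assms)
    also have "\<dots> = (\<Sum>m\<le>Suc s. coeff p m * c (k + m))"
      by (rule sum.reindex_bij_witness[of _ "\<lambda>m. Suc s - m" "\<lambda>i. Suc s - i"]) auto
    also have "\<dots> = contract p c k" by (simp only: contract_def pairing_def assms)
    finally show ?thesis using RC by (simp add: fps_X_power_nth)
  qed
  moreover have "c s \<noteq> 0" using R0 by (simp add: ci)
  ultimately show ?thesis using ci by (intro exI[of _ c]) auto
qed

text \<open>
  A square block of the catalecticant. Its nonvanishing is an open condition that implies
  nondegeneracy.
\<close>

definition hankel :: "nat \<Rightarrow> nat \<Rightarrow> (nat \<Rightarrow> complex) \<Rightarrow> complex" where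
  "hankel n t c = det (mat (Suc n) (Suc n) (\<lambda>(a, b). c (t + a + b)))"

lemma hankel_nondegenerate:
  assumes "hankel n t c \<noteq> 0" "t + n \<le> s"
  shows "nondegenerate c n s"
  unfolding nondegenerate_def
proof (intro allI impI)
  fix h assume h: "degree h \<le> n" "kills c s h"
  have "\<forall>b<Suc n. coeff h b = 0"
  proof (rule det_rows_independent[OF assms(1)[unfolded hankel_def]])
    fix b assume "b < Suc n"
    then have "contract h c (t + b) = 0" using h(2) assms(2) by (simp add: kills_iff)
    then show "(\<Sum>a<Suc n. coeff h a * c (t + a + b)) = 0"
      by (simp add: contract_def pairing_eq[OF h(1)] lessThan_Suc_atMost ac_simps del: sum.lessThan_Suc)
  qed
  then show "h = 0" using h(1) by (intro poly_eqI) (metis coeff_0 coeff_eq_0 le_less_trans not_less_eq)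
qed

text \<open>
  The matrix is zero above the antidiagonal and has a nonzero constant on it.
\<close>

lemma hankel_antitriangular:
  assumes z: "\<And>i. i < t + n \<Longrightarrow> c i = 0" and nonvanishing: "c (t + n) \<noteq> 0"
  shows "hankel n t c \<noteq> 0"
proof
  assume "hankel n t c = 0"
  let ?A = "mat (Suc n) (Suc n) (\<lambda>(a, b). c (t + a + b))"
  have "?A \<in> carrier_mat (Suc n) (Suc n)" by simp
  from det_0_iff_vec_prod_zero[OF this] \<open>hankel n t c = 0\<close>
  obtain v where v: "v \<in> carrier_vec (Suc n)" "v \<noteq> 0\<^sub>v (Suc n)" "?A *\<^sub>v v = 0\<^sub>v (Suc n)"
    unfolding hankel_def by blast
  define S where "S = {i. i < Suc n \<and> v $ i \<noteq> 0}"
  have "S \<noteq> {}" using v(1,2) by (auto simp: S_def intro!: eq_vecI)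
  have finS: "finite S" by (simp add: S_def)
  define m where "m = Max S"
  have m: "m < Suc n" "v $ m \<noteq> 0" using Max_in[OF finS \<open>S \<noteq> {}\<close>] by (auto simp: m_def S_def)
  have above: "v $ i = 0" if "m < i" "i < Suc n" for i
  proof (rule ccontr)
    assume "v $ i \<noteq> 0"
    then have "i \<in> S" using that by (simp add: S_def)
    then show False using Max_ge[OF finS] that(1) by (simp add: m_def leD)
  qed
  have "0 = (?A *\<^sub>v v) $ (n - m)" using v(3) m by simp
  also have "\<dots> = (\<Sum>b<Suc n. c (t + (n - m) + b) * v $ b)"
    using v(1) m by (simp add: scalar_prod_def lessThan_atLeast0 del: sum.op_ivl_Suc)
  also have "\<dots> = (\<Sum>b<Suc n. if b = m then c (t + n) * v $ m else 0)"
  proof (intro sum.cong refl)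
    fix b assume b: "b \<in> {..<Suc n}"
    consider "b < m" | "b = m" | "b > m" by linarith
    then show "c (t + (n - m) + b) * v $ b = (if b = m then c (t + n) * v $ m else 0)"
      using z[of "t + (n - m) + b"] above[of b] b m by cases auto
  qed
  also have "\<dots> = c (t + n) * v $ m" using m by (simp del: sum.lessThan_Suc)
  finally show False using nonvanishing m by simp
qed

lemma homog_poly_hankel: "homog_poly (\<Sum>a<Suc n. 1) (\<lambda>\<zeta>. hankel n t (dual_seq d \<zeta>))"
  unfolding hankel_def dual_seq_def by (intro homog.det homog.scale homog_poly.var)

lemma nondegenerate_nonzero: "nondegenerate (dual_seq d (bcoeff f)) n s \<Longrightarrow> f \<noteq> 0"
  unfolding nondegenerate_def
proof
  assume a: "\<forall>h. degree h \<le> n \<longrightarrow> kills (dual_seq d (bcoeff f)) s h \<longrightarrow> h = 0" "f = 0"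
  have "kills (dual_seq d (bcoeff f)) s 1" by (simp add: a(2) kills_def pairing_def dual_seq_def)
  then have "(1::complex poly) = 0" using a(1) by (metis degree_1 le0)
  then show False by simp
qed

text \<open>
  For fixed generic factors, the sequence \<open>c1\<close> solves the recurrence and has a nonzero Hankel
  determinant. Hence on the line through \<open>f1\<close> in direction \<open>f\<close> all but finitely many forms are
  nondegenerate, and \<open>f\<close> is the point at infinity of this line.
\<close>

lemma vanishing_on_generic_killed:
  fixes e :: "nat \<Rightarrow> nat"
  assumes n: "n + 1 \<le> (\<Sum>i<n. e i)" and d: "d = (\<Sum>i<n. e i) + n"
    and F: "homog_poly m F" "\<forall>p\<in>generic_killed_locus d n e. \<forall>z\<in>point_coords p. F z = 0"
    and g: "generic n a b" and f: "f \<in> forms d" "kills (dual_seq d (bcoeff f)) n (lprod n e a b)"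
  shows "F (bcoeff f) = 0"
proof -
  define s where "s = (\<Sum>i<n. e i)"
  let ?p = "lprod n e a b"
  have s: "s - 1 - n + n = s - 1" "degree ?p = Suc (s - 1)" "degree ?p = s"
    using n degree_lprod_generic[OF g, of e] by (simp_all add: s_def)
  obtain c1 where c1: "\<And>k. contract ?p c1 k = 0" "\<And>i. i < s - 1 \<Longrightarrow> c1 i = 0" "c1 (s - 1) \<noteq> 0"
    using recurrence_solution[OF s(2)] by blast
  define f1 where "f1 = form_of d c1"
  have f1: "f1 \<in> forms d" by (simp add: f1_def form_of_forms)
  have c1': "dual_seq d (bcoeff f1) i = c1 i" if "i \<le> s + n" for i
    using that by (simp add: f1_def dual_seq_form_of d s_def)
  have k1: "kills (dual_seq d (bcoeff f1)) n ?p"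
  proof -
    have "kills c1 n ?p" by (simp add: kills_iff c1(1))
    then show ?thesis by (subst kills_cong[where c' = c1]) (simp_all add: c1' s(3))
  qed
  \<comment> \<open>The block with \<open>c1 (s - 1)\<close> on its antidiagonal; it fits because \<open>n + 1 \<le> s\<close>.\<close>
  define H where "H \<zeta> = hankel n (s - 1 - n) (dual_seq d \<zeta>)" for \<zeta>
  have H1: "H (bcoeff f1) \<noteq> 0"
    unfolding H_def by (rule hankel_antitriangular) (use c1(2,3) s(1) in \<open>simp_all add: c1'\<close>)
  obtain q where q: "\<And>t. H (\<lambda>i. bcoeff f1 i + t * bcoeff f i) = poly q t"
    using homog_poly_line[OF homog_poly_hankel[of n "s - 1 - n" d], of "bcoeff f1" "bcoeff f"] unfolding H_def by blast
  have "q \<noteq> 0" using q[of 0] H1 by auto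
  have "F (\<lambda>i. bcoeff f1 i + t * bcoeff f i) = 0" if t: "poly q t \<noteq> 0" for t
  proof -
    let ?g = "f1 + t *\<^sub>b f"
    have bg: "bcoeff ?g = (\<lambda>i. bcoeff f1 i + t * bcoeff f i)" by auto
    have gf: "?g \<in> forms d" using f1 f(1) subspace_forms by (simp add: bp.subspace_add bp.subspace_scale)
    have nd: "nondegenerate (dual_seq d (bcoeff ?g)) n (d - n)"
      by (rule hankel_nondegenerate[where t = "s - 1 - n"]) (use t q[of t] bg s(1) in \<open>simp_all add: H_def d s_def\<close>)
    have cg: "dual_seq d (bcoeff ?g) = (\<lambda>i. dual_seq d (bcoeff f1) i + t * dual_seq d (bcoeff f) i)"
      unfolding bg dual_seq_add dual_seq_scale ..
    have "kills (dual_seq d (bcoeff ?g)) n ?p"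
      unfolding cg using k1 f(2) by (simp add: kills_def pairing_add_left pairing_scale_left)
    then have "bp.span {?g} \<in> generic_killed_locus d n e"
      unfolding generic_killed_locus_def using gf nd nondegenerate_nonzero[OF nd] g by blast
    moreover have "bcoeff ?g \<in> point_coords (bp.span {?g})"
      unfolding point_coords_def using nondegenerate_nonzero[OF nd] by (intro imageI) (simp add: bp.span_base)
    ultimately show ?thesis using F(2) bg by metis
  qed
  then have "- {t. poly q t = 0} \<subseteq> {t. F (\<lambda>i. bcoeff f1 i + t * bcoeff f i) = 0}" by auto
  moreover have "infinite (- {t. poly q t = 0})"
    using poly_roots_finite[OF \<open>q \<noteq> 0\<close>] infinite_UNIV_char_0 by (simp add: Compl_eq_Diff_UNIV)
  ultimately have "infinite {t. F (\<lambda>i. bcoeff f1 i + t * bcoeff f i) = 0}" using finite_subset by blast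
  then show ?thesis by (rule homog_poly_line_limit[OF F(1)])
qed

text \<open>
  Along the perturbation \<open>Q x\<close> of \<open>p\<close>, solutions of \<open>contract p c = e\<close> can be followed together
  with any perturbation of the right-hand side. The freedom in \<open>e\<close> makes the property
  multiplicative.
\<close>

definition liftable :: "(complex \<Rightarrow> complex poly) \<Rightarrow> complex poly \<Rightarrow> nat \<Rightarrow> bool" where
  "liftable Q p s \<longleftrightarrow> (\<forall>x. degree (Q x) \<le> s) \<and>
     (\<forall>N c e E. (\<forall>k\<le>N. contract p c k = e k) \<longrightarrow> (\<forall>k\<le>N. ((\<lambda>x. E x k) \<longlongrightarrow> e k) (at (0::complex))) \<longrightarrow>
        (\<exists>C. (\<forall>i\<le>N + s. ((\<lambda>x. C x i) \<longlongrightarrow> c i) (at 0)) \<and>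
             (\<forall>\<^sub>F x in at 0. \<forall>k\<le>N. contract (Q x) (C x) k = E x k)))"

lemma liftableD:
  assumes "liftable Q p s" "\<And>k. k \<le> N \<Longrightarrow> contract p c k = e k" "\<And>k. k \<le> N \<Longrightarrow> ((\<lambda>x. E x k) \<longlongrightarrow> e k) (at 0)"
  obtains C where "\<And>i. i \<le> N + s \<Longrightarrow> ((\<lambda>x. C x i) \<longlongrightarrow> c i) (at 0)"
    "\<forall>\<^sub>F x in at 0. \<forall>k\<le>N. contract (Q x) (C x) k = E x k"
  using assms unfolding liftable_def by blast

lemma liftable_1: "liftable (\<lambda>_. 1) 1 0"
  unfolding liftable_def
proof (intro conjI allI impI)
  fix N c e and E :: "complex \<Rightarrow> nat \<Rightarrow> complex"
  assume "\<forall>k\<le>N. contract 1 c k = e k" "\<forall>k\<le>N. ((\<lambda>x. E x k) \<longlongrightarrow> e k) (at 0)"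
  then show "\<exists>C. (\<forall>i\<le>N + 0. ((\<lambda>x. C x i) \<longlongrightarrow> c i) (at 0)) \<and> (\<forall>\<^sub>F x in at 0. \<forall>k\<le>N. contract 1 (C x) k = E x k)"
    by (intro exI[of _ E]) (simp add: contract_def pairing_def)
qed simp

lemma liftable_mult:
  assumes Q: "liftable Q p s" and R: "liftable R q t"
  shows "liftable (\<lambda>x. Q x * R x) (p * q) (s + t)"
  unfolding liftable_def
proof (intro conjI allI impI)
  have dQ: "degree (Q x) \<le> s" and dR: "degree (R x) \<le> t" for x using Q R by (auto simp: liftable_def)
  show "degree (Q x * R x) \<le> s + t" for x
    using degree_mult_le[of "Q x" "R x"] dQ[of x] dR[of x] by linarith
  fix N c e and E :: "complex \<Rightarrow> nat \<Rightarrow> complex"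
  assume c: "\<forall>k\<le>N. contract (p * q) c k = e k" and E: "\<forall>k\<le>N. ((\<lambda>x. E x k) \<longlongrightarrow> e k) (at 0)"
  obtain C' where C': "\<And>i. i \<le> N + t \<Longrightarrow> ((\<lambda>x. C' x i) \<longlongrightarrow> contract p c i) (at 0)"
    "\<forall>\<^sub>F x in at 0. \<forall>k\<le>N. contract (R x) (C' x) k = E x k"
    by (rule liftableD[OF R, of N "contract p c" e E]) (use c E in \<open>auto simp: contract_mult\<close>)
  obtain C where C: "\<And>i. i \<le> N + t + s \<Longrightarrow> ((\<lambda>x. C x i) \<longlongrightarrow> c i) (at 0)"
    "\<forall>\<^sub>F x in at 0. \<forall>k\<le>N + t. contract (Q x) (C x) k = C' x k"
    by (rule liftableD[OF Q, of "N + t" c "contract p c" C']) (use C'(1) in auto)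
  have "\<forall>\<^sub>F x in at 0. \<forall>k\<le>N. contract (Q x * R x) (C x) k = E x k"
    using C'(2) C(2)
  proof eventually_elim
    case (elim x)
    show ?case
    proof (intro allI impI)
      fix k assume k: "k \<le> N"
      have "contract (Q x * R x) (C x) k = contract (R x) (C' x) k"
        unfolding contract_mult by (rule contract_cong) (use elim(2) dR[of x] k in auto)
      then show "contract (Q x * R x) (C x) k = E x k" using elim(1) k by simp
    qed
  qed
  then show "\<exists>C. (\<forall>i\<le>N + (s + t). ((\<lambda>x. C x i) \<longlongrightarrow> c i) (at 0)) \<and>
      (\<forall>\<^sub>F x in at 0. \<forall>k\<le>N. contract (Q x * R x) (C x) k = E x k)"
    using C(1) by (intro exI[of _ C]) (simp add: ac_simps)
qed

lemma liftable_power: "liftable Q p s \<Longrightarrow> liftable (\<lambda>x. Q x ^ m) (p ^ m) (m * s)"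
proof (induction m)
  case 0 then show ?case using liftable_1 by simp
next
  case (Suc m) then show ?case using liftable_mult[of Q p s "\<lambda>x. Q x ^ m" "p ^ m" "m * s"] by simp
qed

text \<open>
  For one linear factor the equation is a recurrence of first order. It is solved upwards from
  the first term if \<open>a i \<noteq> 0\<close>, and downwards from the last term if \<open>a i = 0\<close>.
\<close>

lemma liftable_lfac:
  assumes "(a i, b i) \<noteq> (0, 0)"
  shows "liftable (\<lambda>x. lfac (\<lambda>i. a i + x) (\<lambda>i. b i + x * of_nat i) i) (lfac a b i) 1"
  unfolding liftable_def
proof (intro conjI allI impI)
  show "degree (lfac (\<lambda>i. a i + x) (\<lambda>i. b i + x * of_nat i) i) \<le> 1" for x by (rule degree_lfac)
  fix N c e and E :: "complex \<Rightarrow> nat \<Rightarrow> complex"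
  assume c: "\<forall>k\<le>N. contract (lfac a b i) c k = e k" and E: "\<forall>k\<le>N. ((\<lambda>x. E x k) \<longlongrightarrow> e k) (at 0)"
  let ?a = "\<lambda>x. a i + x" and ?b = "\<lambda>x. b i + x * of_nat i"
  have ab: "(?a \<longlongrightarrow> a i) (at 0)" "(?b \<longlongrightarrow> b i) (at 0)" by (auto intro!: tendsto_eq_intros)
  have ck: "b i * c k + a i * c (Suc k) = e k" if "k \<le> N" for k using c that by (simp add: contract_lfac)
  show "\<exists>C. (\<forall>k\<le>N + 1. ((\<lambda>x. C x k) \<longlongrightarrow> c k) (at 0)) \<and>
     (\<forall>\<^sub>F x in at 0. \<forall>k\<le>N. contract (lfac (\<lambda>i. a i + x) (\<lambda>i. b i + x * of_nat i) i) (C x) k = E x k)"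
  proof (cases "a i = 0")
    case False
    define C where "C x = rec_nat (c 0) (\<lambda>k y. (E x k - ?b x * y) / ?a x)" for x
    have C0: "C x 0 = c 0" and CS: "C x (Suc k) = (E x k - ?b x * C x k) / ?a x" for x k by (simp_all add: C_def)
    have lim: "k \<le> N + 1 \<Longrightarrow> ((\<lambda>x. C x k) \<longlongrightarrow> c k) (at 0)" for k
    proof (induction k)
      case (Suc k)
      have "((\<lambda>x. (E x k - ?b x * C x k) / ?a x) \<longlongrightarrow> (e k - b i * c k) / a i) (at 0)"
        using Suc E False by (intro tendsto_divide tendsto_diff tendsto_mult ab) auto
      moreover have "(e k - b i * c k) / a i = c (Suc k)" using ck[of k] Suc.prems False by (auto simp: field_simps)
      ultimately show ?case by (simp add: CS)
    qed (simp add: C0)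
    have "\<forall>\<^sub>F x in at 0. ?a x \<noteq> 0" using ab(1) False by (rule tendsto_imp_eventually_ne)
    then have "\<forall>\<^sub>F x in at 0. \<forall>k\<le>N. contract (lfac (\<lambda>i. a i + x) (\<lambda>i. b i + x * of_nat i) i) (C x) k = E x k"
      by eventually_elim (simp add: contract_lfac CS)
    then show ?thesis using lim by blast
  next
    case True
    then have b0: "b i \<noteq> 0" using assms by simp
    define G where "G x = rec_nat (c (Suc N)) (\<lambda>m y. (E x (N - m) - ?a x * y) / ?b x)" for x
    have G0: "G x 0 = c (Suc N)" and GS: "G x (Suc m) = (E x (N - m) - ?a x * G x m) / ?b x" for x m
      by (simp_all add: G_def)
    have lim: "m \<le> Suc N \<Longrightarrow> ((\<lambda>x. G x m) \<longlongrightarrow> c (Suc N - m)) (at 0)" for m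
    proof (induction m)
      case (Suc m)
      have "((\<lambda>x. (E x (N - m) - ?a x * G x m) / ?b x) \<longlongrightarrow> (e (N - m) - a i * c (Suc N - m)) / b i) (at 0)"
        using Suc E b0 by (intro tendsto_divide tendsto_diff tendsto_mult ab) auto
      moreover have "(e (N - m) - a i * c (Suc N - m)) / b i = c (Suc N - Suc m)"
        using ck[of "N - m"] Suc.prems b0 by (auto simp: field_simps Suc_diff_le)
      ultimately show ?case by (simp add: GS)
    qed (simp add: G0)
    define C where "C x k = G x (Suc N - k)" for x k
    have "\<forall>\<^sub>F x in at 0. ?b x \<noteq> 0" using ab(2) b0 by (rule tendsto_imp_eventually_ne)
    then have "\<forall>\<^sub>F x in at 0. \<forall>k\<le>N. contract (lfac (\<lambda>i. a i + x) (\<lambda>i. b i + x * of_nat i) i) (C x) k = E x k"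
    proof eventually_elim
      case (elim x)
      show ?case
      proof (intro allI impI)
        fix k assume k: "k \<le> N"
        have "C x k = (E x k - ?a x * C x (Suc k)) / ?b x"
          using GS[of x "N - k"] k by (simp add: C_def Suc_diff_le)
        then show "contract (lfac (\<lambda>i. a i + x) (\<lambda>i. b i + x * of_nat i) i) (C x) k = E x k"
          using elim by (simp add: contract_lfac)
      qed
    qed
    moreover have "((\<lambda>x. C x k) \<longlongrightarrow> c k) (at 0)" if "k \<le> N + 1" for k
      using lim[of "Suc N - k"] that by (simp add: C_def)
    ultimately show ?thesis by blast
  qed
qed

lemma liftable_lprod:
  "proper n a b \<Longrightarrow> liftable (\<lambda>x. lprod n e (\<lambda>i. a i + x) (\<lambda>i. b i + x * of_nat i)) (lprod n e a b) (\<Sum>i<n. e i)"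
proof (induction n)
  case 0
  then show ?case using liftable_1 by (simp add: lprod_def)
next
  case (Suc n)
  have "liftable (\<lambda>x. lfac (\<lambda>i. a i + x) (\<lambda>i. b i + x * of_nat i) n ^ e n) (lfac a b n ^ e n) (e n * 1)"
    by (intro liftable_power liftable_lfac) (use Suc.prems in \<open>simp add: proper_def\<close>)
  from liftable_mult[OF Suc.IH this] Suc.prems show ?case by (simp add: lprod_def proper_def)
qed

text \<open>
  Any annihilated form is a limit of forms annihilated by generic products, obtained by lifting
  its sequence along \<open>eventually_generic\<close>. Polynomials vanishing on the generic part vanish on
  these forms by \<open>vanishing_on_generic_killed\<close>, and on the limit by continuity.
\<close>

lemma killed_subset_closure:
  fixes e :: "nat \<Rightarrow> nat"
  assumes n: "n + 1 \<le> (\<Sum>i<n. e i)" and d: "d = (\<Sum>i<n. e i) + n"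
  shows "killed_locus d n e \<subseteq> proj_closure (forms d) (generic_killed_locus d n e)"
proof
  fix L assume "L \<in> killed_locus d n e"
  then obtain f0 a b where f0: "f0 \<in> forms d" "f0 \<noteq> 0" "L = bp.span {f0}" and ab: "proper n a b"
    and k0: "kills (dual_seq d (bcoeff f0)) n (lprod n e a b)" unfolding killed_locus_def by blast
  have "F z = 0" if F: "homog_poly m F" "\<forall>p\<in>generic_killed_locus d n e. \<forall>z\<in>point_coords p. F z = 0"
    and z: "z \<in> point_coords L" for m F z
  proof -
    obtain t where t: "z = bcoeff (t *\<^sub>b f0)" using z f0(3) by (auto simp: point_coords_def span_single)
    define f where "f = t *\<^sub>b f0"
    have f: "f \<in> forms d" using f0(1) subspace_forms by (simp add: f_def bp.subspace_scale)
    define c where "c = dual_seq d (bcoeff f)"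
    have "bcoeff f = (\<lambda>i. t * bcoeff f0 i)" by (auto simp: f_def)
    then have "kills c n (lprod n e a b)" unfolding c_def using kills_scale_left[OF k0] by (simp add: dual_seq_scale)
    then have ck: "contract (lprod n e a b) c k = 0" if "k \<le> n" for k using that by (simp add: kills_iff)
    let ?a = "\<lambda>x i. a i + x" and ?b = "\<lambda>x i. b i + x * of_nat i"
    obtain C where C: "\<And>i. i \<le> n + (\<Sum>i<n. e i) \<Longrightarrow> ((\<lambda>x. C x i) \<longlongrightarrow> c i) (at 0)"
      "\<forall>\<^sub>F x in at 0. \<forall>k\<le>n. contract (lprod n e (?a x) (?b x)) (C x) k = 0"
      by (rule liftableD[OF liftable_lprod[OF ab, of e], of n c "\<lambda>_. 0" "\<lambda>_ _. 0"]) (use ck in auto)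
    have lim: "((\<lambda>x. bcoeff (form_of d (C x)) y) \<longlongrightarrow> bcoeff f y) (at 0)" for y :: "nat \<times> nat"
    proof -
      obtain i k where y: "y = (i, k)" by (cases y)
      have "((\<lambda>x. bcoeff (form_of d (C x)) y) \<longlongrightarrow> bcoeff (form_of d c) y) (at 0)"
        unfolding y bcoeff_form_of using C(1)[of i] by (cases "i + k = d") (auto simp: d intro!: tendsto_intros)
      then show ?thesis by (simp add: c_def form_of_dual_seq[OF f])
    qed
    have "\<forall>\<^sub>F x in at 0. F (bcoeff (form_of d (C x))) = 0"
      using eventually_generic[of n a b] C(2)
    proof eventually_elim
      case (elim x)
      have "kills (C x) n (lprod n e (?a x) (?b x))" using elim(2) by (simp add: kills_iff)
      moreover have "dual_seq d (bcoeff (form_of d (C x))) i = C x i" if "i \<le> degree (lprod n e (?a x) (?b x)) + n" for i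
        using that degree_lprod[of n e "?a x" "?b x"] by (simp add: dual_seq_form_of d)
      ultimately have "kills (dual_seq d (bcoeff (form_of d (C x)))) n (lprod n e (?a x) (?b x))"
        by (subst kills_cong[where c' = "C x"]) auto
      then show ?case by (rule vanishing_on_generic_killed[OF n d F elim(1) form_of_forms])
    qed
    then have "((\<lambda>x. F (bcoeff (form_of d (C x)))) \<longlongrightarrow> 0) (at 0)" by (rule tendsto_eventually)
    moreover have "((\<lambda>x. F (bcoeff (form_of d (C x)))) \<longlongrightarrow> F (bcoeff f)) (at 0)"
      by (rule homog_poly_tendsto[OF F(1)]) (rule lim)
    ultimately show "F z = 0" unfolding t f_def[symmetric] by (rule tendsto_unique[OF at_neq_bot, THEN sym])
  qed
  moreover have "L \<in> PP (forms d)" unfolding PP_forms_iff using f0 by blast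
  ultimately show "L \<in> proj_closure (forms d) (generic_killed_locus d n e)"
    by (intro proj_closureI) blast+
qed

section \<open>The theorem\<close>

lemma finite_FF: "finite (FF j \<mu>)"
proof -
  let ?S = "{xs. set xs \<subseteq> set_mset \<mu> \<and> length xs = size \<mu>} \<times> {es. set es \<subseteq> {0, 1::nat} \<and> length es = size \<mu>}"
  have "finite ?S" by (intro finite_cartesian_product finite_lists_length_eq) auto
  moreover have "FF j \<mu> \<subseteq> (\<lambda>(xs, es). mset (map2 (-) xs es)) ` ?S"
    unfolding FF_def by (force simp: image_iff)
  ultimately show ?thesis using finite_surj by blast
qed

lemma FF_0: "\<mu>' \<in> FF 0 \<mu> \<Longrightarrow> \<mu>' = \<mu>"
proof -
  assume "\<mu>' \<in> FF 0 \<mu>"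
  then obtain xs es where xs: "mset xs = \<mu>" "length es = length xs" "sum_list es = 0" "\<mu>' = mset (map2 (-) xs es)"
    unfolding FF_def by auto
  have "es ! i = 0" if "i < length es" for i using xs(3) that by (simp add: sum_list_eq_0_iff)
  then have "map2 (-) xs es = xs" using xs(2) by (intro nth_equalityI) auto
  then show ?thesis using xs by simp
qed

lemma generic_killed_locus_reorder:
  assumes "mset xs = mset ys"
  shows "generic_killed_locus d (length xs) ((!) xs) \<subseteq> generic_killed_locus d (length ys) ((!) ys)"
proof -
  have l: "length ys = length xs" using assms by (metis size_mset)
  obtain p where p: "p permutes {..<length xs}"
    "\<And>a b. lprod (length ys) ((!) ys) (a \<circ> p) (b \<circ> p) = lprod (length xs) ((!) xs) a b"
    using lprod_reorder[OF assms[symmetric]] by blast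
  have "\<exists>a' b'. generic (length ys) a' b' \<and> kills c (length ys) (lprod (length ys) ((!) ys) a' b')"
    if "generic (length xs) a b" "kills c (length xs) (lprod (length xs) ((!) xs) a b)" for a b c
    using generic_permute[OF p(1) that(1)] that(2) p(2)[of a b] unfolding l by metis
  then show ?thesis unfolding generic_killed_locus_def l by blast
qed

lemma generic_killed_locus_cong:
  assumes "\<And>i. i < n \<Longrightarrow> e i = e' i"
  shows "generic_killed_locus d n e = generic_killed_locus d n e'"
proof -
  have "lprod n e = lprod n e'" by (intro ext lprod_cong assms)
  then show ?thesis unfolding generic_killed_locus_def by (simp only:)
qed

theorem corollary2p4:
  fixes r n j d :: nat and lam :: "nat multiset"
  assumes "r > 0"
    and "is_partition lam r"
    and "size lam = n"
    and "int j \<le> min (int n) (int r - int n - 1)"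
    and "d = r + n - j"
    and "j \<le> n - count lam 1"
  shows "proj_closure (forms d) (apolar_preimage d r (CH_root j lam)) =
           (\<Union>lam'\<in>FF j lam. proj_closure (forms d) (apolar_preimage d (r - j) (CH_root 0 lam'))) \<and>
         (\<Union>lam'\<in>FF j lam. proj_closure (forms d) (apolar_preimage d (r - j) (CH_root 0 lam'))) =
           (\<Union>lam'\<in>FF j lam. dual_root (image_mset Suc lam'))"
proof -
  let ?cl = "proj_closure (forms d)"
  let ?S1 = "apolar_preimage d r (CH_root j lam)"
  let ?S2 = "\<lambda>lam'. apolar_preimage d (r - j) (CH_root 0 lam')"
  obtain xs0 where xs0: "mset xs0 = lam" using ex_mset by blast
  have j: "j \<le> n" and rn: "n + 1 + j \<le> r" and d: "d = r + (n - j)" using assms(4,5) by auto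
  have n0: "n > 0" using assms(1-3) by (cases lam) (auto simp: is_partition_def)
  have pos: "\<forall>x\<in>#lam. x > 0" using assms(2) unfolding is_partition_def by (metis gr0I)
  have sumlam: "sum_mset lam = r" using assms(2) by (simp add: is_partition_def)
  \<comment> \<open>The common dense subset for \<open>lam'\<close>; the union is over all orders of its parts.\<close>
  define Gen where "Gen lam' = (\<Union>ys\<in>{ys. mset ys = lam' \<and> length ys = n}. generic_killed_locus d n ((!) ys))" for lam'
  have S1_PP: "?S1 \<subseteq> PP (forms d)" and S2_PP: "?S2 lam' \<subseteq> PP (forms d)" for lam'
    by (auto simp: apolar_preimage_def apolar_dom_def)
  have Gen_PP: "Gen lam' \<subseteq> PP (forms d)" for lam'
    unfolding Gen_def generic_killed_locus_def using PP_forms_iff by blast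
  have FFD: "\<exists>xs es. mset xs = lam \<and> length xs = n \<and> length es = n \<and> (\<forall>i<n. es ! i \<le> 1 \<and> es ! i < xs ! i) \<and>
      (\<Sum>i<n. es ! i) = j \<and> lam' = mset (map2 (-) xs es)" if lam': "lam' \<in> FF j lam" for lam'
  proof -
    obtain xs es where xs: "mset xs = lam" "length es = length xs" "set es \<subseteq> {0, 1}" "sum_list es = j"
      "\<forall>y\<in>set (map2 (-) xs es). y > 0" "lam' = mset (map2 (-) xs es)" using lam' unfolding FF_def by blast
    have ln: "length xs = n" using xs(1) assms(3) by auto
    have "es ! i \<le> 1 \<and> es ! i < xs ! i" if i: "i < n" for i
    proof -
      have "map2 (-) xs es ! i \<in> set (map2 (-) xs es)" using i ln xs(2) by (intro nth_mem) simp
      then have "map2 (-) xs es ! i > 0" using xs(5) by blast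
      then have "xs ! i - es ! i > 0" using i ln xs(2) by simp
      moreover have "es ! i \<in> {0, 1}" using xs(2,3) i ln nth_mem by (metis subsetD)
      ultimately show ?thesis by auto
    qed
    then show ?thesis using xs ln by (intro exI[of _ xs] exI[of _ es]) (auto simp: sum_list_nth)
  qed
  have ysD: "length ys = n \<and> sum_list ys = r - j \<and> (\<forall>x\<in>set ys. x > 0)" if lam': "lam' \<in> FF j lam" and ys: "mset ys = lam'" for lam' ys
  proof -
    obtain xs es where xs: "mset xs = lam" "length xs = n" "length es = n" "\<forall>i<n. es ! i \<le> 1 \<and> es ! i < xs ! i"
      "(\<Sum>i<n. es ! i) = j" "lam' = mset (map2 (-) xs es)" using FFD[OF lam'] by blast
    have "length ys = n" using ys xs(6,2,3) by (metis length_map length_zip min.idem size_mset)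
    moreover have "sum_list ys = r - j"
    proof -
      have "sum_list ys = sum_list (map2 (-) xs es)" using ys xs(6) by (metis sum_mset_sum_list)
      also have "\<dots> = (\<Sum>i<n. xs ! i - es ! i)" using xs(2,3) by (simp add: sum_list_nth)
      also have "\<dots> = (\<Sum>i<n. xs ! i) - (\<Sum>i<n. es ! i)"
        using xs(4) by (intro sum_subtractf_nat) force
      also have "(\<Sum>i<n. xs ! i) = r" using sumlam xs(1,2) by (metis sum_list_nth sum_mset_sum_list)
      finally show ?thesis using xs(5) by simp
    qed
    moreover have "\<forall>x\<in>set ys. x > 0"
    proof -
      have "set ys = set (map2 (-) xs es)" using ys xs(6) by (metis set_mset_mset)
      then show ?thesis using xs(2-4) by (auto simp: set_zip)
    qed
    ultimately show ?thesis by blast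
  qed
  have kill_cl: "killed_locus d n ((!) ys) \<subseteq> ?cl (Gen lam')" if "lam' \<in> FF j lam" "mset ys = lam'" for lam' ys
  proof -
    have ys: "length ys = n" "(\<Sum>i<n. ys ! i) = r - j" using ysD[OF that] by (auto simp: sum_list_nth)
    have "killed_locus d n ((!) ys) \<subseteq> ?cl (generic_killed_locus d n ((!) ys))"
      by (rule killed_subset_closure) (use ys rn j d in auto)
    also have "\<dots> \<subseteq> ?cl (Gen lam')"
    proof (rule proj_closure_least)
      have "generic_killed_locus d n ((!) ys) \<subseteq> Gen lam'" using ys(1) that(2) by (auto simp: Gen_def)
      then show "generic_killed_locus d n ((!) ys) \<subseteq> ?cl (Gen lam')" using proj_closure_superset[OF Gen_PP] by blast
    qed
    finally show ?thesis .
  qed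
  have S1_kill: "?S1 \<subseteq> (\<Union>lam'\<in>FF j lam. ?cl (Gen lam'))"
  proof
    fix L assume L: "L \<in> ?S1"
    have "\<exists>ys. mset ys \<in> FF j (mset xs0) \<and> length ys = n \<and> L \<in> killed_locus d n ((!) ys)"
      by (rule preimage_CH_subset[where r = r and j = j])
        (use pos xs0 assms(3,6) sumlam j rn d L in \<open>auto simp flip: sum_mset_sum_list set_mset_mset size_mset\<close>)
    then show "L \<in> (\<Union>lam'\<in>FF j lam. ?cl (Gen lam'))" using kill_cl xs0 by blast
  qed
  have S2_kill: "?S2 lam' \<subseteq> ?cl (Gen lam')" if lam': "lam' \<in> FF j lam" for lam'
  proof
    fix L assume L: "L \<in> ?S2 lam'"
    obtain ys where ys: "mset ys = lam'" using ex_mset by blast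
    note ysp = ysD[OF lam' ys]
    have "\<exists>zs. mset zs \<in> FF 0 (mset ys) \<and> length zs = n \<and> L \<in> killed_locus d n ((!) zs)"
      by (rule preimage_CH_subset[where r = "r - j" and j = 0]) (use ysp rn j d L ys in auto)
    then show "L \<in> ?cl (Gen lam')" using kill_cl[OF lam'] FF_0 ys by blast
  qed
  have Gen_S1: "Gen lam' \<subseteq> ?S1" if lam': "lam' \<in> FF j lam" for lam'
  proof
    fix L assume "L \<in> Gen lam'"
    then obtain ys where ys: "mset ys = lam'" "length ys = n" "L \<in> generic_killed_locus d n ((!) ys)" by (auto simp: Gen_def)
    obtain xs es where xs: "mset xs = lam" "length xs = n" "length es = n" "\<forall>i<n. es ! i \<le> 1 \<and> es ! i < xs ! i"
      "(\<Sum>i<n. es ! i) = j" "lam' = mset (map2 (-) xs es)" using FFD[OF lam'] by blast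
    let ?zs = "map2 (-) xs es"
    have "L \<in> generic_killed_locus d n ((!) ?zs)"
      using generic_killed_locus_reorder[of ys ?zs d] ys xs(2,3,6) by auto
    also have "generic_killed_locus d n ((!) ?zs) = generic_killed_locus d n (\<lambda>i. xs ! i - es ! i)"
      by (rule generic_killed_locus_cong) (use xs(2,3) in simp)
    finally have "L \<in> generic_killed_locus d n (\<lambda>i. xs ! i - es ! i)" .
    moreover have rs: "(\<Sum>i<n. xs ! i) = r" using sumlam xs(1,2) by (metis sum_list_nth sum_mset_sum_list)
    ultimately have "L \<in> apolar_preimage d r (CH r n j (locus n ((!) xs)))"
      using generic_killed_subset_preimage[where n = n and e = "(!) xs" and \<epsilon> = "(!) es" and j = j and L = L] n0 rn xs(4,5) d by simp
    moreover have "CH_root j lam = CH r n j (locus n ((!) xs))"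
      using xs(1,2) sumlam assms(3) by (auto simp: CH_root_def root_locus_eq_locus)
    ultimately show "L \<in> ?S1" by simp
  qed
  have Gen_S2: "Gen lam' \<subseteq> ?S2 lam'" if lam': "lam' \<in> FF j lam" for lam'
  proof
    fix L assume "L \<in> Gen lam'"
    then obtain ys where ys: "mset ys = lam'" "length ys = n" "L \<in> generic_killed_locus d n ((!) ys)" by (auto simp: Gen_def)
    note ysp = ysD[OF lam' ys(1)]
    have rs: "(\<Sum>i<n. ys ! i) = r - j" using ysp by (auto simp: sum_list_nth)
    have "L \<in> apolar_preimage d (r - j) (CH (r - j) n 0 (locus n ((!) ys)))"
      using generic_killed_subset_preimage[where n = n and e = "(!) ys" and \<epsilon> = "\<lambda>_. 0" and j = 0 and L = L]
        n0 rn rs ys ysp j d by (simp add: nth_mem)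
    moreover have "CH_root 0 lam' = CH (r - j) n 0 (locus n ((!) ys))"
      using ys(1,2) ysp by (auto simp: CH_root_def root_locus_eq_locus sum_mset_sum_list)
    ultimately show "L \<in> ?S2 lam'" by simp
  qed
  have S3: "dual_root (image_mset Suc lam') = ?cl (Gen lam')" if lam': "lam' \<in> FF j lam" for lam'
  proof -
    obtain ys where ys: "mset ys = lam'" using ex_mset by blast
    note ysp = ysD[OF lam' ys]
    have ds: "(\<Sum>i<n. Suc (ys ! i)) = d" using ysp rn j d by (auto simp: sum_list_nth sum_Suc)
    let ?X = "locus n (\<lambda>i. Suc (ys ! i))"
    let ?C = "{L \<in> PP (forms d). \<exists>x \<in> smooth_points (forms d) n ?X. tangent (forms d) ?X x \<subseteq> perp d L}"
    have dual: "dual_root (image_mset Suc lam') = ?cl ?C"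
      using dual_root_eq[of n ys] ysp ys unfolding dual_variety_def ds by simp
    have "?C \<subseteq> killed_locus d n ((!) ys)"
      using conormal_subset_killed[where n = n and e = "(!) ys"] unfolding ds .
    then have 1: "?C \<subseteq> ?cl (Gen lam')" using kill_cl[OF lam' ys] by blast
    have 2: "Gen lam' \<subseteq> ?C"
    proof
      fix L assume "L \<in> Gen lam'"
      then obtain zs where zs: "mset zs = lam'" "length zs = n" "L \<in> generic_killed_locus d n ((!) zs)" by (auto simp: Gen_def)
      then have "L \<in> generic_killed_locus d n ((!) ys)"
        using generic_killed_locus_reorder[of zs ys d] ys ysp by auto
      then show "L \<in> ?C"
        using generic_killed_subset_conormal[where n = n and e = "(!) ys", OF n0] unfolding ds by blast
    qed
    have "?cl ?C \<subseteq> ?cl (Gen lam')" by (rule proj_closure_least[OF 1])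
    moreover have "?cl (Gen lam') \<subseteq> ?cl ?C"
      by (rule proj_closure_least) (use 2 proj_closure_superset[of ?C "forms d"] in blast)
    ultimately show ?thesis using dual by blast
  qed
  have S2: "?cl (?S2 lam') = ?cl (Gen lam')" if lam': "lam' \<in> FF j lam" for lam'
    using proj_closure_least[OF S2_kill[OF lam']]
      proj_closure_least[OF subset_trans[OF Gen_S2[OF lam'] proj_closure_superset[OF S2_PP]]] by blast
  have S1: "?cl ?S1 = (\<Union>lam'\<in>FF j lam. ?cl (Gen lam'))"
  proof
    have "?S1 \<subseteq> ?cl (\<Union>lam'\<in>FF j lam. Gen lam')"
    proof -
      have "?cl (Gen lam') \<subseteq> ?cl (\<Union>lam'\<in>FF j lam. Gen lam')" if "lam' \<in> FF j lam" for lam'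
        using that Gen_PP proj_closure_superset[of "\<Union>lam'\<in>FF j lam. Gen lam'" "forms d"]
        by (intro proj_closure_least) blast
      then show ?thesis using S1_kill by blast
    qed
    then have "?cl ?S1 \<subseteq> ?cl (\<Union>lam'\<in>FF j lam. Gen lam')" by (rule proj_closure_least)
    also have "\<dots> \<subseteq> (\<Union>lam'\<in>FF j lam. ?cl (Gen lam'))" by (rule proj_closure_UN[OF finite_FF])
    finally show "?cl ?S1 \<subseteq> (\<Union>lam'\<in>FF j lam. ?cl (Gen lam'))" .
    show "(\<Union>lam'\<in>FF j lam. ?cl (Gen lam')) \<subseteq> ?cl ?S1"
      using Gen_S1 proj_closure_superset[OF S1_PP] by (intro UN_least proj_closure_least) blast
  qed
  show ?thesis using S1 S2 S3 by simp
qed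

end
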